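(* Assume the learning-rate assumption and the smoothness assumption stated in the context. Let $\rho_\ast=\delta_{\omega_\ast}$ be a stationary solution of $\partial_t\rho_t=2\zeta(t)\nabla_\omega\cdot\big(\rho_t\nabla_\omega\Phi(\omega;\rho_t)\big)$, and let $$H_{\mathrm{tr}}=\nabla^2_\omega\Phi(\omega_\ast;\rho_\ast)+\mathbb E_X\Big[\frac1L\sum_{l=1}^L\nabla_\omega\psi_l(X;\omega_\ast)^\top S_{l,\ast}(X)\nabla_\omega\psi_l(X;\omega_\ast)\Big],$$ where $p_{l,\ast}(X)=\mathrm{softmax}(\psi_l(X;\omega_\ast))$ and $S_{l,\ast}(X)=\mathrm{diag}(p_{l,\ast}(X))-p_{l,\ast}(X)p_{l,\ast}(X)^\top$. If there exists $v\in\mathbb R^{d_\omega}$ with $\|v\|=1$ such that $$v^\top H_{\mathrm{tr}}v<0,$$ then $\rho_\ast$ is Lyapunov unstable in $W_2$. More precisely, for all sufficiently small $\varepsilon>0$, the solution $\rho_t^\varepsilon$ starting from $\rho_0^\varepsilon=\delta_{\omega_\ast+\varepsilon v}$ initially moves away from $\rho_\ast$: $$\frac{d}{dt}W_2(\rho_t^\varepsilon,\rho_\ast)^2\Big|_{t=0}>0.$$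
   Context: Model. Fix positive integers $L,d_x,d_k,d_v$ and a fixed matrix $W_{\mathrm{out}}\in\mathbb R^{d_x\times d_v}$. A head parameter is $\omega=(W_Q,W_K,W_V,W_O)\in\mathbb R^{d_x\times d_k}\times\mathbb R^{d_x\times d_k}\times\mathbb R^{d_x\times d_k}\times\mathbb R^{d_k\times d_x}$, identified with a vector in $\mathbb R^{d_\omega}$. For an input $X\in\mathbb R^{L\times d_x}$ (rows are tokens), the causally masked attention matrix $A_\omega(X)\in\mathbb R^{L\times L}$ has entries $$A_\omega(X)_{rs}=\frac{\exp\big((XW_QW_K^\top X^\top)_{rs}/\sqrt{d_k}\big)}{\sum_{s'\le r}\exp\big((XW_QW_K^\top X^\top)_{rs'}/\sqrt{d_k}\big)}\ (s\le r),\qquad A_\omega(X)_{rs}=0\ (s>r).$$ $\psi_l(X;\omega)\in\mathbb R^{d_v}$ is the $l$-th row of $A_\omega(X)XW_VW_OW_{\mathrm{out}}$, $l=1,\dots,L$, and $\nabla_\omega\psi_l(X;\omega)\in\mathbb R^{d_v\times d_\omega}$ is its Jacobian. Data and first variation. $X$ is a random input and $Y_l(X)\in\mathbb R^{d_v}$ is a one-hot label for each $l$; $\mathbb E_X$ is expectation over $X$. $\mathrm{softmax}_j(z)=e^{z_j}/\sum_m e^{z_m}$. For a probability measure $\rho$ on $\mathbb R^{d_\omega}$, $z_l^\rho(X)=\int\psi_l(X;\omega)\,\rho(d\omega)$, and $$\Phi(\omega;\rho)=\mathbb E_X\Big[\frac1L\sum_{l=1}^L\big\langle\mathrm{softmax}(z_l^\rho(X))-Y_l(X),\psi_l(X;\omega)\big\rangle\Big].$$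 $\nabla_\omega$ and $\nabla_\omega^2$ act on the first argument of $\Phi$ with the measure argument held fixed. Solutions. A weak solution of the PDE is a narrowly continuous curve $t\mapsto\rho_t\in\mathcal P(K)$ such that for every $f\in C^1(K)$, $\frac{d}{dt}\int f\,d\rho_t=-2\zeta(t)\int\langle\nabla f(\omega),\nabla_\omega\Phi(\omega;\rho_t)\rangle\,\rho_t(d\omega)$ in the sense of distributions in time; equivalently $\rho_t$ is the law of $W_t$ with $\dot W_t=-2\zeta(t)\nabla_\omega\Phi(W_t;\rho_t)$, $W_0\sim\rho_0$. A measure is a stationary solution if the constant curve at it is a weak solution. $W_2$ is the 2-Wasserstein distance. A stationary $\rho_\ast$ is Lyapunov stable in $W_2$ if for every $\eta>0$ there is $\delta>0$ such that $W_2(\rho_0,\rho_\ast)<\delta$ implies $W_2(\rho_t,\rho_\ast)<\eta$ for all $t\ge0$; it is Lyapunov unstable otherwise. Learning-rate assumption. $\zeta:[0,\infty)\to[0,\infty)$ is bounded and Lipschitz, and $\int_0^\infty\zeta(t)\,dt=\infty$. Smoothness assumption. $K\subset\mathbb R^{d_\omega}$ and $K_x\subset\mathbb R^{d_x}$ are compact, all measures considered (including the solutions above) are supported in $K$, all input tokens lie in $K_x$ (so $X\in K_x^L$), the maps $\omega\mapsto\psi_l(X;\omega)$ are $C^3$ on $K$ for all $l$ and almost every $X$, and there is $B_\psi<\infty$ with $$\sup_{X\in K_x^L,\,1\le l\le L,\,\omega\in K}\big(\|\psi_l(X;\omega)\|+\|\nabla_\omega\psi_l(X;\omega)\|+\|\nabla^2_\omega\psi_l(X;\omega)\|+\|\nabla^3_\omega\psi_l(X;\omega)\|\big)\le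 B_\psi.$$
   Formalization: The strict inequality for the derivative at t=0 is claimed only if ζ(0)>0 (if ζ(0)=0 that derivative is 0); instability is proved for all admissible ζ. That the solutions from δ_{ω*+εv} exist in P(K) for small ε>0 is taken as a standing assumption. *)

theory Defs
  imports "HOL-Probability.Probability"
begin

section \<open>Derivatives\<close>

definition gradient :: "('a::euclidean_space \<Rightarrow> real) \<Rightarrow> 'a \<Rightarrow> 'a" where
  "gradient f x = (THE g. GDERIV f x :> g)"

text \<open>The Jacobian as a bounded linear map. Iterating it gives the higher derivatives, with
  the operator norm of multilinear maps.\<close>

definition jacobian ::
  "('a::euclidean_space \<Rightarrow> 'b::real_normed_vector) \<Rightarrow> 'a \<Rightarrow> 'a \<Rightarrow>\<^sub>L 'b" where
  "jacobian f x = Blinfun (frechet_derivative f (at x))"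

text \<open>Smoothness on a possibly thin set \<open>K\<close> means smoothness on an open neighbourhood of \<open>K\<close>.\<close>

definition C3_on :: "'a::euclidean_space set \<Rightarrow> ('a \<Rightarrow> 'b::real_normed_vector) \<Rightarrow> bool" where
  "C3_on K f \<longleftrightarrow> (\<exists>U. open U \<and> K \<subseteq> U \<and>
     (\<forall>x\<in>U. f differentiable (at x)) \<and>
     (\<forall>x\<in>U. jacobian f differentiable (at x)) \<and>
     (\<forall>x\<in>U. jacobian (jacobian f) differentiable (at x)) \<and>
     continuous_on U (jacobian (jacobian (jacobian f))))"

definition C1_function :: "('a::euclidean_space \<Rightarrow> real) \<Rightarrow> bool" where
  "C1_function f \<longleftrightarrow> (\<forall>x. f differentiable (at x)) \<and> continuous_on UNIV (gradient f)"

section \<open>The attention head\<close>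

text \<open>
  \<open>real ^ 'n ^ 'm\<close> is the type of matrices with rows indexed by \<open>'m\<close> and columns by \<open>'n\<close>.
  The token positions \<open>1, \<dots>, L\<close> form a finite linear order \<open>'l\<close>, and the dimensions
  \<open>d_x, d_k, d_v\<close> are \<open>CARD('x), CARD('k), CARD('v)\<close>. A head parameter is the tuple
  \<open>(W_Q, W_K, W_V, W_O)\<close>; the product Euclidean structure on this type is that of the
  vector of all matrix entries.
\<close>

type_synonym ('x, 'k) head =
  "(real ^ 'k ^ 'x) \<times> (real ^ 'k ^ 'x) \<times> (real ^ 'k ^ 'x) \<times> (real ^ 'x ^ 'k)"

type_synonym ('x, 'l) tokens = "real ^ 'x ^ 'l"

definition scores ::
  "('x::finite, 'k::finite) head \<Rightarrow> ('x, 'l::{finite,linorder}) tokens \<Rightarrow> ((real, 'l) vec, 'l) vec" where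
  "scores \<omega> X = (case \<omega> of (WQ, WK, WV, WO) \<Rightarrow> X ** WQ ** transpose WK ** transpose X)"

definition attention ::
  "('x::finite, 'k::finite) head \<Rightarrow> ('x, 'l::{finite,linorder}) tokens \<Rightarrow> ((real, 'l) vec, 'l) vec" where
  "attention \<omega> X = (\<chi> r s. if s \<le> r
     then exp (scores \<omega> X $ r $ s / sqrt (real CARD('k))) /
          (\<Sum>s'\<in>{..r}. exp (scores \<omega> X $ r $ s' / sqrt (real CARD('k))))
     else 0)"

definition head_output ::
  "real ^ 'v ^ 'x \<Rightarrow> 'l::{finite,linorder} \<Rightarrow> ('x, 'l) tokens \<Rightarrow>
   ('x::finite, 'k::finite) head \<Rightarrow> real ^ 'v::finite" where
  "head_output Wout l X \<omega> = (case \<omega> of (WQ, WK, WV, WO) \<Rightarrow>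
     (attention \<omega> X ** X ** WV ** WO ** Wout) $ l)"

section \<open>First variation\<close>

definition softmax :: "real ^ 'v::finite \<Rightarrow> real ^ 'v" where
  "softmax z = (\<chi> j. exp (z $ j) / (\<Sum>m\<in>UNIV. exp (z $ m)))"

definition softmax_cov :: "real ^ 'v::finite \<Rightarrow> real ^ 'v ^ 'v" where
  "softmax_cov p = (\<chi> i j. (if i = j then p $ i else 0) - p $ i * p $ j)"

definition one_hot :: "real ^ 'v::finite \<Rightarrow> bool" where
  "one_hot y \<longleftrightarrow> (\<exists>j. y = axis j 1)"

definition mean_logits ::
  "real ^ 'v ^ 'x \<Rightarrow> ('x::finite, 'k::finite) head measure \<Rightarrow> 'l::{finite,linorder} \<Rightarrow> ('x, 'l) tokens \<Rightarrow>
   real ^ 'v::finite" where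
  "mean_logits Wout \<rho> l X = (\<integral>\<omega>. head_output Wout l X \<omega> \<partial>\<rho>)"

text \<open>\<open>D\<close> is the law of the random input \<open>X\<close>.\<close>

definition first_variation ::
  "('x, 'l::{finite,linorder}) tokens measure \<Rightarrow> real ^ 'v::finite ^ 'x \<Rightarrow>
   ('l \<Rightarrow> ('x, 'l) tokens \<Rightarrow> real ^ 'v) \<Rightarrow>
   ('x::finite, 'k::finite) head measure \<Rightarrow> ('x, 'k) head \<Rightarrow> real" where
  "first_variation D Wout Y \<rho> \<omega> =
     (\<integral>X. (1 / real CARD('l)) *
        (\<Sum>l\<in>UNIV. (softmax (mean_logits Wout \<rho> l X) - Y l X) \<bullet> head_output Wout l X \<omega>) \<partial>D)"

text \<open>
  The linear map \<open>u \<mapsto> H_tr u\<close>; the Hessian is the derivative of the gradient, and the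
  expectation in the second summand is taken after applying the matrix to \<open>u\<close>.
\<close>

definition H_tr ::
  "('x, 'l::{finite,linorder}) tokens measure \<Rightarrow> real ^ 'v::finite ^ 'x \<Rightarrow>
   ('l \<Rightarrow> ('x, 'l) tokens \<Rightarrow> real ^ 'v) \<Rightarrow>
   ('x::finite, 'k::finite) head \<Rightarrow> ('x, 'k) head \<Rightarrow> ('x, 'k) head" where
  "H_tr D Wout Y \<omega>s u =
     jacobian (gradient (first_variation D Wout Y (return borel \<omega>s))) \<omega>s u +
     (\<integral>X. (1 / real CARD('l)) *\<^sub>R
        (\<Sum>l\<in>UNIV.
           let J = blinfun_apply (jacobian (head_output Wout l X) \<omega>s);
               S = softmax_cov (softmax (head_output Wout l X \<omega>s))
           in adjoint J (S *v J u)) \<partial>D)"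

section \<open>Standing assumptions\<close>

definition learning_rate_assumption :: "(real \<Rightarrow> real) \<Rightarrow> bool" where
  "learning_rate_assumption \<zeta> \<longleftrightarrow>
     (\<forall>t\<ge>0. 0 \<le> \<zeta> t) \<and> bounded (\<zeta> ` {0..}) \<and> (\<exists>C. C-lipschitz_on {0..} \<zeta>) \<and>
     (\<integral>\<^sup>+t\<in>{0..}. ennreal (\<zeta> t) \<partial>lborel) = \<infinity>"

definition smoothness_assumption ::
  "('x, 'l::{finite,linorder}) tokens measure \<Rightarrow> real ^ 'v::finite ^ 'x \<Rightarrow>
   ('x::finite, 'k::finite) head set \<Rightarrow> (real ^ 'x) set \<Rightarrow> bool" where
  "smoothness_assumption D Wout K Kx \<longleftrightarrow>
     compact K \<and> compact Kx \<and>
     (AE X in D. \<forall>r. X $ r \<in> Kx) \<and>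
     (AE X in D. \<forall>l. C3_on K (head_output Wout l X)) \<and>
     (\<exists>B. \<forall>(X::('x, 'l) tokens) l. \<forall>\<omega>\<in>K. (\<forall>r. X $ r \<in> Kx) \<longrightarrow>
        (let \<psi> = head_output Wout l X in
           norm (\<psi> \<omega>) + norm (jacobian \<psi> \<omega>) + norm (jacobian (jacobian \<psi>) \<omega>)
             + norm (jacobian (jacobian (jacobian \<psi>)) \<omega>) \<le> B))"

section \<open>Probability measures on \<open>K\<close> and weak solutions\<close>

text \<open>\<open>\<P>(K)\<close> is realised as the Borel probability measures on the whole space that are
  concentrated on \<open>K\<close>.\<close>

definition prob_measures_on :: "'a::euclidean_space set \<Rightarrow> 'a measure set" where
  "prob_measures_on K = {\<mu>. prob_space \<mu> \<and> sets \<mu> = sets borel \<and> (AE x in \<mu>. x \<in> K)}"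

definition narrowly_continuous :: "(real \<Rightarrow> 'a::euclidean_space measure) \<Rightarrow> bool" where
  "narrowly_continuous \<rho> \<longleftrightarrow>
     (\<forall>g::'a \<Rightarrow> real. continuous_on UNIV g \<and> bounded (range g) \<longrightarrow>
        continuous_on {0..} (\<lambda>t. \<integral>x. g x \<partial>\<rho> t))"

text \<open>\<open>C_c^\<infinity>((0, \<infinity>))\<close>.\<close>

definition time_test_function :: "(real \<Rightarrow> real) \<Rightarrow> bool" where
  "time_test_function \<phi> \<longleftrightarrow>
     (\<forall>n t. (deriv ^^ n) \<phi> differentiable (at t)) \<and>
     (\<exists>a b. 0 < a \<and> (\<forall>t. t \<notin> {a..b} \<longrightarrow> \<phi> t = 0))"

text \<open>
  The equation \<open>d/dt \<integral> f d\<rho>_t = - 2 \<zeta>(t) \<integral> \<langle>\<nabla>f, \<nabla>\<Phi>(\<cdot>; \<rho>_t)\<rangle> d\<rho>_t\<close> in the sense of distributions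
  on \<open>(0, \<infinity>)\<close>. The elements of \<open>C^1(K)\<close> are the restrictions to \<open>K\<close> of \<open>C^1\<close> functions on the
  whole space. Only the restriction of the curve to \<open>[0, \<infinity>)\<close> matters.
\<close>

definition weak_solution ::
  "('x, 'l::{finite,linorder}) tokens measure \<Rightarrow> real ^ 'v::finite ^ 'x \<Rightarrow>
   ('l \<Rightarrow> ('x, 'l) tokens \<Rightarrow> real ^ 'v) \<Rightarrow> (real \<Rightarrow> real) \<Rightarrow>
   ('x::finite, 'k::finite) head set \<Rightarrow> (real \<Rightarrow> ('x, 'k) head measure) \<Rightarrow> bool" where
  "weak_solution D Wout Y \<zeta> K \<rho> \<longleftrightarrow>
     (\<forall>t\<ge>0. \<rho> t \<in> prob_measures_on K) \<and>
     narrowly_continuous \<rho> \<and>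
     (\<forall>f \<phi>. C1_function f \<and> time_test_function \<phi> \<longrightarrow>
        - (LBINT t:{0<..}. deriv \<phi> t * (\<integral>\<omega>. f \<omega> \<partial>\<rho> t)) =
        (LBINT t:{0<..}. \<phi> t *
           (- 2 * \<zeta> t * (\<integral>\<omega>. gradient f \<omega> \<bullet> gradient (first_variation D Wout Y (\<rho> t)) \<omega> \<partial>\<rho> t))))"

definition stationary_solution ::
  "('x, 'l::{finite,linorder}) tokens measure \<Rightarrow> real ^ 'v::finite ^ 'x \<Rightarrow>
   ('l \<Rightarrow> ('x, 'l) tokens \<Rightarrow> real ^ 'v) \<Rightarrow> (real \<Rightarrow> real) \<Rightarrow>
   ('x::finite, 'k::finite) head set \<Rightarrow> ('x, 'k) head measure \<Rightarrow> bool" where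
  "stationary_solution D Wout Y \<zeta> K \<rho>s \<longleftrightarrow> weak_solution D Wout Y \<zeta> K (\<lambda>t. \<rho>s)"

section \<open>Wasserstein distance and Lyapunov stability\<close>

definition couplings ::
  "'a::euclidean_space measure \<Rightarrow> 'a measure \<Rightarrow> ('a \<times> 'a) measure set" where
  "couplings \<mu> \<nu> = {\<gamma>. prob_space \<gamma> \<and> sets \<gamma> = sets (borel \<Otimes>\<^sub>M borel) \<and>
     distr \<gamma> borel fst = \<mu> \<and> distr \<gamma> borel snd = \<nu>}"

text \<open>Only used for measures with bounded support, where the infimum is finite.\<close>

definition W2 :: "'a::euclidean_space measure \<Rightarrow> 'a measure \<Rightarrow> real" where
  "W2 \<mu> \<nu> = sqrt (enn2real
     (INF \<gamma>\<in>couplings \<mu> \<nu>. \<integral>\<^sup>+z. ennreal ((dist (fst z) (snd z))\<^sup>2) \<partial>\<gamma>))"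

definition lyapunov_stable ::
  "('x, 'l::{finite,linorder}) tokens measure \<Rightarrow> real ^ 'v::finite ^ 'x \<Rightarrow>
   ('l \<Rightarrow> ('x, 'l) tokens \<Rightarrow> real ^ 'v) \<Rightarrow> (real \<Rightarrow> real) \<Rightarrow>
   ('x::finite, 'k::finite) head set \<Rightarrow> ('x, 'k) head measure \<Rightarrow> bool" where
  "lyapunov_stable D Wout Y \<zeta> K \<rho>s \<longleftrightarrow>
     (\<forall>\<eta>>0. \<exists>\<delta>>0. \<forall>\<rho>. weak_solution D Wout Y \<zeta> K \<rho> \<and> W2 (\<rho> 0) \<rho>s < \<delta> \<longrightarrow>
        (\<forall>t\<ge>0. W2 (\<rho> t) \<rho>s < \<eta>))"

end

theory Submission
  imports Defs
begin

text \<open>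
  All integrands are explicit functions of head and tokens that are smooth in both arguments, so
  on bounded inputs every expectation may be differentiated under the integral. Testing the weak
  formulation with \<open>|\<omega> - a|\<^sup>2\<close> shows that the variance of \<open>\<rho>\<^sub>t\<close> satisfies a Gronwall inequality,
  because \<open>\<nabla>\<Phi>(\<cdot>; \<rho>)\<close> is Lipschitz on bounded sets uniformly in \<open>\<rho>\<close>. Hence a solution that starts
  at a Dirac mass stays one, \<open>\<rho>\<^sub>t = \<delta>\<^bsub>m(t)\<^esub>\<close>, with \<open>m' = - 2 \<zeta> G(m)\<close> and \<open>G(w) = \<nabla>\<Phi>(w; \<delta>\<^sub>w)\<close>.
  The derivative of \<open>G\<close> at \<open>\<omega>\<^sub>*\<close> is the symmetric operator \<open>H = H_tr\<close>, where the second summand of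
  \<open>H_tr\<close> comes from the dependence of the measure argument on \<open>w\<close>; since \<open>G(\<omega>\<^sub>*) = 0\<close>, the
  initial growth of \<open>W\<^sub>2\<^sup>2 = |m - \<omega>\<^sub>*|\<^sup>2\<close> is read off the first-order expansion of \<open>G\<close>.
  For instability pick \<open>0 < \<mu> < - \<langle>v, H v\<rangle>\<close> with \<open>A = H + \<mu>\<close> invertible. Along the flow
  \<open>V = \<langle>m - \<omega>\<^sub>*, A (m - \<omega>\<^sub>*)\<rangle>\<close> satisfies \<open>V' \<le> 4 \<mu> \<zeta> V\<close> near \<open>\<omega>\<^sub>*\<close> and starts negative, so it
  cannot stay bounded.
\<close>

section \<open>Functions of class $C^n$\<close>

text \<open>Only the weak formulation is available, so neither a flow map nor time differentiability
  may be presumed: the trajectory m and its equation are extracted from it, including the one-sided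
  derivative at time 0 that the final claim needs although test functions live on (0, \<infinity>).
  The shift by \<mu> replaces a splitting into stable and unstable directions: since |A x| is
  bounded below by a multiple of |x|, the term |A x|^2 swallows the nonlinear remainder whatever the
  signature of H, and what is left is exactly a growth inequality for V. Since \<zeta> may decay,
  growth is measured in the clock given by the integral of \<zeta>, whose divergence takes the place
  of t \<rightarrow> \<infinity>. Two hypotheses shape the statement. Measures are confined to the
  compact set K, and for K = {\<omega>s} nothing can move at all, so solutions from the perturbed
  masses are assumed to exist for small \<epsilon>. And the initial derivative of W2^2 carries the
  factor \<zeta> 0, so its positivity is claimed for \<zeta> 0 > 0.\<close>

text \<open>Class \<open>C\<^sup>n\<close> through scalar directional derivatives, which avoids operator-valued
  derivatives: the class is closed under arithmetic and \<open>exp\<close>, jointly in head and tokens.\<close>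

primrec ck :: "nat \<Rightarrow> ('a::euclidean_space \<Rightarrow> real) \<Rightarrow> bool" where
  "ck 0 f \<longleftrightarrow> continuous_on UNIV f"
| "ck (Suc n) f \<longleftrightarrow>
     (\<exists>f'. (\<forall>x. (f has_derivative f' x) (at x)) \<and> (\<forall>h. ck n (\<lambda>x. f' x h)))"

lemma ck_SucI:
  assumes "\<And>x. (f has_derivative f' x) (at x)" "\<And>h. ck n (\<lambda>x. f' x h)"
  shows "ck (Suc n) f"
  unfolding ck.simps using assms by blast

lemma ck_SucE:
  assumes "ck (Suc n) f"
  obtains f' where "\<And>x. (f has_derivative f' x) (at x)" "\<And>h. ck n (\<lambda>x. f' x h)"
  using assms unfolding ck.simps by blast

lemma ck_Suc_D: "ck (Suc n) f \<Longrightarrow> ck n f"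
proof (induction n arbitrary: f)
  case 0
  obtain f' where f': "\<And>x. (f has_derivative f' x) (at x)"
    using ck_SucE[OF 0] by metis
  have "continuous (at x) f" for x
    by (rule has_derivative_continuous[OF f'])
  then show ?case
    by (simp add: continuous_at_imp_continuous_on)
next
  case (Suc n)
  obtain f' where f': "\<And>x. (f has_derivative f' x) (at x)" "\<And>h. ck (Suc n) (\<lambda>x. f' x h)"
    using ck_SucE[OF Suc.prems] by blast
  have "ck n (\<lambda>x. f' x h)" for h
    by (rule Suc.IH[OF f'(2)])
  with f'(1) show ?case
    by (rule ck_SucI)
qed

lemma ck_const: "ck n (\<lambda>x. c)"
proof (induction n arbitrary: c)
  case (Suc n)
  show ?case by (rule ck_SucI[where f' = "\<lambda>x h. 0"], rule has_derivative_const, rule Suc)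
qed simp

lemma ck_linear:
  assumes "bounded_linear f"
  shows "ck n f"
proof (cases n)
  case 0
  then show ?thesis using assms by (simp add: linear_continuous_on)
next
  case (Suc m)
  show ?thesis
    unfolding Suc
    by (rule ck_SucI[where f' = "\<lambda>x. f"])
       (intro bounded_linear_imp_has_derivative assms ck_const)+
qed

lemma ck_add:
  assumes "ck n f" "ck n g"
  shows "ck n (\<lambda>x. f x + g x)"
  using assms
proof (induction n arbitrary: f g)
  case 0
  then show ?case by (simp add: continuous_on_add)
next
  case (Suc n)
  obtain f' where f': "\<And>x. (f has_derivative f' x) (at x)" "\<And>h. ck n (\<lambda>x. f' x h)"
    using ck_SucE[OF Suc.prems(1)] by blast
  obtain g' where g': "\<And>x. (g has_derivative g' x) (at x)" "\<And>h. ck n (\<lambda>x. g' x h)"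
    using ck_SucE[OF Suc.prems(2)] by blast
  show ?case
    by (rule ck_SucI[where f' = "\<lambda>x h. f' x h + g' x h"])
       (intro has_derivative_add Suc.IH f' g')+
qed

lemma ck_mult:
  assumes "ck n f" "ck n g"
  shows "ck n (\<lambda>x. f x * g x)"
  using assms
proof (induction n arbitrary: f g)
  case 0
  then show ?case by (simp add: continuous_on_mult)
next
  case (Suc n)
  obtain f' where f': "\<And>x. (f has_derivative f' x) (at x)" "\<And>h. ck n (\<lambda>x. f' x h)"
    using ck_SucE[OF Suc.prems(1)] by blast
  obtain g' where g': "\<And>x. (g has_derivative g' x) (at x)" "\<And>h. ck n (\<lambda>x. g' x h)"
    using ck_SucE[OF Suc.prems(2)] by blast
  show ?case
    by (rule ck_SucI[where f' = "\<lambda>x h. f x * g' x h + f' x h * g x"])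
       (intro has_derivative_mult ck_add Suc.IH f' g' Suc.prems[THEN ck_Suc_D])+
qed

lemma ck_sum: "(\<And>i. i \<in> I \<Longrightarrow> ck n (f i)) \<Longrightarrow> ck n (\<lambda>x. \<Sum>i\<in>I. f i x)"
  by (induction I rule: infinite_finite_induct) (simp_all add: ck_const ck_add)

lemma ck_exp:
  assumes "ck n f"
  shows "ck n (\<lambda>x. exp (f x))"
  using assms
proof (induction n arbitrary: f)
  case 0
  then show ?case by (simp add: continuous_on_exp)
next
  case (Suc n)
  obtain f' where f': "\<And>x. (f has_derivative f' x) (at x)" "\<And>h. ck n (\<lambda>x. f' x h)"
    using ck_SucE[OF Suc.prems] by blast
  show ?case
    by (rule ck_SucI[where f' = "\<lambda>x h. f' x h * exp (f x)"])
       (intro has_derivative_exp ck_mult Suc.IH f' Suc.prems[THEN ck_Suc_D])+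
qed

lemma ck_inverse:
  assumes "ck n f" "\<And>x. f x \<noteq> 0"
  shows "ck n (\<lambda>x. inverse (f x))"
  using assms
proof (induction n arbitrary: f)
  case 0
  then show ?case by (simp add: continuous_on_inverse)
next
  case (Suc n)
  obtain f' where f': "\<And>x. (f has_derivative f' x) (at x)" "\<And>h. ck n (\<lambda>x. f' x h)"
    using ck_SucE[OF Suc.prems(1)] by blast
  \<comment> \<open>The sign is written as the constant factor - 1 so that closure under products
    covers it.\<close>
  have "((\<lambda>x. inverse (f x)) has_derivative
      (\<lambda>h. - 1 * (inverse (f x) * f' x h * inverse (f x)))) (at x)" for x
    using Deriv.has_derivative_inverse[OF Suc.prems(2) f'(1)] by simp
  moreover have "ck n (\<lambda>x. - 1 * (inverse (f x) * f' x h * inverse (f x)))" for h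
    by (intro ck_const ck_mult f' Suc.IH Suc.prems(1)[THEN ck_Suc_D] Suc.prems(2))
  ultimately show ?case
    by (rule ck_SucI)
qed

lemma ck_divide:
  assumes "ck n f" "ck n g" "\<And>x. g x \<noteq> 0"
  shows "ck n (\<lambda>x. f x / g x)"
  unfolding divide_inverse using assms by (intro ck_mult ck_inverse)

text \<open>The derivative at a point is unique, so the anonymous witness in the definition of
  \<open>ck\<close> can be traded for \<open>frechet_derivative\<close>, which later definitions can
  name.\<close>

lemma ck_frechet:
  assumes "ck (Suc n) f"
  shows "(f has_derivative frechet_derivative f (at x)) (at x)"
    and "ck n (\<lambda>x. frechet_derivative f (at x) h)"
proof -
  obtain f' where f': "\<And>x. (f has_derivative f' x) (at x)" "\<And>h. ck n (\<lambda>x. f' x h)"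
    using ck_SucE[OF assms] by blast
  then have eq: "frechet_derivative f (at x) = f' x" for x
    using frechet_derivative_at by metis
  show "(f has_derivative frechet_derivative f (at x)) (at x)"
    "ck n (\<lambda>x. frechet_derivative f (at x) h)"
    unfolding eq using f' by blast+
qed

lemma ck_continuous: "ck n f \<Longrightarrow> continuous_on UNIV f"
  by (induction n) (use ck_Suc_D ck.simps(1) in blast)+

section \<open>Smoothness of the attention head\<close>

lemma ck_matrix_mult:
  fixes M :: "'a::euclidean_space \<Rightarrow> real ^ 'n::finite ^ 'm::finite" and N :: "'a \<Rightarrow> real ^ 'p::finite ^ 'n"
  assumes "\<And>i j. ck n (\<lambda>z. M z $ i $ j)" "\<And>i j. ck n (\<lambda>z. N z $ i $ j)"
  shows "ck n (\<lambda>z. (M z ** N z) $ i $ j)"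
  unfolding matrix_matrix_mult_def using assms by (auto intro!: ck_sum ck_mult)

lemmas bounded_linear_component_intros = bounded_linear_ident
  bounded_linear_compose[OF bounded_linear_vec_nth]
  bounded_linear_compose[OF bounded_linear_fst] bounded_linear_compose[OF bounded_linear_snd]

text \<open>Entries arise from coordinates by sums, products, \<open>exp\<close> and division by
  softmax denominators, which are sums of exponentials over the nonempty set \<open>{..r}\<close>
  and hence never zero. The causal mask compares indices only, so it creates no discontinuity.
  Tokens are a variable as well, because differentiation under the expectation needs uniformity over
  inputs.\<close>

lemma ck_head_output:
  fixes Wout :: "real ^ 'v::finite ^ 'x::finite" and l :: "'l::{finite,linorder}"
  shows "ck n (\<lambda>z::('x, 'k::finite) head \<times> ('x, 'l) tokens. head_output Wout l (snd z) (fst z) $ j)"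
proof -
  have X: "ck n (\<lambda>z::('x, 'k) head \<times> ('x, 'l) tokens. snd z $ i $ j)" for i j
    by (intro ck_linear bounded_linear_component_intros)
  have WQ: "ck n (\<lambda>z::('x, 'k) head \<times> ('x, 'l) tokens. fst (fst z) $ i $ j)"
   and WK: "ck n (\<lambda>z::('x, 'k) head \<times> ('x, 'l) tokens. fst (snd (fst z)) $ i $ j)"
   and WV: "ck n (\<lambda>z::('x, 'k) head \<times> ('x, 'l) tokens. fst (snd (snd (fst z))) $ i $ j)" for i j
    by (intro ck_linear bounded_linear_component_intros)+
  have WO: "ck n (\<lambda>z::('x, 'k) head \<times> ('x, 'l) tokens. snd (snd (snd (fst z))) $ i $ j)" for i j
    by (intro ck_linear bounded_linear_component_intros)
  have sc: "ck n (\<lambda>z::('x, 'k) head \<times> ('x, 'l) tokens. scores (fst z) (snd z) $ r $ s)" for r s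
    unfolding scores_def case_prod_beta
    using WK X
    by (intro ck_matrix_mult WQ X) (auto simp: transpose_def)
  have E: "ck n (\<lambda>z::('x, 'k) head \<times> ('x, 'l) tokens. exp (scores (fst z) (snd z) $ r $ s / sqrt (real CARD('k))))" for r s
    using sc by (intro ck_exp ck_divide ck_const) auto
  have pos: "(\<Sum>s'\<in>{..r}. exp (scores \<omega> X $ r $ s' / sqrt (real CARD('k)))) \<noteq> 0"
    for r :: 'l and \<omega> :: "('x, 'k) head" and X
    by (rule less_imp_neq[THEN not_sym], rule sum_pos) auto
  have A: "ck n (\<lambda>z::('x, 'k) head \<times> ('x, 'l) tokens. attention (fst z) (snd z) $ r $ s)" for r s
    using E pos unfolding attention_def
    by (cases "s \<le> r") (auto intro!: ck_divide ck_sum ck_const)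
  show ?thesis
    unfolding head_output_def case_prod_beta
    by (intro ck_matrix_mult A X WV WO ck_const)
qed

section \<open>Differentiation under the expectation\<close>

text \<open>Expanding in the basis turns direction-by-direction control, which is all that
  \<open>ck\<close> provides, into a bound on the whole derivative. The dimension factor is crude
  but harmless.\<close>

lemma linear_abs_le_Basis_sum:
  fixes f :: "'a::euclidean_space \<Rightarrow> real"
  assumes "linear f" "\<And>b. b \<in> Basis \<Longrightarrow> \<bar>f b\<bar> \<le> e"
  shows "\<bar>f h\<bar> \<le> real DIM('a) * e * norm h"
proof -
  have "f h = (\<Sum>b\<in>Basis. (h \<bullet> b) * f b)"
    by (subst euclidean_representation[symmetric, of h])
       (simp add: linear_sum[OF assms(1)] linear_cmul[OF assms(1)])
  also have "\<bar>\<dots>\<bar> \<le> (\<Sum>b\<in>(Basis::'a set). norm h * e)"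
    by (intro order_trans[OF sum_abs] sum_mono)
       (auto simp: abs_mult intro!: mult_mono assms Basis_le_norm)
  finally show ?thesis by (simp add: mult_ac)
qed

text \<open>The point is that d does not depend on z: directional derivatives are uniformly
  continuous on a compact neighbourhood of C, and the mean value inequality converts their small
  oscillation into a small linearization error.\<close>

lemma ck_uniform_linearization:
  fixes f :: "'a::euclidean_space \<Rightarrow> real"
  assumes f': "\<And>x. (f has_derivative f' x) (at x)" "\<And>h. continuous_on UNIV (\<lambda>x. f' x h)"
    and "compact C" "e > 0"
  obtains d where "d > 0"
    "\<And>z h. z \<in> C \<Longrightarrow> norm h < d \<Longrightarrow> \<bar>f (z + h) - f z - f' z h\<bar> \<le> e * norm h"
proof -
  \<comment> \<open>z + h may leave C, so continuity is exploited on the closed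
    1-neighbourhood.\<close>
  define T where "T = {x + y |x y. x \<in> C \<and> y \<in> cball (0::'a) 1}"
  have "compact T"
    unfolding T_def by (intro compact_sums \<open>compact C\<close> compact_cball)
  have lin: "linear (f' x)" for x
    using f'(1) has_derivative_linear by blast
  \<comment> \<open>The divisor cancels the factor \<open>DIM('a)\<close> from
    \<open>linear_abs_le_Basis_sum\<close>.\<close>
  define e' where "e' = e / real DIM('a)"
  have "e' > 0" unfolding e'_def using \<open>e > 0\<close> by simp
  have "\<forall>b\<in>Basis. \<exists>d>0. \<forall>x\<in>T. \<forall>y\<in>T. dist y x < d \<longrightarrow> dist (f' y b) (f' x b) < e'"
  proof
    fix b :: 'a
    have "uniformly_continuous_on T (\<lambda>x. f' x b)"
      by (intro compact_uniformly_continuous continuous_on_subset[OF f'(2)] \<open>compact T\<close>) simp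
    then show "\<exists>d>0. \<forall>x\<in>T. \<forall>y\<in>T. dist y x < d \<longrightarrow> dist (f' y b) (f' x b) < e'"
      using \<open>e' > 0\<close> unfolding uniformly_continuous_on_def by blast
  qed
  then obtain d where d: "\<And>b. b \<in> Basis \<Longrightarrow> 0 < d b"
    "\<And>b x y. b \<in> Basis \<Longrightarrow> x \<in> T \<Longrightarrow> y \<in> T \<Longrightarrow> dist y x < d b \<Longrightarrow> dist (f' y b) (f' x b) < e'"
    by metis
  \<comment> \<open>Inserting 1 keeps the whole ball of radius d0 around z inside T.\<close>
  define d0 where "d0 = Min (insert 1 (d ` Basis))"
  have "d0 > 0" "d0 \<le> 1" "\<And>b. b \<in> Basis \<Longrightarrow> d0 \<le> d b"
    using d(1) unfolding d0_def by (auto simp del: Min_insert)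
  note d0 = this(3)
  show thesis
  proof (rule that[OF \<open>d0 > 0\<close>])
    fix z h :: 'a
    assume z: "z \<in> C" and h: "norm h < d0"
    define S where "S = ball z d0"
    have ST: "S \<subseteq> T"
    proof
      fix x assume "x \<in> S"
      then have "x = z + (x - z)" "x - z \<in> cball 0 1"
        using \<open>d0 \<le> 1\<close> by (auto simp: S_def dist_norm norm_minus_commute)
      then show "x \<in> T" unfolding T_def using z by blast
    qed
    have "norm (f (z + h) - f z - f' z (z + h - z)) \<le> norm (z + h - z) * e"
    proof (rule differentiable_bound_linearization[where S = S and f' = f'])
      show "z + t *\<^sub>R (z + h - z) \<in> S" if "t \<in> {0..1}" for t
      proof -
        have "norm (t *\<^sub>R h) \<le> norm h"
          using that by (simp add: mult_left_le_one_le)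
        then show ?thesis
          using h by (simp add: S_def dist_norm)
      qed
      show "(f has_derivative f' x) (at x within S)" for x
        using f'(1) by (rule has_derivative_at_withinI)
      show "z \<in> S" using \<open>d0 > 0\<close> by (simp add: S_def)
      then have "z \<in> T" using ST by blast
      show "onorm (f' x - f' z) \<le> e" if "x \<in> S" for x
      proof (rule onorm_le)
        fix u
        have "\<bar>(f' x - f' z) b\<bar> \<le> e'" if "b \<in> Basis" for b
        proof -
          have "dist x z < d b" "x \<in> T"
            using \<open>x \<in> S\<close> ST d0[OF that] by (auto simp: S_def dist_commute)
          then show ?thesis
            using d(2)[OF that \<open>z \<in> T\<close>] by (simp add: dist_real_def less_imp_le)
        qed
        moreover have "linear (f' x - f' z)"
          using linear_compose_sub[OF lin lin] by (simp add: fun_diff_def)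
        ultimately have "\<bar>(f' x - f' z) u\<bar> \<le> real DIM('a) * e' * norm u"
          by (intro linear_abs_le_Basis_sum)
        then show "norm ((f' x - f' z) u) \<le> e * norm u"
          by (simp add: e'_def)
      qed
    qed
    then show "\<bar>f (z + h) - f z - f' z h\<bar> \<le> e * norm h"
      by (simp add: mult.commute)
  qed
qed

text \<open>Compactness bounds the finitely many basis derivatives, hence the operator norm;
  convexity lets the mean value inequality connect any two points.\<close>

lemma ck_Lipschitz_on_compact_convex:
  fixes f :: "'a::euclidean_space \<Rightarrow> real"
  assumes f: "ck (Suc 0) f" and C: "compact C" "convex C"
  obtains L where "L-lipschitz_on C f"
proof -
  obtain f' where f': "\<And>x. (f has_derivative f' x) (at x)" "\<And>h. ck 0 (\<lambda>x. f' x h)"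
    using ck_SucE[OF f] by blast
  have "\<forall>b\<in>Basis. \<exists>B. \<forall>x\<in>C. \<bar>f' x b\<bar> \<le> B"
  proof
    fix b :: 'a
    have "compact ((\<lambda>x. f' x b) ` C)"
      by (intro compact_continuous_image C continuous_on_subset[OF ck_continuous[OF f'(2)]]) simp
    then show "\<exists>B. \<forall>x\<in>C. \<bar>f' x b\<bar> \<le> B"
      using compact_imp_bounded[THEN bounded_iff[THEN iffD1]] by fastforce
  qed
  then obtain B where B: "\<And>b x. b \<in> Basis \<Longrightarrow> x \<in> C \<Longrightarrow> \<bar>f' x b\<bar> \<le> B b"
    by metis
  define M where "M = Max (insert 0 (B ` Basis))"
  have "M \<ge> 0" "\<And>b. b \<in> Basis \<Longrightarrow> B b \<le> M"
    unfolding M_def by (auto simp del: Max_insert)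
  then have M: "\<bar>f' x b\<bar> \<le> M" if "b \<in> Basis" "x \<in> C" for b x
    using B[OF that] that by force
  have on: "onorm (f' x) \<le> real DIM('a) * M" if "x \<in> C" for x
    using linear_abs_le_Basis_sum[OF has_derivative_linear[OF f'(1)[of x]], of M] M that
    by (intro onorm_le) auto
  have "(real DIM('a) * M)-lipschitz_on C f"
  proof (rule lipschitz_onI)
    show "0 \<le> real DIM('a) * M" using \<open>M \<ge> 0\<close> by simp
    show "dist (f x) (f y) \<le> real DIM('a) * M * dist x y" if "x \<in> C" "y \<in> C" for x y
      using differentiable_bound[OF C(2), of f f', OF has_derivative_at_withinI[OF f'(1)] on that(1,2)]
      by (simp add: dist_norm)
  qed
  then show thesis by (rule that)
qed

locale bounded_input = prob_space D
  for D :: "'b::euclidean_space measure" +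
  fixes R :: real
  assumes sets_D [measurable_cong]: "sets D = sets borel"
    and bounded_D: "AE X in D. norm X \<le> R"
begin

text \<open>The weight c stands for residuals and labels, which are merely measurable and
  essentially bounded in the input; the almost sure bound on X confines the continuous factor f to a
  compact set.\<close>

lemma integrable_bounded_mult:
  fixes f :: "'a::euclidean_space \<times> 'b \<Rightarrow> real"
  assumes f: "continuous_on UNIV f" and c: "c \<in> borel_measurable D" "AE X in D. \<bar>c X\<bar> \<le> M"
  shows "integrable D (\<lambda>X. c X * f (\<omega>, X))"
proof -
  have "compact ((\<lambda>X. f (\<omega>, X)) ` cball 0 R)"
    by (intro compact_continuous_image continuous_on_compose2[OF f] continuous_intros) auto
  from compact_imp_bounded[OF this] obtain B where "\<forall>y\<in>(\<lambda>X. f (\<omega>, X)) ` cball 0 R. norm y \<le> B"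
    unfolding bounded_iff by blast
  then have B: "\<bar>f (\<omega>, X)\<bar> \<le> B" if "norm X \<le> R" for X
    using that by simp
  have [measurable]: "(\<lambda>X. f (\<omega>, X)) \<in> borel_measurable D"
    unfolding measurable_cong_sets[OF sets_D refl]
    by (intro borel_measurable_continuous_onI continuous_on_compose2[OF f] continuous_intros) auto
  show ?thesis
  proof (rule integrable_const_bound)
    show "AE X in D. norm (c X * f (\<omega>, X)) \<le> M * B"
      using c(2) bounded_D
      by eventually_elim (use B in \<open>auto simp: abs_mult intro!: mult_mono elim: order_trans[rotated]\<close>)
    show "(\<lambda>X. c X * f (\<omega>, X)) \<in> borel_measurable D"
      using c(1) by measurable
  qed
qed

text \<open>A linearization error that is uniform over X in the ball of radius R integrates to an
  error of the same order; this takes the place of dominated difference quotients. Only the head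
  moves, hence the increments (u, 0).\<close>

lemma has_derivative_expectation:
  fixes f :: "'a::euclidean_space \<times> 'b \<Rightarrow> real"
  assumes f': "\<And>z. (f has_derivative f' z) (at z)" "\<And>h. continuous_on UNIV (\<lambda>z. f' z h)"
    and c: "c \<in> borel_measurable D" "AE X in D. \<bar>c X\<bar> \<le> M"
  shows "((\<lambda>\<omega>. \<integral>X. c X * f (\<omega>, X) \<partial>D) has_derivative
      (\<lambda>u. \<integral>X. c X * f' (\<omega>, X) (u, 0) \<partial>D)) (at \<omega>)"
  unfolding has_derivative_at_alt
proof (intro conjI allI impI)
  have lin: "linear (f' z)" for z
    using f'(1) has_derivative_linear by blast
  have cont: "continuous_on UNIV f"
    by (intro continuous_at_imp_continuous_on ballI has_derivative_continuous[OF f'(1)])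
  note int = integrable_bounded_mult[OF cont c] integrable_bounded_mult[OF f'(2) c]
  have eq: "f' (\<omega>, X) (u + w, 0) = f' (\<omega>, X) (u, 0) + f' (\<omega>, X) (w, 0)"
    "f' (\<omega>, X) (k *\<^sub>R u, 0) = k * f' (\<omega>, X) (u, 0)" for X u w k
    using linear_add[OF lin, of _ "(u, 0)" "(w, 0)"] linear_cmul[OF lin, of _ k "(u, 0)"]
    by auto
  show "bounded_linear (\<lambda>u. \<integral>X. c X * f' (\<omega>, X) (u, 0) \<partial>D)"
    unfolding linear_conv_bounded_linear[symmetric]
    by (intro linearI) (simp_all add: eq int distrib_left mult.left_commute)
  fix e :: real assume "e > 0"
  have Mpos: "M \<ge> 0"
  proof -
    have "AE X in D. 0 \<le> M"
      using c(2) by eventually_elim linarith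
    then show ?thesis by simp
  qed
  have "compact ({\<omega>} \<times> cball (0::'b) R)"
    by (intro compact_Times compact_cball) auto
  \<comment> \<open>M may be 0, hence M + 1 in the denominator.\<close>
  moreover have "e / (M + 1) > 0" using \<open>e > 0\<close> Mpos by simp
  ultimately obtain d where d: "d > 0"
    "\<And>z h. z \<in> {\<omega>} \<times> cball 0 R \<Longrightarrow> norm h < d \<Longrightarrow> \<bar>f (z + h) - f z - f' z h\<bar> \<le> e / (M + 1) * norm h"
    using ck_uniform_linearization[OF f'] by metis
  show "\<exists>d>0. \<forall>y. norm (y - \<omega>) < d \<longrightarrow>
      norm ((\<integral>X. c X * f (y, X) \<partial>D) - (\<integral>X. c X * f (\<omega>, X) \<partial>D) - (\<integral>X. c X * f' (\<omega>, X) (y - \<omega>, 0) \<partial>D))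
      \<le> e * norm (y - \<omega>)"
  proof (intro exI[of _ d] conjI allI impI d(1))
    fix y assume y: "norm (y - \<omega>) < d"
    have "(\<integral>X. c X * f (y, X) \<partial>D) - (\<integral>X. c X * f (\<omega>, X) \<partial>D) - (\<integral>X. c X * f' (\<omega>, X) (y - \<omega>, 0) \<partial>D)
        = (\<integral>X. c X * f (y, X) - c X * f (\<omega>, X) - c X * f' (\<omega>, X) (y - \<omega>, 0) \<partial>D)"
      by (simp add: int)
    also have "norm \<dots> \<le> (\<integral>X. e * norm (y - \<omega>) \<partial>D)"
    proof (rule order_trans[OF integral_norm_bound integral_mono_AE])
      show "AE X in D. norm (c X * f (y, X) - c X * f (\<omega>, X) - c X * f' (\<omega>, X) (y - \<omega>, 0)) \<le> e * norm (y - \<omega>)"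
        using c(2) bounded_D
      proof eventually_elim
        case (elim X)
        have "\<bar>f (y, X) - f (\<omega>, X) - f' (\<omega>, X) (y - \<omega>, 0)\<bar> \<le> e / (M + 1) * norm (y - \<omega>)"
          using d(2)[of "(\<omega>, X)" "(y - \<omega>, 0)"] elim y by simp
        with elim have "\<bar>c X\<bar> * \<bar>f (y, X) - f (\<omega>, X) - f' (\<omega>, X) (y - \<omega>, 0)\<bar>
            \<le> (M + 1) * (e / (M + 1) * norm (y - \<omega>))"
          using Mpos by (intro mult_mono) auto
        also have "\<dots> = e * norm (y - \<omega>)" using Mpos by simp
        finally show ?case
          by (simp add: abs_mult[symmetric] algebra_simps)
      qed
    qed (auto intro!: integrable_norm Bochner_Integration.integrable_diff int)
    finally show "norm ((\<integral>X. c X * f (y, X) \<partial>D) - (\<integral>X. c X * f (\<omega>, X) \<partial>D) - (\<integral>X. c X * f' (\<omega>, X) (y - \<omega>, 0) \<partial>D))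
      \<le> e * norm (y - \<omega>)"
      by (simp add: prob_space)
  qed
qed

end

section \<open>Test functions and weak derivatives\<close>

text \<open>The regularity half of \<open>time_test_function\<close>; the support is dealt with
  separately.\<close>

definition smooth_fun :: "(real \<Rightarrow> real) \<Rightarrow> bool" where
  "smooth_fun f \<longleftrightarrow> (\<forall>n t. (deriv ^^ n) f differentiable (at t))"

text \<open>A class of functions closed under differentiation can be iterated through forever.
  Smoothness is thus shown by exhibiting such a class, with no formula for iterated
  derivatives.\<close>

lemma smooth_fun_coinduct:
  assumes "P f"
    and "\<And>g. P g \<Longrightarrow> \<exists>g'. (\<forall>t. (g has_real_derivative g' t) (at t)) \<and> P g'"
  shows "smooth_fun f"
proof -
  have "P ((deriv ^^ n) f)" for n
  proof (induction n)
    case (Suc n)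
    then obtain g' where g': "\<forall>t. ((deriv ^^ n) f has_real_derivative g' t) (at t)" "P g'"
      using assms(2) by blast
    then have "deriv ((deriv ^^ n) f) = g'"
      using DERIV_imp_deriv by blast
    with g'(2) show ?case by simp
  qed (use assms(1) in simp)
  then show ?thesis
    unfolding smooth_fun_def using assms(2) real_differentiable_def by metis
qed

lemma smooth_fun_DERIV:
  assumes "smooth_fun f"
  shows "(f has_real_derivative deriv f t) (at t)"
proof -
  have "(deriv ^^ 0) f differentiable (at t)"
    using assms unfolding smooth_fun_def by blast
  then show ?thesis by (simp add: DERIV_deriv_iff_real_differentiable)
qed

lemma smooth_fun_deriv:
  assumes "smooth_fun f"
  shows "smooth_fun (deriv f)"
  unfolding smooth_fun_def
proof (intro allI)
  fix n t
  have "(deriv ^^ Suc n) f differentiable (at t)"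
    using assms unfolding smooth_fun_def by blast
  then show "(deriv ^^ n) (deriv f) differentiable (at t)"
    by (simp only: funpow_Suc_right comp_apply)
qed

lemma smooth_fun_antiderivative:
  assumes "\<And>t. (f has_real_derivative g t) (at t)" "smooth_fun g"
  shows "smooth_fun f"
proof (rule smooth_fun_coinduct[where P = "\<lambda>h. h = f \<or> smooth_fun h"])
  fix h assume "h = f \<or> smooth_fun h"
  then show "\<exists>g'. (\<forall>t. (h has_real_derivative g' t) (at t)) \<and> (g' = f \<or> smooth_fun g')"
    using assms smooth_fun_DERIV[of h] smooth_fun_deriv[of h] by auto
qed simp

lemma smooth_fun_diff:
  assumes "smooth_fun f" "smooth_fun g"
  shows "smooth_fun (\<lambda>t. f t - g t)"
proof (rule smooth_fun_coinduct[where P = "\<lambda>h. \<exists>f g. smooth_fun f \<and> smooth_fun g \<and> h = (\<lambda>t. f t - g t)"])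
  fix h :: "real \<Rightarrow> real"
  assume "\<exists>f g. smooth_fun f \<and> smooth_fun g \<and> h = (\<lambda>t. f t - g t)"
  then obtain f g where fg: "smooth_fun f" "smooth_fun g" "h = (\<lambda>t. f t - g t)"
    by blast
  show "\<exists>g'. (\<forall>t. (h has_real_derivative g' t) (at t)) \<and>
      (\<exists>f g. smooth_fun f \<and> smooth_fun g \<and> g' = (\<lambda>t. f t - g t))"
    unfolding fg(3)
    by (rule exI[of _ "\<lambda>t. deriv f t - deriv g t"], rule conjI)
       (intro allI DERIV_diff smooth_fun_DERIV fg exI[of _ "deriv f"] exI[of _ "deriv g"]
         conjI smooth_fun_deriv refl)+
qed (use assms in blast)

section \<open>A compactly supported smooth bump\<close>

definition bump :: "real poly \<Rightarrow> nat \<Rightarrow> real \<Rightarrow> real" where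
  "bump p k t = (if \<bar>t\<bar> < 1 then poly p t / (1 - t\<^sup>2) ^ k * exp (- 1 / (1 - t\<^sup>2)) else 0)"

text \<open>One term x^n / n! of the exponential series at x = 1 / q lies below exp (1 / q). This is
  the flatness of exp (- 1 / q) at q = 0 against every power of q.\<close>

lemma exp_minus_inverse_le:
  fixes q :: real
  assumes "q > 0"
  shows "exp (- 1 / q) \<le> fact n * q ^ n"
proof -
  have "(1 / q) ^ n / fact n \<le> exp (1 / q)"
  proof -
    have "(\<Sum>i\<in>{n}. (1 / q) ^ i /\<^sub>R fact i) \<le> (\<Sum>i. (1 / q) ^ i /\<^sub>R fact i)"
      using assms by (intro sum_le_suminf summable_exp_generic) auto
    then show ?thesis
      by (simp add: exp_def divide_inverse mult.commute)
  qed
  then show ?thesis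
    using assms by (simp add: exp_minus field_simps)
qed

lemma DERIV_zero_of_quadratic_bound:
  fixes f :: "real \<Rightarrow> real"
  assumes "\<And>t. \<bar>t - t0\<bar> \<le> 1 \<Longrightarrow> \<bar>f t\<bar> \<le> C * (t - t0)\<^sup>2"
  shows "(f has_real_derivative 0) (at t0)"
proof -
  have "f t0 = 0" using assms[of t0] by simp
  have "((\<lambda>t. (f t - f t0) / (t - t0)) \<longlongrightarrow> 0) (at t0)"
  proof (rule Lim_null_comparison)
    show "\<forall>\<^sub>F t in at t0. norm ((f t - f t0) / (t - t0)) \<le> C * \<bar>t - t0\<bar>"
    proof (rule eventually_at[THEN iffD2], intro exI[of _ 1] conjI ballI impI)
      fix t assume "t \<noteq> t0 \<and> dist t t0 < 1"
      then show "norm ((f t - f t0) / (t - t0)) \<le> C * \<bar>t - t0\<bar>"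
        using assms[of t] \<open>f t0 = 0\<close>
        by (simp add: dist_real_def divide_le_eq power2_eq_square mult.assoc)
    qed simp
    show "((\<lambda>t. C * \<bar>t - t0\<bar>) \<longlongrightarrow> 0) (at t0)"
      by (auto intro!: tendsto_eq_intros)
  qed
  then show ?thesis by (simp add: has_field_derivative_iff)
qed

text \<open>The functions polynomial times q^(-k) times exp (- 1 / q), with q = 1 - t^2, form a
  class closed under differentiation; that is why \<open>bump\<close> carries the parameters p and
  k. Quotient and chain rule raise the pole order by 2, and putting the three terms over q^(k + 2)
  gives the new polynomial. At the endpoints the exponential beats the pole.\<close>

lemma bump_DERIV:
  defines "Q \<equiv> [:1, 0, - 1:]"
  shows "(bump p k has_real_derivative
    bump (pderiv p * Q\<^sup>2 + smult (2 * real k) ([:0, 1:] * p * Q) - [:0, 2:] * p) (k + 2) t) (at t)"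
    (is "(_ has_real_derivative bump ?p _ _) _")
proof -
  have Q: "poly Q t = 1 - t\<^sup>2" for t by (simp add: Q_def power2_eq_square)
  consider "\<bar>t\<bar> < 1" | "\<bar>t\<bar> > 1" | "\<bar>t\<bar> = 1" by linarith
  then show ?thesis
  proof cases
    case 1
    then have q: "1 - t\<^sup>2 > 0" by (simp add: abs_square_less_1)
    have "((\<lambda>t. poly p t / (1 - t\<^sup>2) ^ k * exp (- 1 / (1 - t\<^sup>2))) has_real_derivative bump ?p (k + 2) t) (at t)"
    proof -
      have pow: "((\<lambda>t. inverse ((1 - t\<^sup>2) ^ k)) has_real_derivative real k * (2 * t) / (1 - t\<^sup>2) ^ (k + 1)) (at t)"
      proof -
        have "((\<lambda>t. inverse (1 - t\<^sup>2)) has_real_derivative 2 * t * (inverse (1 - t\<^sup>2))\<^sup>2) (at t)"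
          using q by (auto intro!: derivative_eq_intros simp: field_simps power2_eq_square)
        from DERIV_power[OF this, of k] show ?thesis
          unfolding power_inverse[symmetric]
          by (rule DERIV_cong) (cases k; simp add: power2_eq_square divide_inverse power_inverse mult_ac)
      qed
      have ex: "((\<lambda>t. exp (- 1 / (1 - t\<^sup>2))) has_real_derivative exp (- 1 / (1 - t\<^sup>2)) * (- (2 * t) / (1 - t\<^sup>2)\<^sup>2)) (at t)"
        using q by (auto intro!: derivative_eq_intros simp: field_simps power2_eq_square)
      define q where "q = 1 - t\<^sup>2"
      have "q > 0" using q by (simp add: q_def)
      have "bump ?p (k + 2) t =
        (poly (pderiv p) t * q\<^sup>2 + 2 * real k * t * poly p t * q - 2 * t * poly p t) / q ^ (k + 2) * exp (- 1 / q)"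
        using 1 by (simp add: bump_def Q q_def algebra_simps)
      also have "\<dots> = (poly (pderiv p) t * inverse (q ^ k) + (real k * (2 * t) / q ^ (k + 1)) * poly p t) * exp (- 1 / q)
          + exp (- 1 / q) * (- (2 * t) / q\<^sup>2) * (poly p t * inverse (q ^ k))"
        using \<open>q > 0\<close> by (simp add: field_simps power2_eq_square)
      finally have eq: "bump ?p (k + 2) t = \<dots>" .
      show ?thesis
        unfolding eq divide_inverse[of "poly p _"] q_def
        by (intro DERIV_mult[OF DERIV_mult[OF poly_DERIV pow] ex, THEN DERIV_cong])
           (simp add: algebra_simps)
    qed
    moreover have "\<forall>\<^sub>F s in nhds t. s \<in> {-1<..<1}"
      using 1 by (intro eventually_nhds_in_open) auto
    ultimately show ?thesis
      by (elim DERIV_cong_ev[OF refl _ refl, THEN iffD1, rotated])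
         (auto elim!: eventually_mono simp: bump_def)
  next
    case 2
    have "\<forall>\<^sub>F s in nhds t. s \<in> - {-1..1}"
      using 2 by (intro eventually_nhds_in_open) auto
    then have "\<forall>\<^sub>F s in nhds t. bump p k s = 0"
      by (auto elim!: eventually_mono simp: bump_def)
    moreover have "bump ?p (k + 2) t = 0"
      using 2 by (simp add: bump_def)
    ultimately show ?thesis
      using DERIV_cong_ev[OF refl, of "bump p k" "\<lambda>_. 0" t 0 0] by simp
  next
    case 3
    have "compact (poly p ` {-1..1})"
      by (intro compact_continuous_image continuous_intros) auto
    then obtain B where B: "\<forall>y\<in>poly p ` {-1..1}. norm y \<le> B"
      using compact_imp_bounded[THEN bounded_iff[THEN iffD1]] by blast
    have B': "\<bar>poly p s\<bar> \<le> B" if "\<bar>s\<bar> < 1" for s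
      using B that by (auto simp: abs_less_iff)
    have "B \<ge> 0" using B'[of 0] by simp
    \<comment> \<open>Taking the exponential bound with n = k + 2 cancels the pole and leaves (1 -
      s^2)^2 = (s - t)^2 (t + s)^2, where the last factor is at most 4.\<close>
    have "\<bar>bump p k s\<bar> \<le> (B * fact (k + 2) * 4) * (s - t)\<^sup>2" for s
    proof (cases "\<bar>s\<bar> < 1")
      case True
      then have q: "1 - s\<^sup>2 > 0" by (simp add: abs_square_less_1)
      have "t\<^sup>2 = 1" using 3 by (simp add: power2_eq_1_iff abs_if split: if_splits)
      then have "1 - s\<^sup>2 = (t - s) * (t + s)" by (simp add: power2_eq_square algebra_simps)
      then have "(1 - s\<^sup>2)\<^sup>2 = (s - t)\<^sup>2 * (t + s)\<^sup>2" by (simp add: power2_eq_square algebra_simps)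
      also have "\<dots> \<le> (s - t)\<^sup>2 * 2\<^sup>2"
        using 3 True by (intro mult_left_mono abs_le_square_iff[THEN iffD1]) auto
      finally have sq: "(1 - s\<^sup>2)\<^sup>2 \<le> (s - t)\<^sup>2 * 4" by simp
      have "\<bar>bump p k s\<bar> = \<bar>poly p s\<bar> * (exp (- 1 / (1 - s\<^sup>2)) / (1 - s\<^sup>2) ^ k)"
        using True q by (simp add: bump_def abs_mult)
      also have "\<dots> \<le> B * (fact (k + 2) * (1 - s\<^sup>2) ^ (k + 2) / (1 - s\<^sup>2) ^ k)"
        using q B'[OF True] \<open>B \<ge> 0\<close> by (intro mult_mono divide_right_mono exp_minus_inverse_le) auto
      also have "\<dots> = B * fact (k + 2) * (1 - s\<^sup>2)\<^sup>2"
        using q by (simp add: power_add power2_eq_square[of "1 - s\<^sup>2"])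
      also have "\<dots> \<le> B * fact (k + 2) * ((s - t)\<^sup>2 * 4)"
        using \<open>B \<ge> 0\<close> by (intro mult_left_mono sq) auto
      finally show ?thesis by (simp only: mult_ac)
    next
      case False
      then show ?thesis using \<open>B \<ge> 0\<close> by (simp add: bump_def)
    qed
    then have "(bump p k has_real_derivative 0) (at t)"
      by (intro DERIV_zero_of_quadratic_bound)
    then show ?thesis using 3 by (simp add: bump_def)
  qed
qed

lemma smooth_bump_exists:
  fixes a \<delta> :: real
  assumes "\<delta> > 0"
  obtains b where "smooth_fun b" "\<And>t. 0 \<le> b t" "\<And>t. 0 < b t \<longleftrightarrow> \<bar>t - a\<bar> < \<delta>"
proof
  let ?b = "\<lambda>t. bump [:1:] 0 ((t - a) / \<delta>)"
  \<comment> \<open>The factor c absorbs the powers of 1 / \<delta> produced by the chain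
    rule.\<close>
  show "smooth_fun ?b"
  proof (rule smooth_fun_coinduct[where P = "\<lambda>h. \<exists>c p k. h = (\<lambda>t. c * bump p k ((t - a) / \<delta>))"])
    fix h :: "real \<Rightarrow> real"
    assume "\<exists>c p k. h = (\<lambda>t. c * bump p k ((t - a) / \<delta>))"
    then obtain c p k where h: "h = (\<lambda>t. c * bump p k ((t - a) / \<delta>))" by blast
    obtain p' k' where p': "(bump p k has_real_derivative bump p' k' t) (at t)" for t
      using bump_DERIV by blast
    have "(h has_real_derivative (c / \<delta>) * bump p' k' ((t - a) / \<delta>)) (at t)" for t
      unfolding h
      by (rule DERIV_cmult[THEN DERIV_cong], rule DERIV_chain2[OF p'])
         (use assms in \<open>auto intro!: derivative_eq_intros\<close>)
    then show "\<exists>g'. (\<forall>t. (h has_real_derivative g' t) (at t)) \<and>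
        (\<exists>c p k. g' = (\<lambda>t. c * bump p k ((t - a) / \<delta>)))"
      by (intro exI[of _ "\<lambda>t. (c / \<delta>) * bump p' k' ((t - a) / \<delta>)"]) blast
  qed (intro exI[of _ 1] exI[of _ "[:1:]"] exI[of _ 0], simp)
  show "0 \<le> ?b t" "0 < ?b t \<longleftrightarrow> \<bar>t - a\<bar> < \<delta>" for t
    using assms by (auto simp: bump_def abs_divide)
qed

section \<open>Distributional equations in time\<close>

lemma LBINT_eq_integral_compact_support:
  fixes f :: "real \<Rightarrow> real"
  assumes "continuous_on {p..q} f" "0 < p" "\<And>t. t \<notin> {p..q} \<Longrightarrow> f t = 0"
  shows "(LBINT t:{0<..}. f t) = integral {p..q} f"
proof -
  have "(LBINT t:{0<..}. f t) = (LBINT t:{p..q}. f t)"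
    unfolding set_lebesgue_integral_def
    by (rule Bochner_Integration.integral_cong) (use assms in \<open>force simp: indicator_def\<close>)+
  also have "\<dots> = integral {p..q} f"
    using assms(1) by (intro set_borel_integral_eq_integral borel_integrable_atLeastAtMost')
  finally show ?thesis .
qed

lemma smooth_fun_imp_time_test_function:
  assumes "smooth_fun \<phi>" "0 < p" "\<And>t. t \<notin> {p..q} \<Longrightarrow> \<phi> t = 0"
  shows "time_test_function \<phi>"
  unfolding time_test_function_def
proof (intro conjI allI exI impI)
  show "(deriv ^^ n) \<phi> differentiable (at t)" for n t
    using assms(1) unfolding smooth_fun_def by blast
qed (use assms in blast)+

text \<open>A smoothed indicator of \<open>[a, c]\<close>: the difference of two translates of a primitive of a bump.\<close>

lemma step_test_function_exists:
  fixes a c \<delta> :: real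
  assumes "0 < \<delta>" "a < c"
  obtains \<phi> b\<^sub>1 b\<^sub>2 where "smooth_fun \<phi>" "\<And>t. (\<phi> has_real_derivative b\<^sub>1 t - b\<^sub>2 t) (at t)"
    "\<And>t. t \<notin> {a - \<delta><..<c + \<delta>} \<Longrightarrow> \<phi> t = 0"
    "\<And>t. 0 \<le> b\<^sub>1 t" "\<And>t. 0 < b\<^sub>1 t \<longleftrightarrow> \<bar>t - a\<bar> < \<delta>"
    "\<And>t. 0 \<le> b\<^sub>2 t" "\<And>t. 0 < b\<^sub>2 t \<longleftrightarrow> \<bar>t - c\<bar> < \<delta>"
    "continuous_on UNIV b\<^sub>1" "continuous_on UNIV b\<^sub>2"
proof -
  obtain b where b: "smooth_fun b" "\<And>t. 0 \<le> b t" "\<And>t. 0 < b t \<longleftrightarrow> \<bar>t - 0\<bar> < \<delta>"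
    using smooth_bump_exists[OF \<open>0 < \<delta>\<close>, of 0] by blast
  have contb: "isCont b t" for t
    using smooth_fun_DERIV[OF b(1)] DERIV_isCont by blast
  obtain B where B: "(B has_real_derivative b t) (at t)" for t
    using einterval_antiderivative[of "-\<infinity>" "\<infinity>" b] contb
    by (auto simp: has_real_derivative_iff_has_vector_derivative)
  have b0: "b t = 0" if "\<delta> \<le> \<bar>t\<bar>" for t
    using b(2)[of t] b(3)[of t] that by auto
  have B0: "(B has_real_derivative 0) (at t within S)" if "\<delta> \<le> \<bar>t\<bar>" for t S
    using B[of t] b0[OF that] has_field_derivative_at_within by metis
  \<comment> \<open>B is constant on either side of the bump, so its two translates cancel to the
    left of both bumps and to the right of both.\<close>
  have "\<exists>k. \<forall>t\<in>{..-\<delta>}. B t = k"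
    by (rule has_field_derivative_zero_constant) (use \<open>0 < \<delta>\<close> in \<open>auto intro!: B0\<close>)
  then obtain k1 where k1: "\<And>t. t \<le> -\<delta> \<Longrightarrow> B t = k1"
    by auto
  have "\<exists>k. \<forall>t\<in>{\<delta>..}. B t = k"
    by (rule has_field_derivative_zero_constant) (use \<open>0 < \<delta>\<close> in \<open>auto intro!: B0\<close>)
  then obtain k2 where k2: "\<And>t. t \<ge> \<delta> \<Longrightarrow> B t = k2"
    by auto
  have D: "((\<lambda>t. B (t - s)) has_real_derivative b (t - s)) (at t)" for s t
    by (rule DERIV_chain2[OF B, THEN DERIV_cong]) (auto intro!: derivative_eq_intros)
  have smb: "smooth_fun (\<lambda>t. b (t - s))" for s
  proof (rule smooth_fun_coinduct[where P = "\<lambda>h. \<exists>g. smooth_fun g \<and> h = (\<lambda>t. g (t - s))"])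
    fix h :: "real \<Rightarrow> real"
    assume "\<exists>g. smooth_fun g \<and> h = (\<lambda>t. g (t - s))"
    then obtain g where g: "smooth_fun g" "h = (\<lambda>t. g (t - s))" by blast
    have "(h has_real_derivative deriv g (t - s)) (at t)" for t
      unfolding g(2)
      by (rule DERIV_chain2[OF smooth_fun_DERIV[OF g(1)], THEN DERIV_cong]) (auto intro!: derivative_eq_intros)
    then show "\<exists>g'. (\<forall>t. (h has_real_derivative g' t) (at t)) \<and> (\<exists>g. smooth_fun g \<and> g' = (\<lambda>t. g (t - s)))"
      by (intro exI[of _ "\<lambda>t. deriv g (t - s)"]) (use smooth_fun_deriv[OF g(1)] in blast)
  qed (use b(1) in blast)
  let ?\<phi> = "\<lambda>t. B (t - a) - B (t - c)"
  have D\<phi>: "(?\<phi> has_real_derivative b (t - a) - b (t - c)) (at t)" for t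
    by (intro DERIV_diff D)
  show thesis
  proof (rule that[of ?\<phi> "\<lambda>t. b (t - a)" "\<lambda>t. b (t - c)"])
    show "smooth_fun ?\<phi>"
      by (rule smooth_fun_antiderivative[OF D\<phi>]) (intro smooth_fun_diff smb)
    show "?\<phi> t = 0" if "t \<notin> {a - \<delta><..<c + \<delta>}" for t
      using that assms k1[of "t - a"] k1[of "t - c"] k2[of "t - a"] k2[of "t - c"] by auto
    show "continuous_on UNIV (\<lambda>t. b (t - a))" "continuous_on UNIV (\<lambda>t. b (t - c))"
      by (intro continuous_at_imp_continuous_on ballI continuous_intros isCont_o2[OF _ contb])+
  qed (use D\<phi> b in auto)
qed

text \<open>Du Bois-Reymond: \<open>u\<close> minus the primitive of \<open>h\<close> cannot increase from \<open>a\<close> to \<open>c\<close>, since otherwise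
  a test function with derivative concentrated near \<open>a\<close> and \<open>c\<close> separates the two values.\<close>

lemma weak_derivative_primitive_le:
  fixes u h :: "real \<Rightarrow> real"
  assumes u: "continuous_on {0..} u" and h: "continuous_on {0..} h"
    and weak: "\<And>\<phi>. time_test_function \<phi> \<Longrightarrow>
      - (LBINT t:{0<..}. deriv \<phi> t * u t) = (LBINT t:{0<..}. \<phi> t * h t)"
    and ac: "0 < a" "a < c"
  shows "u c - integral {0..c} h \<le> u a - integral {0..a} h"
proof (rule ccontr)
  define H where "H t = integral {0..t} h" for t
  define w where "w t = u t - H t" for t
  have H': "(H has_real_derivative h t) (at t within {0..T})" if "t \<in> {0..T}" for t T
    unfolding H_def by (rule integral_has_real_derivative[OF continuous_on_subset[OF h] that]) auto
  have Hcont: "continuous_on {0..T} H" for T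
    by (rule has_derivative_continuous_on) (use H' in \<open>auto simp: has_field_derivative_def\<close>)
  assume "\<not> u c - integral {0..c} h \<le> u a - integral {0..a} h"
  then have less: "w a < w c" by (simp add: w_def H_def)
  \<comment> \<open>A level strictly between the two values: w lies below m near a and above m near
    c, which gives both bumps a nonnegative contribution.\<close>
  define m where "m = (w a + w c) / 2"
  have m: "w a < m" "m < w c" using less by (auto simp: m_def)
  have wcont: "continuous_on {0..T} w" for T
    unfolding w_def by (intro continuous_intros Hcont continuous_on_subset[OF u]) auto
  have wat: "isCont w t" if "t > 0" for t
    using continuous_on_interior[OF wcont[of "t + 1"], of t] that by simp
  have "0 < c" using ac by simp
  obtain \<delta>1 where \<delta>1: "\<delta>1 > 0" "\<And>t. \<bar>t - a\<bar> < \<delta>1 \<Longrightarrow> \<bar>w t - w a\<bar> < m - w a"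
    using wat[OF ac(1), unfolded continuous_at_eps_delta, rule_format, of "m - w a"] m(1)
    by (auto simp: dist_real_def)
  obtain \<delta>2 where \<delta>2: "\<delta>2 > 0" "\<And>t. \<bar>t - c\<bar> < \<delta>2 \<Longrightarrow> \<bar>w t - w c\<bar> < w c - m"
    using wat[OF \<open>0 < c\<close>, unfolded continuous_at_eps_delta, rule_format, of "w c - m"] m(2)
    by (auto simp: dist_real_def)
  \<comment> \<open>The bound a / 2 keeps the support of the test function inside (0,
    \<infinity>).\<close>
  define \<delta> where "\<delta> = min (a / 2) (min \<delta>1 \<delta>2)"
  have \<delta>: "\<delta> > 0" "\<delta> < a" "\<delta> \<le> \<delta>1" "\<delta> \<le> \<delta>2"
    using ac \<delta>1(1) \<delta>2(1) by (auto simp: \<delta>_def)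
  obtain \<phi> b\<^sub>1 b\<^sub>2 where \<phi>: "smooth_fun \<phi>" "\<And>t. (\<phi> has_real_derivative b\<^sub>1 t - b\<^sub>2 t) (at t)"
    "\<And>t. t \<notin> {a - \<delta><..<c + \<delta>} \<Longrightarrow> \<phi> t = 0"
    and b\<^sub>1: "\<And>t. 0 \<le> b\<^sub>1 t" "\<And>t. 0 < b\<^sub>1 t \<longleftrightarrow> \<bar>t - a\<bar> < \<delta>"
    and b\<^sub>2: "\<And>t. 0 \<le> b\<^sub>2 t" "\<And>t. 0 < b\<^sub>2 t \<longleftrightarrow> \<bar>t - c\<bar> < \<delta>"
    and bc: "continuous_on UNIV b\<^sub>1" "continuous_on UNIV b\<^sub>2"
    using step_test_function_exists[OF \<delta>(1) ac(2)] by metis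
  define p q where "p = a - \<delta>" and "q = c + \<delta>"
  have pq: "0 < p" "p < q" using \<delta> ac by (auto simp: p_def q_def)
  have sub: "{p..q} \<subseteq> {0..}" using pq by auto
  have d\<phi>: "deriv \<phi> = (\<lambda>t. b\<^sub>1 t - b\<^sub>2 t)"
    using \<phi>(2) DERIV_imp_deriv by blast
  have \<phi>0: "\<phi> p = 0" "\<phi> q = 0" "\<And>t. t \<notin> {p..q} \<Longrightarrow> \<phi> t = 0"
    using \<phi>(3) by (auto simp: p_def q_def)
  have b0: "b\<^sub>1 t - b\<^sub>2 t = 0" if "t \<notin> {p..q}" for t
  proof -
    have "\<not> \<bar>t - a\<bar> < \<delta>" "\<not> \<bar>t - c\<bar> < \<delta>"
      using that ac(2) unfolding p_def q_def by auto
    then have "b\<^sub>1 t = 0" "b\<^sub>2 t = 0"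
      using b\<^sub>1[of t] b\<^sub>2[of t] by linarith+
    then show ?thesis by simp
  qed
  have \<phi>cont: "continuous_on S \<phi>" for S
    using \<phi>(2) DERIV_isCont continuous_at_imp_continuous_on by blast
  note cont = continuous_on_subset[OF u sub] continuous_on_subset[OF h sub] \<phi>cont
    continuous_on_subset[OF bc(1) subset_UNIV] continuous_on_subset[OF bc(2) subset_UNIV]
  have "- (LBINT t:{0<..}. deriv \<phi> t * u t) = (LBINT t:{0<..}. \<phi> t * h t)"
    by (rule weak[OF smooth_fun_imp_time_test_function[OF \<phi>(1) pq(1) \<phi>0(3)]])
  moreover have "(LBINT t:{0<..}. deriv \<phi> t * u t) = integral {p..q} (\<lambda>t. (b\<^sub>1 t - b\<^sub>2 t) * u t)"
    unfolding d\<phi> by (intro LBINT_eq_integral_compact_support pq continuous_intros cont) (use b0 in simp)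
  moreover have "(LBINT t:{0<..}. \<phi> t * h t) = integral {p..q} (\<lambda>t. \<phi> t * h t)"
    by (intro LBINT_eq_integral_compact_support pq continuous_intros cont) (use \<phi>0 in simp)
  ultimately have "integral {p..q} (\<lambda>t. (b\<^sub>1 t - b\<^sub>2 t) * u t) + integral {p..q} (\<lambda>t. \<phi> t * h t) = 0"
    by simp
  then have w1: "integral {p..q} (\<lambda>t. (b\<^sub>1 t - b\<^sub>2 t) * u t + \<phi> t * h t) = 0"
    by (subst integral_add) (intro integrable_continuous_interval continuous_intros cont | simp)+
  \<comment> \<open>Integration by parts: the boundary terms of \<phi> (H + m) vanish. Subtracting
    the weak identity leaves the integral of \<phi>' (m - w), where \<phi>' is
    \<open>b\<^sub>1 - b\<^sub>2\<close>.\<close>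
  have "((\<lambda>t. (b\<^sub>1 t - b\<^sub>2 t) * (H t + m) + \<phi> t * h t) has_integral \<phi> q * (H q + m) - \<phi> p * (H p + m)) {p..q}"
  proof (rule fundamental_theorem_of_calculus)
    fix t assume t: "t \<in> {p..q}"
    have "(H has_real_derivative h t) (at t within {p..q})"
      by (rule DERIV_subset[OF H'[of t q]]) (use t pq in auto)
    then show "((\<lambda>t. \<phi> t * (H t + m)) has_vector_derivative (b\<^sub>1 t - b\<^sub>2 t) * (H t + m) + \<phi> t * h t) (at t within {p..q})"
      unfolding has_real_derivative_iff_has_vector_derivative[symmetric]
      using \<phi>(2)[THEN has_field_derivative_at_within]
      by (auto intro!: derivative_eq_intros)
  qed (use pq in simp)
  then have w2: "((\<lambda>t. (b\<^sub>1 t - b\<^sub>2 t) * (H t + m) + \<phi> t * h t) has_integral 0) {p..q}"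
    by (simp add: \<phi>0)
  have "((\<lambda>t. (b\<^sub>1 t - b\<^sub>2 t) * u t + \<phi> t * h t) has_integral 0) {p..q}"
    unfolding w1[symmetric]
    by (intro integrable_integral integrable_continuous_interval continuous_intros cont)
  from has_integral_diff[OF w2 this]
  have w3: "((\<lambda>t. (b\<^sub>1 t - b\<^sub>2 t) * (m - w t)) has_integral 0) {p..q}"
    by (simp add: w_def algebra_simps)
  have nonneg: "0 \<le> (b\<^sub>1 t - b\<^sub>2 t) * (m - w t)" for t
  proof -
    have "0 \<le> b\<^sub>1 t * (m - w t)"
    proof (cases "b\<^sub>1 t = 0")
      case False
      then have "\<bar>t - a\<bar> < \<delta>" using b\<^sub>1(1)[of t] b\<^sub>1(2)[of t] by linarith
      then show ?thesis using \<delta>1(2)[of t] \<delta>(3) b\<^sub>1(1)[of t] by (intro mult_nonneg_nonneg) linarith+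
    qed simp
    moreover have "0 \<le> b\<^sub>2 t * (w t - m)"
    proof (cases "b\<^sub>2 t = 0")
      case False
      then have "\<bar>t - c\<bar> < \<delta>" using b\<^sub>2(1)[of t] b\<^sub>2(2)[of t] by linarith
      then show ?thesis using \<delta>2(2)[of t] \<delta>(4) b\<^sub>2(1)[of t] by (intro mult_nonneg_nonneg) linarith+
    qed simp
    ultimately show ?thesis by (simp add: algebra_simps)
  qed
  have "continuous_on {p..q} (\<lambda>t. (b\<^sub>1 t - b\<^sub>2 t) * (m - w t))"
    by (intro continuous_intros cont continuous_on_subset[OF wcont[of q]]) (use pq in auto)
  then have "\<forall>t\<in>{p..q}. (b\<^sub>1 t - b\<^sub>2 t) * (m - w t) = 0"
    using integral_eq_0_iff[of p q "\<lambda>t. (b\<^sub>1 t - b\<^sub>2 t) * (m - w t)"] pq(2) nonneg w3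
    by (simp add: integral_unique)
  moreover have "a \<in> {p..q}" using \<delta> ac by (auto simp: p_def q_def)
  \<comment> \<open>The factor m - w does not vanish at a, so the two bumps agree there; then a also
    lies within \<delta>2 of c, where w exceeds m.\<close>
  ultimately have "b\<^sub>1 a = b\<^sub>2 a" using m(1) by auto
  moreover have "b\<^sub>1 a > 0" using b\<^sub>1(2) \<delta>(1) by simp
  ultimately have "\<bar>a - c\<bar> < \<delta>2"
    using b\<^sub>2(2)[of a] \<delta>(4) by simp
  then have "m < w a"
    using \<delta>2(2)[of a] by linarith
  then show False using m(1) by simp
qed

text \<open>Applying the one-sided comparison to (u, h) and to (- u, - h) makes u minus the
  primitive of h constant on (0, \<infinity>). Continuity carries the constant to 0, and so the
  right derivative at time 0 is obtained although no test function sees that point.\<close>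

lemma weak_derivative_imp_has_derivative:
  fixes u h :: "real \<Rightarrow> real"
  assumes u: "continuous_on {0..} u" and h: "continuous_on {0..} h"
    and weak: "\<And>\<phi>. time_test_function \<phi> \<Longrightarrow>
      - (LBINT t:{0<..}. deriv \<phi> t * u t) = (LBINT t:{0<..}. \<phi> t * h t)"
    and "t \<ge> 0"
  shows "(u has_real_derivative h t) (at t within {0..})"
proof -
  define w where "w t = u t - integral {0..t} h" for t
  have H': "((\<lambda>t. integral {0..t} h) has_real_derivative h t) (at t within {0..})" if "t \<ge> 0" for t
  proof -
    have "((\<lambda>t. integral {0..t} h) has_real_derivative h t) (at t within {0..t + 1})"
      by (rule integral_has_real_derivative[OF continuous_on_subset[OF h]]) (use that in auto)
    moreover have "at t within {0..t + 1} = at t within {0..}"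
      by (rule at_within_nhd[of _ "{..<t + 1}"]) auto
    ultimately show ?thesis by simp
  qed
  have wcont: "continuous_on {0..} w"
    unfolding w_def
    by (intro continuous_intros u has_derivative_continuous_on[OF H'[unfolded has_field_derivative_def]]) simp
  have le: "w c \<le> w a" if "0 < a" "a < c" for a c
    unfolding w_def by (rule weak_derivative_primitive_le[OF u h weak that])
  have ge: "w a \<le> w c" if "0 < a" "a < c" for a c
  proof -
    have "(- u c) - integral {0..c} (\<lambda>t. - h t) \<le> (- u a) - integral {0..a} (\<lambda>t. - h t)"
      by (rule weak_derivative_primitive_le[OF _ _ _ that])
         (use u h weak in \<open>auto intro!: continuous_intros simp: set_lebesgue_integral_def\<close>)
    then show ?thesis by (simp add: w_def)
  qed
  have const: "w s = w 1" if "s > 0" for s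
    using le[of s 1] ge[of s 1] le[of 1 s] ge[of 1 s] that by (cases s "1::real" rule: linorder_cases) auto
  have "w s = w 1" if "s \<ge> 0" for s
  proof (rule continuous_constant_on_closure[of "{0<..}" w "w 1"])
    show "w x = w 1" if "x \<in> {0<..}" for x
      using const that by blast
  qed (use wcont that in simp_all)
  then have eq: "u s = w 1 + integral {0..s} h" if "s \<ge> 0" for s
    using that by (simp add: w_def algebra_simps)
  have "((\<lambda>t. w 1 + integral {0..t} h) has_real_derivative h t) (at t within {0..})"
    using DERIV_add[OF DERIV_const H'[OF \<open>t \<ge> 0\<close>]] by simp
  then show ?thesis
    by (rule has_field_derivative_transform_within[of _ _ _ _ 1]) (use \<open>t \<ge> 0\<close> eq in auto)
qed

text \<open>Dirac marginals force a coupling to be carried by the single point (a, b), so every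
  coupling has the same cost and the infimum is over a constant; the Dirac mass at (a, b) shows that
  it is not over the empty set.\<close>

lemma W2_return:
  fixes a b :: "'a::euclidean_space"
  shows "W2 (return borel a) (return borel b) = dist a b"
proof -
  have nn: "(\<integral>\<^sup>+z. ennreal ((dist (fst z) (snd z))\<^sup>2) \<partial>\<gamma>) = ennreal ((dist a b)\<^sup>2)"
    if "\<gamma> \<in> couplings (return borel a) (return borel b)" for \<gamma>
  proof -
    have "prob_space \<gamma>" and sets [measurable_cong]: "sets \<gamma> = sets (borel \<Otimes>\<^sub>M borel)"
      and d: "distr \<gamma> borel fst = return borel a" "distr \<gamma> borel snd = return borel b"
      using that unfolding couplings_def by auto
    interpret prob_space \<gamma> by fact
    have "AE x in distr \<gamma> borel fst. x = a" "AE x in distr \<gamma> borel snd. x = b"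
      unfolding d by (simp_all add: AE_return)
    then have "AE z in \<gamma>. fst z = a" "AE z in \<gamma>. snd z = b"
      by (simp_all add: AE_distr_iff)
    then have "(\<integral>\<^sup>+z. ennreal ((dist (fst z) (snd z))\<^sup>2) \<partial>\<gamma>) = (\<integral>\<^sup>+z. ennreal ((dist a b)\<^sup>2) \<partial>\<gamma>)"
      by (intro nn_integral_cong_AE) auto
    then show ?thesis by (simp add: emeasure_space_1)
  qed
  have "return (borel \<Otimes>\<^sub>M borel) (a, b) \<in> couplings (return borel a) (return borel b)"
    unfolding couplings_def
    by (auto intro!: prob_space_return simp: space_pair_measure distr_return)
  then have "couplings (return borel a) (return borel b) \<noteq> {}" by blast
  then show ?thesis
    unfolding W2_def by (simp add: nn cong: INF_cong)
qed

section \<open>Instability of gradient flows\<close>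

text \<open>The mean value theorem is applied twice: along u to the difference of f across s w, then
  along w to the directional derivative. The difference on the left is symmetric in u and w while
  the right side is not, which is what Schwarz's theorem exploits.\<close>

lemma mixed_second_difference:
  fixes f :: "'a::euclidean_space \<Rightarrow> real"
  assumes f: "\<And>x. (f has_derivative f' x) (at x)"
    and f2: "\<And>x. ((\<lambda>x. f' x u) has_derivative f2 x) (at x)" and "s > 0"
  obtains \<theta> \<theta>' where "0 < \<theta>" "\<theta> < s" "0 < \<theta>'" "\<theta>' < s"
    "f (x + s *\<^sub>R u + s *\<^sub>R w) - f (x + s *\<^sub>R u) - f (x + s *\<^sub>R w) + f x
      = s * s * f2 (x + \<theta> *\<^sub>R u + \<theta>' *\<^sub>R w) w"
proof -
  have line: "((\<lambda>t. g (y + t *\<^sub>R h)) has_real_derivative g' (y + t *\<^sub>R h) h) (at t)"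
    if "\<And>x. (g has_derivative g' x) (at x)" for g :: "'a \<Rightarrow> real" and g' y h t
  proof -
    have "((\<lambda>t. g (y + t *\<^sub>R h)) has_derivative (\<lambda>r. g' (y + t *\<^sub>R h) (r *\<^sub>R h))) (at t)"
      by (rule has_derivative_compose[OF _ that]) (auto intro!: derivative_eq_intros)
    moreover have "g' (y + t *\<^sub>R h) (r *\<^sub>R h) = g' (y + t *\<^sub>R h) h * r" for r
      using linear_cmul[OF has_derivative_linear[OF that], of _ r h] by (simp add: mult.commute)
    ultimately show ?thesis by (simp add: has_field_derivative_def)
  qed
  define \<phi> where "\<phi> t = f ((x + s *\<^sub>R w) + t *\<^sub>R u) - f (x + t *\<^sub>R u)" for t
  have "(\<phi> has_real_derivative f' ((x + s *\<^sub>R w) + t *\<^sub>R u) u - f' (x + t *\<^sub>R u) u) (at t)" for t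
    unfolding \<phi>_def by (intro DERIV_diff line[where g' = f'] f)
  from MVT2[OF \<open>s > 0\<close>, of \<phi>, OF this] obtain \<theta> where \<theta>: "0 < \<theta>" "\<theta> < s"
    "\<phi> s - \<phi> 0 = s * (f' ((x + s *\<^sub>R w) + \<theta> *\<^sub>R u) u - f' (x + \<theta> *\<^sub>R u) u)"
    by auto
  have "((\<lambda>t. f' ((x + \<theta> *\<^sub>R u) + t *\<^sub>R w) u) has_real_derivative f2 ((x + \<theta> *\<^sub>R u) + t *\<^sub>R w) w) (at t)" for t
    by (rule line[of "\<lambda>x. f' x u" f2, OF f2])
  from MVT2[OF \<open>s > 0\<close>, of "\<lambda>t. f' ((x + \<theta> *\<^sub>R u) + t *\<^sub>R w) u", OF this] obtain \<theta>' where \<theta>': "0 < \<theta>'" "\<theta>' < s"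
    "f' ((x + \<theta> *\<^sub>R u) + s *\<^sub>R w) u - f' (x + \<theta> *\<^sub>R u) u = s * f2 ((x + \<theta> *\<^sub>R u) + \<theta>' *\<^sub>R w) w"
    by auto
  show thesis
    by (rule that[OF \<theta>(1,2) \<theta>'(1,2)]) (use \<theta>(3) \<theta>'(3) in \<open>simp add: \<phi>_def algebra_simps\<close>)
qed

text \<open>Schwarz's theorem: both mixed derivatives are limits of the same second difference quotient.\<close>

lemma ck_second_derivative_symmetric:
  fixes f :: "'a::euclidean_space \<Rightarrow> real"
  assumes f: "ck (Suc (Suc 0)) f"
  defines "f' \<equiv> \<lambda>x. frechet_derivative f (at x)"
  shows "frechet_derivative (\<lambda>x. f' x u) (at x) w = frechet_derivative (\<lambda>x. f' x w) (at x) u"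
proof (rule ccontr)
  define f2 where "f2 u x w = frechet_derivative (\<lambda>x. f' x u) (at x) w" for u x w
  have D1: "(f has_derivative f' x) (at x)" for x
    unfolding f'_def by (rule ck_frechet[OF f])
  have C1: "ck (Suc 0) (\<lambda>x. f' x u)" for u
    unfolding f'_def by (rule ck_frechet[OF f])
  have D2: "((\<lambda>x. f' x u) has_derivative f2 u x) (at x)" for u x
    unfolding f2_def by (rule ck_frechet[OF C1])
  have C2: "continuous_on UNIV (\<lambda>x. f2 u x w)" for u w
    unfolding f2_def using ck_frechet(2)[OF C1] by simp
  have lim: "\<exists>d>0. \<forall>y. dist y x < d \<longrightarrow> \<bar>f2 u y w - f2 u x w\<bar> < e" if "e > 0" for u w e
    using C2[of u w] that unfolding continuous_on_iff dist_real_def by auto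
  assume "frechet_derivative (\<lambda>x. f' x u) (at x) w \<noteq> frechet_derivative (\<lambda>x. f' x w) (at x) u"
  then have ne: "f2 u x w \<noteq> f2 w x u" by (simp add: f2_def)
  define e where "e = \<bar>f2 u x w - f2 w x u\<bar> / 2"
  have "e > 0" using ne by (simp add: e_def)
  obtain d1 where d1: "d1 > 0" "\<And>y. dist y x < d1 \<Longrightarrow> \<bar>f2 u y w - f2 u x w\<bar> < e"
    using lim[OF \<open>e > 0\<close>] by blast
  obtain d2 where d2: "d2 > 0" "\<And>y. dist y x < d2 \<Longrightarrow> \<bar>f2 w y u - f2 w x u\<bar> < e"
    using lim[OF \<open>e > 0\<close>] by blast
  \<comment> \<open>Keeps every intermediate point within both moduli of continuity; the + 1 avoids
    division by zero.\<close>
  define s where "s = min d1 d2 / (norm u + norm w + 1)"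
  have s: "s > 0" using d1 d2 by (simp add: s_def add_nonneg_pos)
  have near: "dist (x + \<theta> *\<^sub>R a + \<theta>' *\<^sub>R b) x < min d1 d2"
    if "0 < \<theta>" "\<theta> < s" "0 < \<theta>'" "\<theta>' < s" "norm a + norm b = norm u + norm w" for \<theta> \<theta>' a b
  proof -
    have "dist (x + \<theta> *\<^sub>R a + \<theta>' *\<^sub>R b) x = norm (\<theta> *\<^sub>R a + \<theta>' *\<^sub>R b)"
      by (simp add: dist_norm add.assoc)
    also have "\<dots> \<le> \<theta> * norm a + \<theta>' * norm b"
      using that by (intro order_trans[OF norm_triangle_ineq]) auto
    also have "\<dots> \<le> s * norm a + s * norm b"
      using that by (intro add_mono mult_right_mono) auto
    also have "\<dots> = s * (norm u + norm w)"
      using that(5) by (simp add: distrib_left[symmetric])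
    also have "\<dots> < s * (norm u + norm w + 1)"
      using s by simp
    also have "\<dots> = min d1 d2"
      using norm_ge_zero[of u] norm_ge_zero[of w] unfolding s_def
      by (simp add: add_nonneg_eq_0_iff less_imp_neq[THEN not_sym] add_nonneg_pos)
    finally show ?thesis .
  qed
  obtain \<theta>1 \<theta>1' where 1: "0 < \<theta>1" "\<theta>1 < s" "0 < \<theta>1'" "\<theta>1' < s"
    "f (x + s *\<^sub>R u + s *\<^sub>R w) - f (x + s *\<^sub>R u) - f (x + s *\<^sub>R w) + f x
      = s * s * f2 u (x + \<theta>1 *\<^sub>R u + \<theta>1' *\<^sub>R w) w"
    by (rule mixed_second_difference[OF D1 D2 s])
  obtain \<theta>2 \<theta>2' where 2: "0 < \<theta>2" "\<theta>2 < s" "0 < \<theta>2'" "\<theta>2' < s"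
    "f (x + s *\<^sub>R w + s *\<^sub>R u) - f (x + s *\<^sub>R w) - f (x + s *\<^sub>R u) + f x
      = s * s * f2 w (x + \<theta>2 *\<^sub>R w + \<theta>2' *\<^sub>R u) u"
    by (rule mixed_second_difference[OF D1 D2 s])
  have "s * s * f2 u (x + \<theta>1 *\<^sub>R u + \<theta>1' *\<^sub>R w) w = s * s * f2 w (x + \<theta>2 *\<^sub>R w + \<theta>2' *\<^sub>R u) u"
    unfolding 1(5)[symmetric] 2(5)[symmetric] by (simp add: algebra_simps)
  then have "f2 u (x + \<theta>1 *\<^sub>R u + \<theta>1' *\<^sub>R w) w = f2 w (x + \<theta>2 *\<^sub>R w + \<theta>2' *\<^sub>R u) u"
    using s by simp
  moreover have "\<bar>f2 u (x + \<theta>1 *\<^sub>R u + \<theta>1' *\<^sub>R w) w - f2 u x w\<bar> < e"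
    using near[OF 1(1-4), of u w] by (intro d1(2)) simp
  moreover have "\<bar>f2 w (x + \<theta>2 *\<^sub>R w + \<theta>2' *\<^sub>R u) u - f2 w x u\<bar> < e"
    using near[OF 2(1-4), of w u] by (intro d2(2)) simp
  moreover have "\<bar>f2 u x w - f2 w x u\<bar> \<le> \<bar>z - f2 u x w\<bar> + \<bar>z - f2 w x u\<bar>" for z
    by linarith
  ultimately show False unfolding e_def by (smt (verit) field_sum_of_halves)
qed

section \<open>The escape estimate and its linear algebra\<close>

lemma nonincreasing_of_derivative_within:
  fixes f :: "real \<Rightarrow> real"
  assumes "\<And>t. t \<ge> 0 \<Longrightarrow> (f has_real_derivative f' t) (at t within {0..})"
    "\<And>t. t \<ge> 0 \<Longrightarrow> f' t \<le> 0" "t \<ge> 0"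
  shows "f t \<le> f 0"
proof -
  have "\<exists>x\<in>{0..t}. f t - f 0 = (*) (f' x) (t - 0)"
  proof (rule mvt_very_simple)
    fix x assume "0 \<le> x" "x \<le> t"
    then have "(f has_real_derivative f' x) (at x within {0..t})"
      by (intro DERIV_subset[OF assms(1)]) auto
    then show "(f has_derivative (*) (f' x)) (at x within {0..t})"
      by (simp add: has_field_derivative_def)
  qed (use assms in simp)
  then obtain x where "x \<in> {0..t}" "f t - f 0 = f' x * t" by auto
  moreover have "f' x * t \<le> 0"
    using assms(2)[of x] \<open>x \<in> {0..t}\<close> \<open>t \<ge> 0\<close> by (intro mult_nonpos_nonneg) auto
  ultimately show ?thesis by linarith
qed

text \<open>\<open>gradient\<close> is a definite description, so a representing vector is built
  from the basis values of the derivative and shown to be the only one.\<close>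

lemma gradient_inner:
  fixes f :: "'a::euclidean_space \<Rightarrow> real"
  assumes "(f has_derivative f') (at x)"
  shows "gradient f x \<bullet> h = f' h" "h \<bullet> gradient f x = f' h"
proof -
  define g where "g = (\<Sum>b\<in>Basis. f' b *\<^sub>R b)"
  have eq: "f' = (\<lambda>h. h \<bullet> g)"
  proof
    fix h
    have "f' h = f' (\<Sum>b\<in>Basis. (h \<bullet> b) *\<^sub>R b)"
      by (simp add: euclidean_representation)
    also have "\<dots> = h \<bullet> g"
      unfolding g_def
      by (simp add: linear_sum[OF has_derivative_linear[OF assms]]
          linear_cmul[OF has_derivative_linear[OF assms]] inner_sum_right mult.commute)
    finally show "f' h = h \<bullet> g" .
  qed
  have "gradient f x = g"
    unfolding gradient_def
  proof (rule the_equality)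
    show "GDERIV f x :> g" using assms unfolding gderiv_def eq .
    fix g' assume "GDERIV f x :> g'"
    then have "(\<lambda>h. h \<bullet> g') = (\<lambda>h. h \<bullet> g)"
      using assms has_derivative_unique unfolding gderiv_def eq by blast
    then show "g' = g" by (metis vector_eq_ldot)
  qed
  then show "gradient f x \<bullet> h = f' h" "h \<bullet> gradient f x = f' h"
    unfolding eq by (simp_all add: inner_commute)
qed

text \<open>Eigenvectors for distinct eigenvalues of a symmetric map are orthogonal, hence
  independent, and in finite dimension there are finitely many of them. This serves to find a shift
  that avoids the spectrum.\<close>

lemma symmetric_finite_eigenvalues:
  fixes A :: "'a::euclidean_space \<Rightarrow> 'a"
  assumes "linear A" and sym: "\<And>x y. A x \<bullet> y = x \<bullet> A y"
  shows "finite {c. \<exists>x. x \<noteq> 0 \<and> A x = c *\<^sub>R x}"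
proof -
  let ?E = "{c. \<exists>x. x \<noteq> 0 \<and> A x = c *\<^sub>R x}"
  define e where "e c = (SOME x. x \<noteq> 0 \<and> A x = c *\<^sub>R x)" for c
  have e: "e c \<noteq> 0 \<and> A (e c) = c *\<^sub>R e c" if "c \<in> ?E" for c
    unfolding e_def by (rule someI_ex) (use that in blast)
  have orth: "e c \<bullet> e d = 0" if "c \<in> ?E" "d \<in> ?E" "c \<noteq> d" for c d
    using sym[of "e c" "e d"] e[OF that(1)] e[OF that(2)] that(3) by simp
  have "pairwise orthogonal (e ` ?E)"
    unfolding pairwise_def orthogonal_def using orth by (metis (no_types, lifting) imageE)
  moreover have "0 \<notin> e ` ?E" using e by (metis (no_types, lifting) imageE)
  ultimately have "independent (e ` ?E)"
    by (rule pairwise_orthogonal_independent)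
  then have "finite (e ` ?E)" by (rule independent_imp_finite)
  moreover have "inj_on e ?E"
  proof (rule inj_onI, rule ccontr)
    fix c d assume "c \<in> ?E" "d \<in> ?E" "e c = e d" "c \<noteq> d"
    then have "e c \<bullet> e c = 0" using orth[of c d] by simp
    then show False using e[OF \<open>c \<in> ?E\<close>] by simp
  qed
  ultimately show ?thesis by (rule finite_imageD)
qed

text \<open>The radius is fixed before \<epsilon> and m, the order of quantifiers that instability
  requires. It is the radius within which the linearization error of G is at most k |x|, with k the
  lower bound of A.\<close>

lemma gradient_flow_leaves_neighbourhood:
  fixes G H :: "'a::euclidean_space \<Rightarrow> 'a" and \<zeta> :: "real \<Rightarrow> real"
  assumes G: "(G has_derivative H) (at p)" "G p = 0"
    and sym: "\<And>x y. H x \<bullet> y = x \<bullet> H y"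
    and neg: "v \<bullet> H v < 0" and "norm v = 1"
    and \<zeta>: "continuous_on {0..} \<zeta>" "\<And>t. t \<ge> 0 \<Longrightarrow> 0 \<le> \<zeta> t"
    and diverges: "\<And>M. \<exists>t\<ge>0. M < integral {0..t} \<zeta>"
  obtains \<eta> where "\<eta> > 0"
    "\<And>\<epsilon> m. \<epsilon> > 0 \<Longrightarrow> m 0 = p + \<epsilon> *\<^sub>R v \<Longrightarrow>
      (\<And>t. t \<ge> 0 \<Longrightarrow> (m has_vector_derivative (- 2 * \<zeta> t) *\<^sub>R G (m t)) (at t within {0..})) \<Longrightarrow>
      \<exists>t\<ge>0. \<eta> \<le> norm (m t - p)"
proof -
  have lin: "linear H" using G(1) has_derivative_linear by blast
  define c where "c = - (v \<bullet> H v)"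
  have "c > 0" using neg by (simp add: c_def)
  \<comment> \<open>An interval is infinite and the spectrum finite, so some \<mu> in it has - \<mu>
    outside the spectrum, which makes H + \<mu> injective; \<mu> < c keeps V 0 negative.\<close>
  have "\<not> {0<..<c} \<subseteq> uminus ` {c. \<exists>x. x \<noteq> 0 \<and> H x = c *\<^sub>R x}"
    using finite_subset[OF _ finite_imageI[OF symmetric_finite_eigenvalues[OF lin sym]]]
      infinite_Ioo[OF \<open>c > 0\<close>] by blast
  then obtain \<mu> where \<mu>0: "\<mu> \<in> {0<..<c}" "\<mu> \<notin> uminus ` {c. \<exists>x. x \<noteq> 0 \<and> H x = c *\<^sub>R x}"
    by blast
  have "- \<mu> \<notin> {c. \<exists>x. x \<noteq> 0 \<and> H x = c *\<^sub>R x}"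
  proof
    assume "- \<mu> \<in> {c. \<exists>x. x \<noteq> 0 \<and> H x = c *\<^sub>R x}"
    then have "- (- \<mu>) \<in> uminus ` {c. \<exists>x. x \<noteq> 0 \<and> H x = c *\<^sub>R x}"
      by (rule imageI)
    with \<mu>0(2) show False by (simp only: minus_minus)
  qed
  with \<mu>0(1) have \<mu>: "0 < \<mu>" "\<mu> < c" "- \<mu> \<notin> {c. \<exists>x. x \<noteq> 0 \<and> H x = c *\<^sub>R x}"
    by simp_all
  define A where "A x = H x + \<mu> *\<^sub>R x" for x
  have linA: "linear A"
    unfolding A_def by (intro linear_compose_add lin linear_scaleR)
  have symA: "A x \<bullet> y = x \<bullet> A y" for x y
    unfolding A_def by (simp add: inner_add_left inner_add_right sym)
  have "inj A"
    unfolding linear_injective_0[OF linA] using \<mu>(3)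
    by (auto simp: A_def eq_neg_iff_add_eq_0)
  then obtain k where k: "k > 0" "\<And>x. k * norm x \<le> norm (A x)"
    using linear_inj_bounded_below_pos[OF linA] by blast
  obtain \<eta> where \<eta>: "\<eta> > 0" "\<And>y. norm (y - p) < \<eta> \<Longrightarrow> norm (G y - G p - H (y - p)) \<le> k * norm (y - p)"
    using G(1) k(1) unfolding has_derivative_at_alt by metis
  have blA: "bounded_linear A" using linA by (simp add: linear_conv_bounded_linear)
  obtain B where B: "\<And>x. norm (A x) \<le> norm x * B" "B > 0"
    using bounded_linear.pos_bounded[OF blA] by blast
  show thesis
  proof (rule that[OF \<eta>(1)], rule ccontr)
    fix \<epsilon> :: real and m
    assume \<epsilon>: "\<epsilon> > 0" and m0: "m 0 = p + \<epsilon> *\<^sub>R v"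
      and m': "\<And>t. t \<ge> 0 \<Longrightarrow> (m has_vector_derivative (- 2 * \<zeta> t) *\<^sub>R G (m t)) (at t within {0..})"
      and "\<not> (\<exists>t\<ge>0. \<eta> \<le> norm (m t - p))"
    then have near: "norm (m t - p) < \<eta>" if "t \<ge> 0" for t
      using that by force
    define V where "V t = A (m t - p) \<bullet> (m t - p)" for t
    define Z where "Z t = integral {0..t} \<zeta>" for t
    have Z': "(Z has_real_derivative \<zeta> t) (at t within {0..})" if "t \<ge> 0" for t
    proof -
      have "(Z has_real_derivative \<zeta> t) (at t within {0..t + 1})"
        unfolding Z_def
        by (rule integral_has_real_derivative[OF continuous_on_subset[OF \<zeta>(1)]]) (use that in auto)
      moreover have "at t within {0..t + 1} = at t within {0..}"
        by (rule at_within_nhd[of _ "{..<t + 1}"]) auto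
      ultimately show ?thesis by simp
    qed
    have V': "(V has_real_derivative - 4 * \<zeta> t * (A (m t - p) \<bullet> G (m t))) (at t within {0..})"
      if "t \<ge> 0" for t
    proof -
      have md: "((\<lambda>t. m t - p) has_derivative (\<lambda>r. r *\<^sub>R ((- 2 * \<zeta> t) *\<^sub>R G (m t)))) (at t within {0..})"
        using m'[OF that] unfolding has_vector_derivative_def
        by (auto intro!: derivative_eq_intros)
      have "(V has_derivative (\<lambda>r. A (m t - p) \<bullet> (r *\<^sub>R ((- 2 * \<zeta> t) *\<^sub>R G (m t)))
          + A (r *\<^sub>R ((- 2 * \<zeta> t) *\<^sub>R G (m t))) \<bullet> (m t - p))) (at t within {0..})"
        unfolding V_def
        by (intro has_derivative_inner bounded_linear.has_derivative[OF blA] md)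
      also have "(\<lambda>r. A (m t - p) \<bullet> (r *\<^sub>R ((- 2 * \<zeta> t) *\<^sub>R G (m t)))
          + A (r *\<^sub>R ((- 2 * \<zeta> t) *\<^sub>R G (m t))) \<bullet> (m t - p))
          = (\<lambda>r. (- 4 * \<zeta> t * (A (m t - p) \<bullet> G (m t))) * r)"
        by (rule ext) (simp add: symA linear_cmul[OF linA] inner_commute[of "G (m t)"])
      finally show ?thesis unfolding has_field_derivative_def .
    qed
    \<comment> \<open>\<open>\<langle>A x, G\<rangle> = |A x|\<^sup>2 - \<mu> \<langle>A x, x\<rangle> + \<langle>A x, r\<rangle>\<close>, and the remainder \<open>r\<close> is dominated by \<open>A x\<close>.\<close>
    have key: "- \<mu> * V t \<le> A (m t - p) \<bullet> G (m t)" if "t \<ge> 0" for t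
    proof -
      define x where "x = m t - p"
      define r where "r = G (m t) - H x"
      have "norm r \<le> k * norm x"
        using \<eta>(2)[OF near[OF that]] G(2) by (simp add: r_def x_def)
      then have "norm r \<le> norm (A x)" using k(2)[of x] by linarith
      then have "\<bar>A x \<bullet> r\<bar> \<le> norm (A x) * norm (A x)"
        by (intro order_trans[OF Cauchy_Schwarz_ineq2] mult_left_mono) auto
      then have "0 \<le> A x \<bullet> A x + A x \<bullet> r"
        by (simp add: power2_norm_eq_inner[symmetric] power2_eq_square abs_le_iff)
      moreover have "G (m t) = A x - \<mu> *\<^sub>R x + r"
        by (simp add: r_def A_def)
      ultimately show ?thesis
        by (simp add: V_def x_def[symmetric] inner_add_right inner_diff_right)
    qed
    have mono: "V t * exp (- 4 * \<mu> * Z t) \<le> V 0 * exp (- 4 * \<mu> * Z 0)" if "t \<ge> 0" for t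
    proof (rule nonincreasing_of_derivative_within[OF _ _ that])
      fix t :: real assume t: "t \<ge> 0"
      show "((\<lambda>t. V t * exp (- 4 * \<mu> * Z t)) has_real_derivative
          (- 4 * \<zeta> t * (A (m t - p) \<bullet> G (m t) + \<mu> * V t)) * exp (- 4 * \<mu> * Z t)) (at t within {0..})"
        by (auto intro!: derivative_eq_intros V'[OF t] Z'[OF t] simp: algebra_simps)
      show "(- 4 * \<zeta> t * (A (m t - p) \<bullet> G (m t) + \<mu> * V t)) * exp (- 4 * \<mu> * Z t) \<le> 0"
        using \<zeta>(2)[OF t] key[OF t]
        by (intro mult_nonpos_nonneg mult_nonpos_nonneg) auto
    qed
    have V0: "V 0 = \<epsilon>\<^sup>2 * (\<mu> - c)"
    proof -
      have "V 0 = \<epsilon>\<^sup>2 * (v \<bullet> A v)"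
        by (simp add: V_def m0 linear_cmul[OF linA] power2_eq_square symA)
      also have "v \<bullet> A v = \<mu> - c"
        using \<open>norm v = 1\<close> by (simp add: A_def c_def inner_add_right norm_eq_1)
      finally show ?thesis .
    qed
    have "V 0 < 0" using \<epsilon> \<mu>(2) by (simp add: V0 mult_pos_neg)
    have Vlow: "- (\<eta> * B * \<eta>) \<le> V t" if "t \<ge> 0" for t
    proof -
      have "\<bar>V t\<bar> \<le> norm (A (m t - p)) * norm (m t - p)"
        unfolding V_def by (rule Cauchy_Schwarz_ineq2)
      also have "\<dots> \<le> (\<eta> * B) * \<eta>"
        using near[OF that] \<eta>(1) B(2)
        by (intro mult_mono order_trans[OF B(1)]) auto
      finally show ?thesis by linarith
    qed
    \<comment> \<open>The threshold is such that even the linear lower bound 1 + x of exp x pushes V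
      t below its Cauchy-Schwarz bound.\<close>
    obtain t where t: "t \<ge> 0" "\<eta> * B * \<eta> / (- V 0 * 4 * \<mu>) < Z t"
      using diverges unfolding Z_def by blast
    have "V t \<le> V 0 * exp (4 * \<mu> * Z t)"
    proof -
      have "V t = V t * exp (- 4 * \<mu> * Z t) * exp (4 * \<mu> * Z t)"
        by (simp add: mult.assoc exp_add[symmetric])
      also have "\<dots> \<le> V 0 * exp (4 * \<mu> * Z t)"
        using mono[OF t(1)] by (intro mult_right_mono) (simp_all add: Z_def)
      finally show ?thesis .
    qed
    also have "\<dots> \<le> V 0 * (1 + 4 * \<mu> * Z t)"
      using \<open>V 0 < 0\<close> exp_ge_add_one_self by (intro mult_left_mono_neg) auto
    also have "\<dots> < V 0 * (4 * \<mu> * Z t)"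
      using \<open>V 0 < 0\<close> by (simp add: distrib_left)
    also have "\<dots> < - (\<eta> * B * \<eta>)"
    proof -
      have "0 < - V 0 * 4 * \<mu>" using \<open>V 0 < 0\<close> \<mu>(1) by (intro mult_pos_pos) auto
      from t(2)[unfolded pos_divide_less_eq[OF this]] show ?thesis
        by (simp add: mult_ac)
    qed
    finally show False using Vlow[OF t(1)] by simp
  qed
qed

text \<open>The hypothesis is a Lebesgue integral over the half-line, the conclusion concerns
  Henstock-Kurzweil integrals over bounded intervals: on each [0, n] the two agree, and monotone
  convergence passes to the half-line.\<close>

lemma learning_rate_integral_unbounded:
  fixes \<zeta> :: "real \<Rightarrow> real"
  assumes "continuous_on {0..} \<zeta>" "\<And>t. t \<ge> 0 \<Longrightarrow> 0 \<le> \<zeta> t"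
    and "(\<integral>\<^sup>+t\<in>{0..}. ennreal (\<zeta> t) \<partial>lborel) = \<infinity>"
  shows "\<exists>t\<ge>0. M < integral {0..t} \<zeta>"
proof (rule ccontr)
  assume "\<not> ?thesis"
  then have le: "integral {0..real n} \<zeta> \<le> M" for n
    using of_nat_0_le_iff not_less by blast
  have "(\<integral>\<^sup>+t. ennreal (\<zeta> t) * indicator {0..real n} t \<partial>lborel) \<le> ennreal M" for n
  proof -
    have "(\<zeta> has_integral integral {0..real n} \<zeta>) {0..real n}"
      using continuous_on_subset[OF assms(1)] by (intro integrable_integral integrable_continuous_interval) auto
    moreover have "(\<lambda>t. indicator {0..real n} t *\<^sub>R \<zeta> t) \<in> borel_measurable borel"
      using continuous_on_subset[OF assms(1), of "{0..real n}"]
      by (intro borel_measurable_continuous_on_indicator) auto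
    moreover have "(\<lambda>t. indicator {0..real n} t *\<^sub>R \<zeta> t) = (\<lambda>t. if t \<in> {0..real n} then \<zeta> t else 0)"
      by (auto simp: indicator_def)
    ultimately have "((\<lambda>t. indicator {0..real n} t *\<^sub>R \<zeta> t) has_integral integral {0..real n} \<zeta>) UNIV"
      "(\<lambda>t. indicator {0..real n} t *\<^sub>R \<zeta> t) \<in> borel_measurable borel"
      by (simp_all only: has_integral_restrict_UNIV)
    then have "(\<integral>\<^sup>+t. ennreal (indicator {0..real n} t *\<^sub>R \<zeta> t) \<partial>lborel) = ennreal (integral {0..real n} \<zeta>)"
      using assms(2) by (intro nn_integral_has_integral_lborel) (simp_all add: indicator_def)
    moreover have "(\<integral>\<^sup>+t. ennreal (\<zeta> t) * indicator {0..real n} t \<partial>lborel)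
       = (\<integral>\<^sup>+t. ennreal (indicator {0..real n} t *\<^sub>R \<zeta> t) \<partial>lborel)"
      by (intro nn_integral_cong) (auto simp: indicator_def)
    ultimately show ?thesis using le by (simp add: ennreal_leI)
  qed
  moreover have "(\<integral>\<^sup>+t. ennreal (\<zeta> t) * indicator {0..} t \<partial>lborel)
      = (SUP n. \<integral>\<^sup>+t. ennreal (\<zeta> t) * indicator {0..real n} t \<partial>lborel)"
  proof -
    have meas: "(\<lambda>t. ennreal (\<zeta> t) * indicator {0..real n} t) \<in> borel_measurable lborel" for n
    proof -
      have "(\<lambda>t. indicator {0..real n} t *\<^sub>R \<zeta> t) \<in> borel_measurable borel"
        using continuous_on_subset[OF assms(1), of "{0..real n}"]
        by (intro borel_measurable_continuous_on_indicator) auto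
      then have "(\<lambda>t. ennreal (indicator {0..real n} t *\<^sub>R \<zeta> t)) \<in> borel_measurable lborel"
        by simp
      moreover have "(\<lambda>t. ennreal (indicator {0..real n} t *\<^sub>R \<zeta> t)) = (\<lambda>t. ennreal (\<zeta> t) * indicator {0..real n} t)"
        by (auto simp: indicator_def)
      ultimately show ?thesis by simp
    qed
    have "ennreal (\<zeta> t) * indicator {0..} t = (SUP n. ennreal (\<zeta> t) * indicator {0..real n} t)" for t
    proof -
      obtain N where "t \<le> real N" using real_arch_simple by blast
      then have "ennreal (\<zeta> t) * indicator {0..} t \<le> ennreal (\<zeta> t) * indicator {0..real N} t"
        by (auto simp: indicator_def)
      then show ?thesis
        by (intro antisym SUP_upper2[of N] SUP_least) (auto simp: indicator_def)
    qed
    moreover have "incseq (\<lambda>n t. ennreal (\<zeta> t) * indicator {0..real n} t)"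
      by (auto simp: incseq_def le_fun_def indicator_def)
    ultimately show ?thesis
      using nn_integral_monotone_convergence_SUP[OF _ meas] by simp
  qed
  ultimately have "(\<integral>\<^sup>+t. ennreal (\<zeta> t) * indicator {0..} t \<partial>lborel) \<le> ennreal M"
    by (simp add: SUP_least)
  with assms(3) show False by (simp add: top_unique)
qed

section \<open>Curves of measures\<close>

lemma integrable_prob_measures_on:
  fixes g :: "'a::euclidean_space \<Rightarrow> 'c::euclidean_space"
  assumes \<rho>: "\<rho> \<in> prob_measures_on K" and "compact K" and g: "continuous_on UNIV g"
  shows "integrable \<rho> g"
proof -
  interpret prob_space \<rho> using \<rho> by (simp add: prob_measures_on_def)
  have s: "sets \<rho> = sets borel" and K: "AE x in \<rho>. x \<in> K"
    using \<rho> by (simp_all add: prob_measures_on_def)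
  have "bounded (g ` K)"
    by (intro compact_imp_bounded compact_continuous_image continuous_on_subset[OF g] \<open>compact K\<close>) simp
  then obtain B where "\<forall>y\<in>g ` K. norm y \<le> B" unfolding bounded_iff by blast
  then have B: "norm (g x) \<le> B" if "x \<in> K" for x using that by blast
  have "AE x in \<rho>. norm (g x) \<le> B" using K by eventually_elim (rule B)
  then show ?thesis
    using borel_measurable_continuous_onI[OF g]
    by (intro integrable_const_bound) (simp_all cong: measurable_cong_sets add: measurable_cong_sets[OF s refl])
qed

text \<open>Narrow continuity tests bounded functions only. Clamping g at its bound on K changes no
  integral, because all measures are concentrated on K.\<close>

lemma narrowly_continuous_integral:
  fixes g :: "'a::euclidean_space \<Rightarrow> real"
  assumes \<rho>: "\<And>t. t \<ge> 0 \<Longrightarrow> \<rho> t \<in> prob_measures_on K" and nc: "narrowly_continuous \<rho>"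
    and "compact K" and g: "continuous_on UNIV g"
  shows "continuous_on {0..} (\<lambda>t. \<integral>x. g x \<partial>\<rho> t)"
proof -
  have "bounded (g ` K)"
    by (intro compact_imp_bounded compact_continuous_image continuous_on_subset[OF g] \<open>compact K\<close>) simp
  then obtain B where B: "\<forall>y\<in>g ` K. norm y \<le> B" unfolding bounded_iff by blast
  define h where "h x = max (- \<bar>B\<bar>) (min \<bar>B\<bar> (g x))" for x
  have h: "continuous_on UNIV h"
    unfolding h_def by (intro continuous_intros g)
  have "\<bar>h x\<bar> \<le> \<bar>B\<bar>" for x unfolding h_def by linarith
  then have "bounded (range h)" unfolding bounded_iff by auto
  then have "continuous_on {0..} (\<lambda>t. \<integral>x. h x \<partial>\<rho> t)"
    using nc h unfolding narrowly_continuous_def by blast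
  moreover have "(\<integral>x. h x \<partial>\<rho> t) = (\<integral>x. g x \<partial>\<rho> t)" if "t \<ge> 0" for t
  proof (rule integral_cong_AE)
    have s: "sets (\<rho> t) = sets borel" and K: "AE x in \<rho> t. x \<in> K"
      using \<rho>[OF that] by (simp_all add: prob_measures_on_def)
    show "h \<in> borel_measurable (\<rho> t)" "g \<in> borel_measurable (\<rho> t)"
      unfolding measurable_cong_sets[OF s refl]
      by (intro borel_measurable_continuous_onI h g)+
    show "AE x in \<rho> t. h x = g x"
      using K
    proof eventually_elim
      case (elim x)
      then have "\<bar>g x\<bar> \<le> B" using B by simp
      then show ?case unfolding h_def by linarith
    qed
  qed
  ultimately show ?thesis
    by (simp cong: continuous_on_cong_simp)
qed

lemma return_mem_prob_measures_on:
  assumes "compact K"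
  shows "return borel a \<in> prob_measures_on K \<longleftrightarrow> a \<in> K"
proof -
  have "{x \<in> space borel. x \<in> K} \<in> sets borel"
    using borel_closed[OF compact_imp_closed[OF assms]] by simp
  then show ?thesis
    unfolding prob_measures_on_def
    by (simp add: AE_return prob_space_return)
qed

lemma eq_return_of_AE_eq:
  fixes a :: "'a::euclidean_space"
  assumes "prob_space \<mu>" "sets \<mu> = sets borel" "AE x in \<mu>. x = a"
  shows "\<mu> = return borel a"
proof (rule measure_eqI)
  interpret prob_space \<mu> by fact
  fix A assume A: "A \<in> sets \<mu>"
  have "emeasure \<mu> A = (\<integral>\<^sup>+x. indicator A x \<partial>\<mu>)" using A by simp
  also have "\<dots> = (\<integral>\<^sup>+x. indicator A a \<partial>\<mu>)"
    using assms(3) by (intro nn_integral_cong_AE) auto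
  also have "\<dots> = emeasure (return borel a) A"
    using A assms(2) by (simp add: emeasure_space_1)
  finally show "emeasure \<mu> A = emeasure (return borel a) A" .
qed (use assms(2) in simp)

text \<open>The integral of a non-integrable function is 0 by convention, and 0 \<le> B covers that
  case.\<close>

lemma (in prob_space) integral_prob_bound:
  fixes g :: "'a \<Rightarrow> real"
  assumes "AE x in M. \<bar>g x\<bar> \<le> B" "B \<ge> 0"
  shows "\<bar>\<integral>x. g x \<partial>M\<bar> \<le> B"
proof (cases "integrable M g")
  case True
  have "\<bar>\<integral>x. g x \<partial>M\<bar> \<le> (\<integral>x. \<bar>g x\<bar> \<partial>M)"
    using integral_norm_bound[of M g] by simp
  also have "\<dots> \<le> (\<integral>x. B \<partial>M)"
    by (intro integral_mono_AE) (use True assms in auto)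
  finally show ?thesis by (simp add: prob_space)
qed (simp add: not_integrable_integral_eq assms(2))

section \<open>Integrals over heads and inputs together\<close>

context bounded_input
begin

lemma measurable_parameter_integral:
  fixes g :: "'a::euclidean_space \<times> 'b \<Rightarrow> real"
  assumes \<rho>: "\<rho> \<in> prob_measures_on K" and g: "continuous_on UNIV g"
  shows "(\<lambda>X. \<integral>\<omega>. g (\<omega>, X) \<partial>\<rho>) \<in> borel_measurable D"
proof -
  interpret \<rho>: prob_space \<rho> using \<rho> by (simp add: prob_measures_on_def)
  have s: "sets \<rho> = sets borel" using \<rho> by (simp add: prob_measures_on_def)
  have [measurable]: "g \<in> borel_measurable (borel \<Otimes>\<^sub>M borel)"
    unfolding borel_prod using g by (rule borel_measurable_continuous_onI)
  show ?thesis
    by (rule \<rho>.borel_measurable_lebesgue_integral)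
       (simp add: measurable_cong_sets[OF sets_pair_measure_cong[OF sets_D s] refl] case_prod_beta')
qed

text \<open>Averaging over K cannot exceed the supremum, so one constant serves the integrand and
  all its averages; uniformity in \<rho> supplies the dominating function along a curve of
  measures.\<close>

lemma parameter_integral_bound:
  fixes g :: "'a::euclidean_space \<times> 'b \<Rightarrow> real"
  assumes "compact K" and g: "continuous_on UNIV g"
  obtains B where "B \<ge> 0" "\<And>\<omega> X. \<omega> \<in> K \<Longrightarrow> norm X \<le> R \<Longrightarrow> \<bar>g (\<omega>, X)\<bar> \<le> B"
    "\<And>\<rho> X. \<rho> \<in> prob_measures_on K \<Longrightarrow> norm X \<le> R \<Longrightarrow> \<bar>\<integral>\<omega>. g (\<omega>, X) \<partial>\<rho>\<bar> \<le> B"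
proof -
  have "bounded (g ` (K \<times> cball 0 R))"
    by (intro compact_imp_bounded compact_continuous_image continuous_on_subset[OF g]
        compact_Times compact_cball \<open>compact K\<close>) simp
  then obtain B where "\<forall>y\<in>g ` (K \<times> cball 0 R). norm y \<le> B" unfolding bounded_iff by blast
  then have B: "\<bar>g (\<omega>, X)\<bar> \<le> \<bar>B\<bar>" if "\<omega> \<in> K" "norm X \<le> R" for \<omega> X
    using that by force
  moreover have "\<bar>\<integral>\<omega>. g (\<omega>, X) \<partial>\<rho>\<bar> \<le> \<bar>B\<bar>" if "\<rho> \<in> prob_measures_on K" "norm X \<le> R" for \<rho> X
  proof -
    interpret \<rho>: prob_space \<rho> using that by (simp add: prob_measures_on_def)
    have "AE \<omega> in \<rho>. \<omega> \<in> K" using that by (simp add: prob_measures_on_def)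
    then have "AE \<omega> in \<rho>. \<bar>g (\<omega>, X)\<bar> \<le> \<bar>B\<bar>"
      by eventually_elim (rule B[OF _ that(2)])
    then show ?thesis by (rule \<rho>.integral_prob_bound) simp
  qed
  ultimately show thesis by (intro that[of "\<bar>B\<bar>"]) auto
qed

text \<open>Fubini, in the shape that pulls the weight out of the head integral: afterwards the
  measure acts on a continuous function for each fixed input, where narrow continuity
  applies.\<close>

lemma parameter_integral_swap:
  fixes g :: "'a::euclidean_space \<times> 'b \<Rightarrow> real"
  assumes \<rho>: "\<rho> \<in> prob_measures_on K" and "compact K" and g: "continuous_on UNIV g"
    and c: "c \<in> borel_measurable D" "AE X in D. \<bar>c X\<bar> \<le> M"
  shows "(\<integral>\<omega>. (\<integral>X. c X * g (\<omega>, X) \<partial>D) \<partial>\<rho>) = (\<integral>X. c X * (\<integral>\<omega>. g (\<omega>, X) \<partial>\<rho>) \<partial>D)"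
proof -
  interpret \<rho>: prob_space \<rho> using \<rho> by (simp add: prob_measures_on_def)
  have s: "sets \<rho> = sets borel" and K: "AE \<omega> in \<rho>. \<omega> \<in> K"
    using \<rho> by (simp_all add: prob_measures_on_def)
  interpret P: pair_prob_space D \<rho> ..
  obtain B where B: "B \<ge> 0" "\<And>\<omega> X. \<omega> \<in> K \<Longrightarrow> norm X \<le> R \<Longrightarrow> \<bar>g (\<omega>, X)\<bar> \<le> B"
    "\<And>\<rho> X. \<rho> \<in> prob_measures_on K \<Longrightarrow> norm X \<le> R \<Longrightarrow> \<bar>\<integral>\<omega>. g (\<omega>, X) \<partial>\<rho>\<bar> \<le> B"
    by (rule parameter_integral_bound[OF \<open>compact K\<close> g]) blast
  have gm: "g \<in> borel_measurable (borel \<Otimes>\<^sub>M borel)"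
    unfolding borel_prod using g by (rule borel_measurable_continuous_onI)
  have "(\<lambda>z. g (snd z, fst z)) \<in> borel_measurable (D \<Otimes>\<^sub>M \<rho>)"
    unfolding measurable_cong_sets[OF sets_pair_measure_cong[OF sets_D s] refl]
    using gm by measurable
  then have m: "(\<lambda>z. c (fst z) * g (snd z, fst z)) \<in> borel_measurable (D \<Otimes>\<^sub>M \<rho>)"
    using c(1) by measurable
  have "integrable (D \<Otimes>\<^sub>M \<rho>) (\<lambda>z. c (fst z) * g (snd z, fst z))"
  proof (rule P.integrable_const_bound)
    have "AE z in D \<Otimes>\<^sub>M \<rho>. \<bar>c (fst z) * g (snd z, fst z)\<bar> \<le> M * B"
    proof (rule P.AE_pair_measure)
      show "{z \<in> space (D \<Otimes>\<^sub>M \<rho>). \<bar>c (fst z) * g (snd z, fst z)\<bar> \<le> M * B} \<in> sets (D \<Otimes>\<^sub>M \<rho>)"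
        using m by measurable
      show "AE X in D. AE \<omega> in \<rho>. \<bar>c (fst (X, \<omega>)) * g (snd (X, \<omega>), fst (X, \<omega>))\<bar> \<le> M * B"
        using c(2) bounded_D
      proof eventually_elim
        case (elim X)
        show ?case using K
          by eventually_elim (use elim B in \<open>auto simp: abs_mult intro!: mult_mono\<close>)
      qed
    qed
    then show "AE z in D \<Otimes>\<^sub>M \<rho>. norm (c (fst z) * g (snd z, fst z)) \<le> M * B" by simp
  qed (rule m)
  then have "integrable (D \<Otimes>\<^sub>M \<rho>) (\<lambda>(X, \<omega>). c X * g (\<omega>, X))"
    by (simp add: case_prod_beta')
  from P.Fubini_integral[OF this] show ?thesis by simp
qed

text \<open>For each fixed input both factors are continuous in t; the bounds M and B are uniform in
  t, so dominated convergence with a constant passes to the expectation.\<close>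

lemma continuous_expectation_along_curve:
  fixes g :: "'a::euclidean_space \<times> 'b \<Rightarrow> real"
  assumes \<rho>: "\<And>t. t \<ge> 0 \<Longrightarrow> \<rho> t \<in> prob_measures_on K" and nc: "narrowly_continuous \<rho>"
    and "compact K" and g: "continuous_on UNIV g"
    and c: "\<And>t. t \<ge> 0 \<Longrightarrow> c t \<in> borel_measurable D" "\<And>t. t \<ge> 0 \<Longrightarrow> AE X in D. \<bar>c t X\<bar> \<le> M"
      "\<And>X. continuous_on {0..} (\<lambda>t. c t X)"
  shows "continuous_on {0..} (\<lambda>t. \<integral>X. c t X * (\<integral>\<omega>. g (\<omega>, X) \<partial>\<rho> t) \<partial>D)"
  unfolding continuous_on_sequentially
proof (intro allI ballI impI)
  fix x a
  assume a: "a \<in> {0::real..}" and x: "(\<forall>n. x n \<in> {0..}) \<and> x \<longlonglongrightarrow> a"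
  obtain B where B: "B \<ge> 0" "\<And>\<omega> X. \<omega> \<in> K \<Longrightarrow> norm X \<le> R \<Longrightarrow> \<bar>g (\<omega>, X)\<bar> \<le> B"
    "\<And>\<rho> X. \<rho> \<in> prob_measures_on K \<Longrightarrow> norm X \<le> R \<Longrightarrow> \<bar>\<integral>\<omega>. g (\<omega>, X) \<partial>\<rho>\<bar> \<le> B"
    by (rule parameter_integral_bound[OF \<open>compact K\<close> g]) blast
  have meas: "(\<lambda>X. c t X * (\<integral>\<omega>. g (\<omega>, X) \<partial>\<rho> t)) \<in> borel_measurable D" if "t \<ge> 0" for t
    by (intro borel_measurable_times c(1) measurable_parameter_integral[OF \<rho>] g that)
  have "(\<lambda>n. \<integral>X. c (x n) X * (\<integral>\<omega>. g (\<omega>, X) \<partial>\<rho> (x n)) \<partial>D) \<longlonglongrightarrow> (\<integral>X. c a X * (\<integral>\<omega>. g (\<omega>, X) \<partial>\<rho> a) \<partial>D)"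
  proof (rule integral_dominated_convergence[where w = "\<lambda>_. M * B"])
    show "AE X in D. (\<lambda>n. c (x n) X * (\<integral>\<omega>. g (\<omega>, X) \<partial>\<rho> (x n))) \<longlonglongrightarrow> c a X * (\<integral>\<omega>. g (\<omega>, X) \<partial>\<rho> a)"
    proof (rule AE_I2)
      fix X
      have "continuous_on UNIV (\<lambda>\<omega>. g (\<omega>, X))"
        by (intro continuous_on_compose2[OF g] continuous_intros) auto
      then have "continuous_on {0..} (\<lambda>t. c t X * (\<integral>\<omega>. g (\<omega>, X) \<partial>\<rho> t))"
        by (intro continuous_on_mult c(3) narrowly_continuous_integral[OF \<rho> nc \<open>compact K\<close>])
      then show "(\<lambda>n. c (x n) X * (\<integral>\<omega>. g (\<omega>, X) \<partial>\<rho> (x n))) \<longlonglongrightarrow> c a X * (\<integral>\<omega>. g (\<omega>, X) \<partial>\<rho> a)"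
        using a x unfolding continuous_on_sequentially comp_def by blast
    qed
    show "AE X in D. norm (c (x n) X * (\<integral>\<omega>. g (\<omega>, X) \<partial>\<rho> (x n))) \<le> M * B" for n
    proof -
      have "x n \<ge> 0" using x by simp
      show ?thesis using c(2)[OF \<open>x n \<ge> 0\<close>] bounded_D
        by eventually_elim (use B(3)[OF \<rho>[OF \<open>x n \<ge> 0\<close>]] in \<open>auto simp: abs_mult intro!: mult_mono\<close>)
    qed
  qed (use meas a x in auto)
  then show "((\<lambda>t. \<integral>X. c t X * (\<integral>\<omega>. g (\<omega>, X) \<partial>\<rho> t) \<partial>D) \<circ> x) \<longlonglongrightarrow> (\<integral>X. c a X * (\<integral>\<omega>. g (\<omega>, X) \<partial>\<rho> a) \<partial>D)"
    by (simp add: comp_def)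
qed

end

section \<open>Gradient of the first variation\<close>

lemma softmax_nth_bounds: "0 \<le> softmax z $ j" "softmax z $ j \<le> 1"
proof -
  have "0 < (\<Sum>m\<in>UNIV. exp (z $ m))" by (rule sum_pos) auto
  moreover have "exp (z $ j) \<le> (\<Sum>m\<in>UNIV. exp (z $ m))"
    by (rule member_le_sum) auto
  ultimately show "0 \<le> softmax z $ j" "softmax z $ j \<le> 1"
    by (auto simp: softmax_def)
qed

lemma one_hot_nth_bounds: "one_hot y \<Longrightarrow> 0 \<le> y $ j \<and> y $ j \<le> 1"
  by (auto simp: one_hot_def axis_def)

lemma continuous_on_softmax_nth: "continuous_on UNIV (\<lambda>z. softmax z $ j)"
proof -
  have "(\<Sum>m\<in>UNIV. exp (z $ m)) \<noteq> 0" for z :: "real ^ 'v::finite"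
    by (rule less_imp_neq[THEN not_sym], rule sum_pos) auto
  then show ?thesis
    unfolding softmax_def vec_lambda_beta by (intro continuous_intros ballI)
qed

locale attention_flow = bounded_input D R
  for D :: "('x::finite, 'l::{finite,linorder}) tokens measure" and R +
  fixes Wout :: "real ^ 'v::finite ^ 'x"
    and Y :: "'l \<Rightarrow> ('x, 'l) tokens \<Rightarrow> real ^ 'v"
    and K :: "('x, 'k::finite) head set"
  assumes labels_measurable: "\<And>l. Y l \<in> borel_measurable D"
    and labels_one_hot: "AE X in D. \<forall>l. one_hot (Y l X)"
    and compact_K: "compact K"
begin

definition \<psi> :: "'l \<Rightarrow> 'v \<Rightarrow> ('x, 'k) head \<times> ('x, 'l) tokens \<Rightarrow> real" where
  "\<psi> l j z = head_output Wout l (snd z) (fst z) $ j"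

definition d\<psi> :: "'l \<Rightarrow> 'v \<Rightarrow> ('x, 'k) head \<Rightarrow> ('x, 'k) head \<times> ('x, 'l) tokens \<Rightarrow> real" where
  "d\<psi> l j u z = frechet_derivative (\<psi> l j) (at z) (u, 0)"

definition residual :: "('x, 'k) head measure \<Rightarrow> 'l \<Rightarrow> 'v \<Rightarrow> ('x, 'l) tokens \<Rightarrow> real" where
  "residual \<rho> l j X = softmax (mean_logits Wout \<rho> l X) $ j - Y l X $ j"

definition first_variation_deriv :: "('x, 'k) head measure \<Rightarrow> ('x, 'k) head \<Rightarrow> ('x, 'k) head \<Rightarrow> real" where
  "first_variation_deriv \<rho> \<omega> u = (1 / real CARD('l)) *
     (\<Sum>l\<in>UNIV. \<Sum>j\<in>UNIV. \<integral>X. residual \<rho> l j X * d\<psi> l j u (\<omega>, X) \<partial>D)"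

abbreviation "\<Phi> \<equiv> first_variation D Wout Y"

lemma ck_\<psi>: "ck n (\<psi> l j)"
  unfolding \<psi>_def by (rule ck_head_output)

lemma ck_d\<psi>: "ck n (d\<psi> l j u)"
  unfolding d\<psi>_def by (rule ck_frechet[OF ck_\<psi>])

lemma head_output_continuous:
  fixes l :: 'l and X :: "('x, 'l) tokens"
  shows "continuous_on UNIV (head_output Wout l X :: ('x, 'k) head \<Rightarrow> _)"
proof -
  have "head_output Wout l X = (\<lambda>\<omega>::('x, 'k) head. \<chi> j. \<psi> l j (\<omega>, X))"
    by (simp add: \<psi>_def vec_eq_iff fun_eq_iff)
  moreover have "continuous_on UNIV (\<lambda>\<omega>::('x, 'k) head. \<psi> l j (\<omega>, X))" for j
    by (intro continuous_on_compose2[OF ck_continuous[OF ck_\<psi>[of 0]]] continuous_intros) auto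
  ultimately show ?thesis
    by (simp add: continuous_on_vec_lambda)
qed

lemma mean_logits_nth:
  assumes "\<rho> \<in> prob_measures_on K"
  shows "mean_logits Wout \<rho> l X $ j = (\<integral>\<omega>. \<psi> l j (\<omega>, X) \<partial>\<rho>)"
proof -
  have "integrable \<rho> (head_output Wout l X)"
    using assms compact_K head_output_continuous by (rule integrable_prob_measures_on)
  from integral_bounded_linear[OF bounded_linear_vec_nth this]
  show ?thesis by (simp add: mean_logits_def \<psi>_def)
qed

text \<open>Both terms are entries in [0, 1], whatever \<rho> is. Residuals can therefore serve as
  weights with M = 1, which makes later constants independent of \<rho>.\<close>

lemma residual_bound: "AE X in D. \<bar>residual \<rho> l j X\<bar> \<le> 1"
  using labels_one_hot
proof eventually_elim
  case (elim X)
  then have "0 \<le> Y l X $ j \<and> Y l X $ j \<le> 1" using one_hot_nth_bounds by blast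
  then show ?case
    unfolding residual_def
    using softmax_nth_bounds[of "mean_logits Wout \<rho> l X" j] by linarith
qed

lemma residual_measurable:
  assumes "\<rho> \<in> prob_measures_on K"
  shows "residual \<rho> l j \<in> borel_measurable D"
proof -
  have "(\<lambda>X. mean_logits Wout \<rho> l X $ m) \<in> borel_measurable D" for m
    unfolding mean_logits_nth[OF assms]
    by (rule measurable_parameter_integral[OF assms ck_continuous[OF ck_\<psi>[of 0]]])
  then have "(\<lambda>X. softmax (mean_logits Wout \<rho> l X) $ j) \<in> borel_measurable D"
    unfolding softmax_def by simp
  moreover have "(\<lambda>X. Y l X $ j) \<in> borel_measurable D"
    using measurable_compose[OF labels_measurable borel_measurable_continuous_onI[OF continuous_on_component[OF continuous_on_id]]]
    by simp
  ultimately show ?thesis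
    unfolding residual_def by simp
qed

lemma first_variation_expand:
  assumes "\<rho> \<in> prob_measures_on K"
  shows "\<Phi> \<rho> \<omega> = (1 / real CARD('l)) *
     (\<Sum>l\<in>UNIV. \<Sum>j\<in>UNIV. \<integral>X. residual \<rho> l j X * \<psi> l j (\<omega>, X) \<partial>D)"
proof -
  have "\<Phi> \<rho> \<omega> = (\<integral>X. (1 / real CARD('l)) *
      (\<Sum>l\<in>UNIV. \<Sum>j\<in>UNIV. residual \<rho> l j X * \<psi> l j (\<omega>, X)) \<partial>D)"
    unfolding first_variation_def by (simp add: inner_vec_def residual_def \<psi>_def)
  also have "\<dots> = (1 / real CARD('l)) *
      (\<integral>X. (\<Sum>l\<in>UNIV. \<Sum>j\<in>UNIV. residual \<rho> l j X * \<psi> l j (\<omega>, X)) \<partial>D)"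
    by (rule integral_mult_right_zero)
  also have "(\<integral>X. (\<Sum>l\<in>UNIV. \<Sum>j\<in>UNIV. residual \<rho> l j X * \<psi> l j (\<omega>, X)) \<partial>D)
      = (\<Sum>l\<in>UNIV. \<Sum>j\<in>UNIV. \<integral>X. residual \<rho> l j X * \<psi> l j (\<omega>, X) \<partial>D)"
    using integrable_bounded_mult[OF ck_continuous[OF ck_\<psi>[of 0]] residual_measurable[OF assms] residual_bound]
    by simp
  finally show ?thesis .
qed

lemma first_variation_has_derivative:
  assumes "\<rho> \<in> prob_measures_on K"
  shows "(\<Phi> \<rho> has_derivative first_variation_deriv \<rho> \<omega>) (at \<omega>)"
proof -
  have eq: "\<Phi> \<rho> = (\<lambda>\<omega>. (1 / real CARD('l)) *
     (\<Sum>l\<in>UNIV. \<Sum>j\<in>UNIV. \<integral>X. residual \<rho> l j X * \<psi> l j (\<omega>, X) \<partial>D))"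
    using first_variation_expand[OF assms] by blast
  show ?thesis
    unfolding eq first_variation_deriv_def d\<psi>_def
    by (intro has_derivative_mult_right has_derivative_sum
        has_derivative_expectation[OF _ _ residual_measurable[OF assms] residual_bound]
        ck_frechet(1)[OF ck_\<psi>[of "Suc 0"]] ck_continuous[OF ck_frechet(2)[OF ck_\<psi>[of "Suc 0"]]])
qed

lemma gradient_first_variation_inner:
  assumes "\<rho> \<in> prob_measures_on K"
  shows "gradient (\<Phi> \<rho>) \<omega> \<bullet> u = first_variation_deriv \<rho> \<omega> u" "u \<bullet> gradient (\<Phi> \<rho>) \<omega> = first_variation_deriv \<rho> \<omega> u"
  using gradient_inner[OF first_variation_has_derivative[OF assms]] by auto

lemma first_variation_deriv_continuous:
  assumes "\<rho> \<in> prob_measures_on K"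
  shows "continuous_on UNIV (\<lambda>\<omega>. first_variation_deriv \<rho> \<omega> u)"
proof -
  have "continuous (at \<omega>) (\<lambda>\<omega>. \<integral>X. residual \<rho> l j X * d\<psi> l j u (\<omega>, X) \<partial>D)" for \<omega> l j
    by (rule has_derivative_continuous,
        rule has_derivative_expectation[OF _ _ residual_measurable[OF assms] residual_bound],
        rule ck_frechet(1)[OF ck_d\<psi>[of "Suc 0"]], rule ck_continuous[OF ck_frechet(2)[OF ck_d\<psi>[of "Suc 0"]]])
  then have "continuous_on UNIV (\<lambda>\<omega>. \<integral>X. residual \<rho> l j X * d\<psi> l j u (\<omega>, X) \<partial>D)" for l j
    by (simp add: continuous_at_imp_continuous_on)
  then show ?thesis
    unfolding first_variation_deriv_def by (intro continuous_intros)
qed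

lemma gradient_first_variation_continuous:
  assumes "\<rho> \<in> prob_measures_on K"
  shows "continuous_on UNIV (gradient (\<Phi> \<rho>))"
  by (subst continuous_on_componentwise)
     (simp add: gradient_first_variation_inner[OF assms] first_variation_deriv_continuous[OF assms])

text \<open>The measure enters the gradient only through residuals of modulus at most 1, so C
  depends on derivatives of the head over a product of balls and not on \<rho>. A ball replaces K
  because the argument needs convexity and because the mean of a measure on K may lie outside
  K.\<close>

lemma gradient_first_variation_Lipschitz:
  obtains C where "C \<ge> 0"
    "\<And>\<rho> \<omega> \<omega>'. \<rho> \<in> prob_measures_on K \<Longrightarrow> norm \<omega> \<le> r \<Longrightarrow> norm \<omega>' \<le> r \<Longrightarrow>
      norm (gradient (\<Phi> \<rho>) \<omega> - gradient (\<Phi> \<rho>) \<omega>') \<le> C * norm (\<omega> - \<omega>')"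
proof -
  define S where "S = cball (0::('x, 'k) head) r \<times> cball (0::('x, 'l) tokens) R"
  have "\<exists>L. L-lipschitz_on S (d\<psi> l j u)" for l j u
  proof (rule ck_Lipschitz_on_compact_convex[OF ck_d\<psi>])
    show "compact S" "convex S"
      unfolding S_def by (intro compact_Times compact_cball convex_Times convex_cball)+
  qed blast
  then obtain L where L: "\<And>l j u. (L l j u)-lipschitz_on S (d\<psi> l j u)" by metis
  have L0: "L l j u \<ge> 0" for l j u using lipschitz_on_nonneg[OF L] .
  define C where "C = (\<Sum>b\<in>Basis. (1 / real CARD('l)) * (\<Sum>l\<in>UNIV. \<Sum>j\<in>UNIV. L l j b))"
  show thesis
  proof (rule that[of C])
    show "C \<ge> 0" unfolding C_def by (intro sum_nonneg mult_nonneg_nonneg L0) auto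
    fix \<rho> and \<omega> \<omega>' :: "('x, 'k) head"
    assume \<rho>: "\<rho> \<in> prob_measures_on K" and \<omega>: "norm \<omega> \<le> r" "norm \<omega>' \<le> r"
    have int: "\<bar>(\<integral>X. residual \<rho> l j X * d\<psi> l j u (\<omega>, X) \<partial>D) - (\<integral>X. residual \<rho> l j X * d\<psi> l j u (\<omega>', X) \<partial>D)\<bar>
        \<le> L l j u * norm (\<omega> - \<omega>')" for l j u
    proof -
      have i: "integrable D (\<lambda>X. residual \<rho> l j X * d\<psi> l j u (\<omega>, X))" for \<omega>
        by (rule integrable_bounded_mult[OF ck_continuous[OF ck_d\<psi>[of 0]] residual_measurable[OF \<rho>] residual_bound])
      have "\<bar>\<integral>X. residual \<rho> l j X * d\<psi> l j u (\<omega>, X) - residual \<rho> l j X * d\<psi> l j u (\<omega>', X) \<partial>D\<bar> \<le> L l j u * norm (\<omega> - \<omega>')"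
      proof (rule integral_prob_bound)
        show "AE X in D. \<bar>residual \<rho> l j X * d\<psi> l j u (\<omega>, X) - residual \<rho> l j X * d\<psi> l j u (\<omega>', X)\<bar> \<le> L l j u * norm (\<omega> - \<omega>')"
          using residual_bound[of \<rho> l j] bounded_D
        proof eventually_elim
          case (elim X)
          have "\<bar>d\<psi> l j u (\<omega>, X) - d\<psi> l j u (\<omega>', X)\<bar> \<le> L l j u * norm (\<omega> - \<omega>')"
            using lipschitz_onD[OF L, of "(\<omega>, X)" "(\<omega>', X)" l j u] elim(2) \<omega>
            by (simp add: S_def dist_Pair_Pair dist_norm)
          with elim(1) have "\<bar>residual \<rho> l j X\<bar> * \<bar>d\<psi> l j u (\<omega>, X) - d\<psi> l j u (\<omega>', X)\<bar> \<le> 1 * (L l j u * norm (\<omega> - \<omega>'))"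
            by (intro mult_mono) auto
          then show ?case by (simp add: abs_mult[symmetric] right_diff_distrib)
        qed
        show "0 \<le> L l j u * norm (\<omega> - \<omega>')" using L0 by simp
      qed
      then show ?thesis by (simp add: i)
    qed
    have "norm (gradient (\<Phi> \<rho>) \<omega> - gradient (\<Phi> \<rho>) \<omega>')
        \<le> (\<Sum>b\<in>Basis. \<bar>(gradient (\<Phi> \<rho>) \<omega> - gradient (\<Phi> \<rho>) \<omega>') \<bullet> b\<bar>)"
      by (rule norm_le_l1)
    also have "\<dots> \<le> (\<Sum>b\<in>Basis. (1 / real CARD('l)) * (\<Sum>l\<in>UNIV. \<Sum>j\<in>UNIV. L l j b * norm (\<omega> - \<omega>')))"
    proof (rule sum_mono)
      fix b
      have "(gradient (\<Phi> \<rho>) \<omega> - gradient (\<Phi> \<rho>) \<omega>') \<bullet> b = first_variation_deriv \<rho> \<omega> b - first_variation_deriv \<rho> \<omega>' b"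
        by (simp add: inner_diff_left gradient_first_variation_inner[OF \<rho>])
      also have "\<dots> = (1 / real CARD('l)) * (\<Sum>l\<in>UNIV. \<Sum>j\<in>UNIV.
          (\<integral>X. residual \<rho> l j X * d\<psi> l j b (\<omega>, X) \<partial>D) - (\<integral>X. residual \<rho> l j X * d\<psi> l j b (\<omega>', X) \<partial>D))"
        unfolding first_variation_deriv_def by (simp add: right_diff_distrib sum_subtractf)
      also have "\<bar>\<dots>\<bar> \<le> (1 / real CARD('l)) * (\<Sum>l\<in>UNIV. \<Sum>j\<in>UNIV. L l j b * norm (\<omega> - \<omega>'))"
        unfolding abs_mult
        by (intro mult_mono order_trans[OF sum_abs] sum_mono int sum_nonneg) auto
      finally show "\<bar>(gradient (\<Phi> \<rho>) \<omega> - gradient (\<Phi> \<rho>) \<omega>') \<bullet> b\<bar>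
          \<le> (1 / real CARD('l)) * (\<Sum>l\<in>UNIV. \<Sum>j\<in>UNIV. L l j b * norm (\<omega> - \<omega>'))" .
    qed
    also have "\<dots> = C * norm (\<omega> - \<omega>')"
      unfolding C_def by (simp add: sum_distrib_right mult.assoc)
    finally show "norm (gradient (\<Phi> \<rho>) \<omega> - gradient (\<Phi> \<rho>) \<omega>') \<le> C * norm (\<omega> - \<omega>')" .
  qed
qed

text \<open>Brings the right side of the weak equation into a form where \<rho> occurs in the
  residual and in an innermost integral of a continuous function;
  \<open>continuous_expectation_along_curve\<close> handles exactly this form.\<close>

lemma integral_inner_gradient_first_variation:
  assumes \<rho>: "\<rho> \<in> prob_measures_on K" and g: "continuous_on UNIV g"
  shows "(\<integral>\<omega>. g \<omega> \<bullet> gradient (\<Phi> \<rho>) \<omega> \<partial>\<rho>) =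
    (\<Sum>b\<in>Basis. (1 / real CARD('l)) * (\<Sum>l\<in>UNIV. \<Sum>j\<in>UNIV.
      \<integral>X. residual \<rho> l j X * (\<integral>\<omega>. (g \<omega> \<bullet> b) * d\<psi> l j b (\<omega>, X) \<partial>\<rho>) \<partial>D))"
proof -
  have gd: "continuous_on UNIV (\<lambda>z. (g (fst z) \<bullet> b) * d\<psi> l j b z)" for l j b
    by (intro continuous_intros continuous_on_compose2[OF g] ck_continuous[OF ck_d\<psi>[of 0]]) auto
  have res: "(\<integral>X. residual \<rho> l j X * ((g \<omega> \<bullet> b) * d\<psi> l j b (\<omega>, X)) \<partial>D)
      = (g \<omega> \<bullet> b) * (\<integral>X. residual \<rho> l j X * d\<psi> l j b (\<omega>, X) \<partial>D)" for l j b \<omega>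
    by (subst integral_mult_right_zero[symmetric]) (simp add: mult.left_commute)
  have cont: "continuous_on UNIV (\<lambda>\<omega>. \<integral>X. residual \<rho> l j X * d\<psi> l j b (\<omega>, X) \<partial>D)" for l j b
    by (intro continuous_at_imp_continuous_on ballI, rule has_derivative_continuous,
        rule has_derivative_expectation[OF _ _ residual_measurable[OF \<rho>] residual_bound],
        rule ck_frechet(1)[OF ck_d\<psi>[of "Suc 0"]], rule ck_continuous[OF ck_frechet(2)[OF ck_d\<psi>[of "Suc 0"]]])
  have int: "integrable \<rho> (\<lambda>\<omega>. (g \<omega> \<bullet> b) * (\<integral>X. residual \<rho> l j X * d\<psi> l j b (\<omega>, X) \<partial>D))" for l j b
    by (intro integrable_prob_measures_on[OF \<rho> compact_K] continuous_intros g cont)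
  have swap: "(\<integral>\<omega>. (g \<omega> \<bullet> b) * (\<integral>X. residual \<rho> l j X * d\<psi> l j b (\<omega>, X) \<partial>D) \<partial>\<rho>)
      = (\<integral>X. residual \<rho> l j X * (\<integral>\<omega>. (g \<omega> \<bullet> b) * d\<psi> l j b (\<omega>, X) \<partial>\<rho>) \<partial>D)" for l j b
  proof -
    have "(\<integral>\<omega>. (\<integral>X. residual \<rho> l j X * (\<lambda>z. (g (fst z) \<bullet> b) * d\<psi> l j b z) (\<omega>, X) \<partial>D) \<partial>\<rho>)
        = (\<integral>X. residual \<rho> l j X * (\<integral>\<omega>. (\<lambda>z. (g (fst z) \<bullet> b) * d\<psi> l j b z) (\<omega>, X) \<partial>\<rho>) \<partial>D)"
      by (intro parameter_integral_swap[where K = K and M = 1] \<rho> compact_K gd residual_measurable residual_bound)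
    then show ?thesis by (simp add: res)
  qed
  have pull: "a * (c * (\<Sum>l\<in>UNIV. \<Sum>j\<in>UNIV. F l j)) = c * (\<Sum>l\<in>UNIV. \<Sum>j\<in>UNIV. a * F l j)"
    for a c :: real and F :: "'l \<Rightarrow> 'v \<Rightarrow> real"
    by (simp only: sum_distrib_left[symmetric] mult.left_commute[of a c])
  have "g \<omega> \<bullet> gradient (\<Phi> \<rho>) \<omega> = (\<Sum>b\<in>Basis. (1 / real CARD('l)) * (\<Sum>l\<in>UNIV. \<Sum>j\<in>UNIV.
      (g \<omega> \<bullet> b) * (\<integral>X. residual \<rho> l j X * d\<psi> l j b (\<omega>, X) \<partial>D)))" for \<omega>
    by (subst euclidean_inner) (simp only: gradient_first_variation_inner[OF \<rho>] first_variation_deriv_def pull)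
  then have "(\<integral>\<omega>. g \<omega> \<bullet> gradient (\<Phi> \<rho>) \<omega> \<partial>\<rho>) = (\<Sum>b\<in>Basis. (1 / real CARD('l)) * (\<Sum>l\<in>UNIV. \<Sum>j\<in>UNIV.
      (\<integral>\<omega>. (g \<omega> \<bullet> b) * (\<integral>X. residual \<rho> l j X * d\<psi> l j b (\<omega>, X) \<partial>D) \<partial>\<rho>)))"
    by (simp add: int)
  then show ?thesis by (simp only: swap)
qed

section \<open>Time regularity of weak solutions\<close>

lemma residual_continuous_along_curve:
  assumes \<rho>: "\<And>t. t \<ge> 0 \<Longrightarrow> \<rho> t \<in> prob_measures_on K" and nc: "narrowly_continuous \<rho>"
  shows "continuous_on {0..} (\<lambda>t. residual (\<rho> t) l j X)"
proof -
  have "continuous_on {0..} (\<lambda>t. mean_logits Wout (\<rho> t) l X $ m)" for m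
  proof -
    have "continuous_on UNIV (\<lambda>\<omega>. \<psi> l m (\<omega>, X))"
      by (intro continuous_on_compose2[OF ck_continuous[OF ck_\<psi>[of 0]]] continuous_intros) auto
    from narrowly_continuous_integral[OF _ nc compact_K this]
    have "continuous_on {0..} (\<lambda>t. \<integral>\<omega>. \<psi> l m (\<omega>, X) \<partial>\<rho> t)"
      using \<rho> by blast
    then show ?thesis
      by (rule continuous_on_eq) (simp add: mean_logits_nth[OF \<rho>])
  qed
  then have "continuous_on {0..} (\<lambda>t. \<chi> m. mean_logits Wout (\<rho> t) l X $ m)"
    by (rule continuous_on_vec_lambda)
  then have "continuous_on {0..} (\<lambda>t. mean_logits Wout (\<rho> t) l X)"
    by simp
  then have "continuous_on {0..} (\<lambda>t. softmax (mean_logits Wout (\<rho> t) l X) $ j)"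
    by (rule continuous_on_compose2[OF continuous_on_softmax_nth]) simp
  then show ?thesis
    unfolding residual_def by (rule continuous_on_diff[OF _ continuous_on_const])
qed

text \<open>The right side of the equation is continuous in t along a narrowly continuous curve, so
  the distributional derivative is a classical one, one-sided at 0.\<close>

lemma weak_solution_has_derivative:
  assumes ws: "weak_solution D Wout Y \<zeta> K \<rho>" and \<zeta>: "continuous_on {0..} \<zeta>"
    and f: "C1_function f" and "t \<ge> 0"
  shows "((\<lambda>t. \<integral>\<omega>. f \<omega> \<partial>\<rho> t) has_real_derivative
    - 2 * \<zeta> t * (\<integral>\<omega>. gradient f \<omega> \<bullet> gradient (\<Phi> (\<rho> t)) \<omega> \<partial>\<rho> t)) (at t within {0..})"
proof (rule weak_derivative_imp_has_derivative[OF _ _ _ \<open>t \<ge> 0\<close>])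
  have \<rho>: "\<And>t. t \<ge> 0 \<Longrightarrow> \<rho> t \<in> prob_measures_on K" and nc: "narrowly_continuous \<rho>"
    using ws unfolding weak_solution_def by auto
  have fc: "continuous_on UNIV f"
    using f differentiable_imp_continuous_within
    unfolding C1_function_def by (metis continuous_at_imp_continuous_on)
  have gc: "continuous_on UNIV (gradient f)" using f unfolding C1_function_def by blast
  show "continuous_on {0..} (\<lambda>t. \<integral>\<omega>. f \<omega> \<partial>\<rho> t)"
    by (rule narrowly_continuous_integral[OF \<rho> nc compact_K fc])
  have gd: "continuous_on UNIV (\<lambda>z. (gradient f (fst z) \<bullet> b) * d\<psi> l j b z)" for l j b
    by (intro continuous_intros continuous_on_compose2[OF gc] ck_continuous[OF ck_d\<psi>[of 0]]) auto
  have "continuous_on {0..} (\<lambda>t. \<integral>X. residual (\<rho> t) l j X *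
      (\<integral>\<omega>. (\<lambda>z. (gradient f (fst z) \<bullet> b) * d\<psi> l j b z) (\<omega>, X) \<partial>\<rho> t) \<partial>D)" for l j b
    by (intro continuous_expectation_along_curve[where K = K and M = 1] \<rho> nc compact_K gd
        residual_measurable residual_bound residual_continuous_along_curve)
  then have "continuous_on {0..} (\<lambda>t. \<Sum>b\<in>Basis. (1 / real CARD('l)) * (\<Sum>l\<in>UNIV. \<Sum>j\<in>UNIV.
      \<integral>X. residual (\<rho> t) l j X * (\<integral>\<omega>. (gradient f \<omega> \<bullet> b) * d\<psi> l j b (\<omega>, X) \<partial>\<rho> t) \<partial>D))"
    unfolding fst_conv by (intro continuous_intros)
  then have "continuous_on {0..} (\<lambda>t. \<integral>\<omega>. gradient f \<omega> \<bullet> gradient (\<Phi> (\<rho> t)) \<omega> \<partial>\<rho> t)"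
    by (rule continuous_on_eq) (simp add: integral_inner_gradient_first_variation[OF \<rho> gc])
  then show "continuous_on {0..} (\<lambda>t. - 2 * \<zeta> t * (\<integral>\<omega>. gradient f \<omega> \<bullet> gradient (\<Phi> (\<rho> t)) \<omega> \<partial>\<rho> t))"
    by (intro continuous_intros \<zeta>)
  show "- (LBINT t:{0<..}. deriv \<phi> t * (\<integral>\<omega>. f \<omega> \<partial>\<rho> t)) =
      (LBINT t:{0<..}. \<phi> t * (- 2 * \<zeta> t * (\<integral>\<omega>. gradient f \<omega> \<bullet> gradient (\<Phi> (\<rho> t)) \<omega> \<partial>\<rho> t)))"
    if "time_test_function \<phi>" for \<phi>
    using ws f that unfolding weak_solution_def by blast
qed

end

section \<open>Solutions starting at a Dirac mass\<close>

lemma C1_functionI: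
  fixes f :: "'a::euclidean_space \<Rightarrow> real"
  assumes "\<And>x. (f has_derivative (\<lambda>h. h \<bullet> g x)) (at x)" "continuous_on UNIV g"
  shows "C1_function f" "gradient f x = g x"
proof -
  have eq: "gradient f x = g x" for x
    by (rule euclidean_eqI) (simp add: gradient_inner[OF assms(1)] inner_commute)
  then show "gradient f x = g x" .
  have "gradient f = g" using eq by blast
  then show "C1_function f"
    using assms unfolding C1_function_def differentiable_def by auto
qed

lemma C1_inner: "C1_function (\<lambda>x. x \<bullet> b)" "gradient (\<lambda>x. x \<bullet> b) x = b"
  by (rule C1_functionI[where g = "\<lambda>_. b"]; auto intro!: derivative_eq_intros)+

lemma C1_norm_square:
  "C1_function (\<lambda>x. (x - a) \<bullet> (x - a))" "gradient (\<lambda>x. (x - a) \<bullet> (x - a)) x = 2 *\<^sub>R (x - a)"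
proof -
  have 1: "((\<lambda>x. (x - a) \<bullet> (x - a)) has_derivative (\<lambda>h. h \<bullet> (2 *\<^sub>R (x - a)))) (at x)" for x
    by (auto intro!: derivative_eq_intros simp: inner_commute)
  have 2: "continuous_on UNIV (\<lambda>x. 2 *\<^sub>R (x - a))" by (intro continuous_intros)
  show "C1_function (\<lambda>x. (x - a) \<bullet> (x - a))" "gradient (\<lambda>x. (x - a) \<bullet> (x - a)) x = 2 *\<^sub>R (x - a)"
    by (rule C1_functionI[OF 1 2])+
qed

context attention_flow
begin

text \<open>\<omega> - a has mean zero, so the constant vector
  \<open>gradient (\<Phi> \<rho>) a\<close> may be subtracted; Cauchy-Schwarz and the Lipschitz
  bound do the rest. The mean a is only known to lie in the ball of radius r, which is where the
  Lipschitz bound is assumed.\<close>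

lemma variance_derivative_bound:
  assumes \<rho>: "\<rho> \<in> prob_measures_on K" and r: "K \<subseteq> cball 0 r"
    and C: "C \<ge> 0" "\<And>\<omega> \<omega>'. norm \<omega> \<le> r \<Longrightarrow> norm \<omega>' \<le> r \<Longrightarrow>
      norm (gradient (\<Phi> \<rho>) \<omega> - gradient (\<Phi> \<rho>) \<omega>') \<le> C * norm (\<omega> - \<omega>')"
  defines "a \<equiv> (\<integral>\<omega>. \<omega> \<partial>\<rho>)"
  shows "- (\<integral>\<omega>. (\<omega> - a) \<bullet> gradient (\<Phi> \<rho>) \<omega> \<partial>\<rho>) \<le> C * (\<integral>\<omega>. (\<omega> - a) \<bullet> (\<omega> - a) \<partial>\<rho>)"
proof -
  interpret \<rho>: prob_space \<rho> using \<rho> by (simp add: prob_measures_on_def)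
  have K: "AE \<omega> in \<rho>. \<omega> \<in> K" using \<rho> by (simp add: prob_measures_on_def)
  note int = integrable_prob_measures_on[OF \<rho> compact_K]
  have i1: "integrable \<rho> (\<lambda>\<omega>. \<omega>)" by (intro int continuous_intros)
  have "norm a \<le> (\<integral>\<omega>. norm \<omega> \<partial>\<rho>)" unfolding a_def by (rule integral_norm_bound)
  also have "\<dots> \<le> (\<integral>\<omega>. r \<partial>\<rho>)"
    using K by (intro integral_mono_AE integrable_norm i1) (use r in \<open>auto elim!: eventually_mono\<close>)
  finally have a: "norm a \<le> r" by (simp add: \<rho>.prob_space)
  have zero: "(\<integral>\<omega>. (\<omega> - a) \<bullet> gradient (\<Phi> \<rho>) a \<partial>\<rho>) = 0"
    by (subst integral_inner_left) (simp_all add: i1 a_def \<rho>.prob_space)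
  note cG = gradient_first_variation_continuous[OF \<rho>]
  have "- (\<integral>\<omega>. (\<omega> - a) \<bullet> gradient (\<Phi> \<rho>) \<omega> \<partial>\<rho>)
      = (\<integral>\<omega>. (\<omega> - a) \<bullet> (gradient (\<Phi> \<rho>) a - gradient (\<Phi> \<rho>) \<omega>) \<partial>\<rho>)"
    unfolding inner_diff_right
    by (subst Bochner_Integration.integral_diff) (intro int continuous_intros cG | simp add: zero)+
  also have "\<dots> \<le> (\<integral>\<omega>. C * ((\<omega> - a) \<bullet> (\<omega> - a)) \<partial>\<rho>)"
  proof (rule integral_mono_AE)
    show "AE \<omega> in \<rho>. (\<omega> - a) \<bullet> (gradient (\<Phi> \<rho>) a - gradient (\<Phi> \<rho>) \<omega>) \<le> C * ((\<omega> - a) \<bullet> (\<omega> - a))"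
      using K
    proof eventually_elim
      case (elim \<omega>)
      then have "norm \<omega> \<le> r" using r by auto
      have "(\<omega> - a) \<bullet> (gradient (\<Phi> \<rho>) a - gradient (\<Phi> \<rho>) \<omega>)
          \<le> norm (\<omega> - a) * norm (gradient (\<Phi> \<rho>) a - gradient (\<Phi> \<rho>) \<omega>)"
        by (rule norm_cauchy_schwarz)
      also have "\<dots> \<le> norm (\<omega> - a) * (C * norm (a - \<omega>))"
        by (intro mult_left_mono C(2) a \<open>norm \<omega> \<le> r\<close>) auto
      also have "\<dots> = C * ((\<omega> - a) \<bullet> (\<omega> - a))"
        by (simp add: norm_minus_commute[of a] power2_norm_eq_inner[symmetric] power2_eq_square)
      finally show ?case .
    qed
  qed (intro int continuous_intros cG)+
  finally show ?thesis by simp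
qed

text \<open>At \<open>t = s\<close> the derivative of the variance equals that of \<open>\<integral>|\<omega> - m s|\<^sup>2 d\<rho>\<^sub>t\<close> with frozen centre,
  because the difference \<open>|m t - m s|\<^sup>2\<close> vanishes to second order.\<close>

lemma weak_solution_variance_zero:
  assumes ws: "weak_solution D Wout Y \<zeta> K \<rho>" and \<rho>0: "\<rho> 0 = return borel w"
    and \<zeta>: "continuous_on {0..} \<zeta>" "\<And>t. t \<ge> 0 \<Longrightarrow> 0 \<le> \<zeta> t" "\<And>t. t \<ge> 0 \<Longrightarrow> \<zeta> t \<le> Z"
    and "t \<ge> 0"
  defines "m \<equiv> \<lambda>t. \<integral>\<omega>. \<omega> \<partial>\<rho> t"
  shows "(\<integral>\<omega>. (\<omega> - m t) \<bullet> (\<omega> - m t) \<partial>\<rho> t) \<le> 0"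
proof -
  have \<rho>: "\<And>t. t \<ge> 0 \<Longrightarrow> \<rho> t \<in> prob_measures_on K"
    using ws unfolding weak_solution_def by auto
  note deriv = weak_solution_has_derivative[OF ws \<zeta>(1)]
  define Var where "Var t = (\<integral>\<omega>. (\<omega> - m t) \<bullet> (\<omega> - m t) \<partial>\<rho> t)" for t
  \<comment> \<open>Steiner's identity; it separates the effect of the moving centre from the
    variance.\<close>
  have split: "(\<integral>\<omega>. (\<omega> - a) \<bullet> (\<omega> - a) \<partial>\<rho> t) = Var t + (m t - a) \<bullet> (m t - a)" if "t \<ge> 0" for t a
  proof -
    interpret \<rho>: prob_space "\<rho> t" using \<rho>[OF that] by (simp add: prob_measures_on_def)
    note int = integrable_prob_measures_on[OF \<rho>[OF that] compact_K]
    define u c where "u = 2 *\<^sub>R (m t - a)" and "c = (m t - a) \<bullet> (m t - a) - m t \<bullet> u"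
    have eq: "(\<omega> - a) \<bullet> (\<omega> - a) = (\<omega> - m t) \<bullet> (\<omega> - m t) + (\<omega> \<bullet> u + c)" for \<omega>
      by (simp add: u_def c_def inner_diff_left inner_diff_right inner_commute algebra_simps)
    have i: "integrable (\<rho> t) (\<lambda>\<omega>. (\<omega> - m t) \<bullet> (\<omega> - m t))" "integrable (\<rho> t) (\<lambda>\<omega>. \<omega> \<bullet> u)"
      by (intro int continuous_intros)+
    have u: "(\<integral>\<omega>. \<omega> \<bullet> u \<partial>\<rho> t) = m t \<bullet> u"
      unfolding m_def by (intro integral_inner_left) (intro int continuous_intros)
    have "(\<integral>\<omega>. (\<omega> - a) \<bullet> (\<omega> - a) \<partial>\<rho> t) = Var t + ((\<integral>\<omega>. \<omega> \<bullet> u \<partial>\<rho> t) + (\<integral>\<omega>. c \<partial>\<rho> t))"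
      unfolding eq Var_def
      by (simp only: Bochner_Integration.integral_add[OF i(1) Bochner_Integration.integrable_add[OF i(2) \<rho>.integrable_const]]
          Bochner_Integration.integral_add[OF i(2) \<rho>.integrable_const])
    also have "\<dots> = Var t + (m t - a) \<bullet> (m t - a)"
      by (simp add: u \<rho>.prob_space c_def)
    finally show ?thesis .
  qed
  have m': "((\<lambda>t. m t \<bullet> b) has_real_derivative
      - 2 * \<zeta> t * (\<integral>\<omega>. b \<bullet> gradient (\<Phi> (\<rho> t)) \<omega> \<partial>\<rho> t)) (at t within {0..})" if "t \<ge> 0" for t b
  proof -
    have eq: "(\<integral>\<omega>. \<omega> \<bullet> b \<partial>\<rho> t) = m t \<bullet> b" if "t \<ge> 0" for t
      unfolding m_def
      by (intro integral_inner_left integrable_prob_measures_on[OF \<rho>[OF that] compact_K] continuous_intros)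
    from deriv[OF C1_inner(1) that, of b] show ?thesis
      unfolding C1_inner(2)
      by (rule has_field_derivative_transform_within[of _ _ _ _ 1]) (use that eq in auto)
  qed
  define V' where "V' t = - 4 * \<zeta> t * (\<integral>\<omega>. (\<omega> - m t) \<bullet> gradient (\<Phi> (\<rho> t)) \<omega> \<partial>\<rho> t)" for t
  have Var': "(Var has_real_derivative V' s) (at s within {0..})" if "s \<ge> 0" for s
  proof -
    have "((\<lambda>t. \<integral>\<omega>. (\<omega> - m s) \<bullet> (\<omega> - m s) \<partial>\<rho> t) has_real_derivative V' s) (at s within {0..})"
      using deriv[OF C1_norm_square(1) that, of "m s"] by (simp add: C1_norm_square(2) V'_def mult.assoc)
    moreover have "((\<lambda>t. (m t - m s) \<bullet> (m t - m s)) has_real_derivative 0) (at s within {0..})"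
    proof -
      have "((\<lambda>t. \<Sum>b\<in>Basis. (m t \<bullet> b - m s \<bullet> b) * (m t \<bullet> b - m s \<bullet> b)) has_real_derivative (\<Sum>b\<in>(Basis :: ('x, 'k) head set). 0)) (at s within {0..})"
      proof (rule DERIV_sum)
        fix b :: "('x, 'k) head"
        show "((\<lambda>t. (m t \<bullet> b - m s \<bullet> b) * (m t \<bullet> b - m s \<bullet> b)) has_real_derivative 0) (at s within {0..})"
          by (rule DERIV_mult[OF DERIV_diff[OF m'[OF that] DERIV_const] DERIV_diff[OF m'[OF that] DERIV_const], THEN DERIV_cong]) simp
      qed
      moreover have "(m t - m s) \<bullet> (m t - m s) = (\<Sum>b\<in>Basis. (m t \<bullet> b - m s \<bullet> b) * (m t \<bullet> b - m s \<bullet> b))" for t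
        by (subst euclidean_inner) (simp add: inner_diff_left)
      ultimately show ?thesis by simp
    qed
    ultimately have "((\<lambda>t. (\<integral>\<omega>. (\<omega> - m s) \<bullet> (\<omega> - m s) \<partial>\<rho> t) - (m t - m s) \<bullet> (m t - m s)) has_real_derivative V' s - 0) (at s within {0..})"
      by (rule DERIV_diff)
    then have "((\<lambda>t. (\<integral>\<omega>. (\<omega> - m s) \<bullet> (\<omega> - m s) \<partial>\<rho> t) - (m t - m s) \<bullet> (m t - m s)) has_real_derivative V' s) (at s within {0..})"
      by simp
    then show ?thesis
      by (rule has_field_derivative_transform_within[of _ _ _ _ 1]) (use that split in auto)
  qed
  obtain r where r: "K \<subseteq> cball 0 r"
    using compact_imp_bounded[OF compact_K] unfolding bounded_iff by (auto simp: subset_iff)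
  obtain C where C: "C \<ge> 0"
    "\<And>\<rho> \<omega> \<omega>'. \<rho> \<in> prob_measures_on K \<Longrightarrow> norm \<omega> \<le> r \<Longrightarrow> norm \<omega>' \<le> r \<Longrightarrow>
      norm (gradient (\<Phi> \<rho>) \<omega> - gradient (\<Phi> \<rho>) \<omega>') \<le> C * norm (\<omega> - \<omega>')"
    using gradient_first_variation_Lipschitz[of r] by blast
  have Var_nonneg: "Var t \<ge> 0" for t
    unfolding Var_def by (rule Bochner_Integration.integral_nonneg) simp
  have growth: "V' t \<le> 4 * Z * C * Var t" if "t \<ge> 0" for t
  proof -
    have "- (\<integral>\<omega>. (\<omega> - m t) \<bullet> gradient (\<Phi> (\<rho> t)) \<omega> \<partial>\<rho> t) \<le> C * Var t"
      unfolding Var_def m_def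
      by (rule variance_derivative_bound[OF \<rho>[OF that] r C(1) C(2)[OF \<rho>[OF that]]])
    then have "4 * \<zeta> t * (- (\<integral>\<omega>. (\<omega> - m t) \<bullet> gradient (\<Phi> (\<rho> t)) \<omega> \<partial>\<rho> t)) \<le> 4 * \<zeta> t * (C * Var t)"
      using \<zeta>(2)[OF that] by (intro mult_left_mono) auto
    then have "V' t \<le> 4 * \<zeta> t * (C * Var t)"
      unfolding V'_def by (simp only: mult_minus_left mult_minus_right)
    also have "\<dots> \<le> 4 * Z * (C * Var t)"
      using \<zeta>(3)[OF that] Var_nonneg C(1) by (intro mult_right_mono) auto
    finally show ?thesis by (simp add: mult.assoc)
  qed
  \<comment> \<open>Integrating factor for Var' \<le> 4 Z C Var; the initial variance is that of a
    Dirac mass, namely 0.\<close>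
  have "Var t * exp (- (4 * Z * C) * t) \<le> Var 0 * exp (- (4 * Z * C) * 0)"
  proof (rule nonincreasing_of_derivative_within[OF _ _ \<open>t \<ge> 0\<close>])
    fix t :: real assume t: "t \<ge> 0"
    show "((\<lambda>t. Var t * exp (- (4 * Z * C) * t)) has_real_derivative
        (V' t - 4 * Z * C * Var t) * exp (- (4 * Z * C) * t)) (at t within {0..})"
      by (auto intro!: derivative_eq_intros Var'[OF t] simp: algebra_simps)
    show "(V' t - 4 * Z * C * Var t) * exp (- (4 * Z * C) * t) \<le> 0"
      using growth[OF t] by (intro mult_nonpos_nonneg) auto
  qed
  moreover have "Var 0 = 0"
  proof -
    have "m 0 = w" unfolding m_def \<rho>0 by (subst integral_return) auto
    then show ?thesis
      unfolding Var_def \<rho>0 by (subst integral_return) (auto intro!: borel_measurable_continuous_onI continuous_intros)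
  qed
  ultimately have "Var t * exp (- (4 * Z * C) * t) \<le> 0" by simp
  then have "Var t \<le> 0" by (simp add: mult_le_0_iff)
  then show ?thesis by (simp add: Var_def)
qed

text \<open>\<open>G(w) = \<nabla>\<Phi>(w; \<delta>\<^sub>w)\<close>, written through partial derivatives so that it is also meaningful for
  \<open>w\<close> outside \<open>K\<close>, where the gradient formula for measures on \<open>K\<close> does not apply; differentiating
  at a point of \<open>K\<close> needs a full neighbourhood.\<close>

definition particle_velocity :: "('x, 'k) head \<Rightarrow> ('x, 'k) head" where
  "particle_velocity w = (\<Sum>b\<in>Basis. first_variation_deriv (return borel w) w b *\<^sub>R b)"

lemma particle_velocity_eq_gradient:
  assumes "w \<in> K"
  shows "particle_velocity w = gradient (\<Phi> (return borel w)) w"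
  unfolding particle_velocity_def
  by (rule euclidean_eqI)
     (simp add: gradient_first_variation_inner return_mem_prob_measures_on[OF compact_K] assms)

text \<open>Zero variance concentrates each \<open>\<rho> t\<close> at its mean, which then lies in
  K because the measure does. Testing with coordinate functions yields the equation for m, as
  integration against a Dirac mass is evaluation.\<close>

lemma weak_solution_from_Dirac:
  assumes ws: "weak_solution D Wout Y \<zeta> K \<rho>" and \<rho>0: "\<rho> 0 = return borel w"
    and \<zeta>: "continuous_on {0..} \<zeta>" "\<And>t. t \<ge> 0 \<Longrightarrow> 0 \<le> \<zeta> t" "\<And>t. t \<ge> 0 \<Longrightarrow> \<zeta> t \<le> Z"
  defines "m \<equiv> \<lambda>t. \<integral>\<omega>. \<omega> \<partial>\<rho> t"
  shows "m 0 = w" "\<And>t. t \<ge> 0 \<Longrightarrow> m t \<in> K" "\<And>t. t \<ge> 0 \<Longrightarrow> \<rho> t = return borel (m t)"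
    "\<And>t. t \<ge> 0 \<Longrightarrow> (m has_vector_derivative (- 2 * \<zeta> t) *\<^sub>R particle_velocity (m t)) (at t within {0..})"
proof -
  have \<rho>: "\<And>t. t \<ge> 0 \<Longrightarrow> \<rho> t \<in> prob_measures_on K"
    using ws unfolding weak_solution_def by auto
  show "m 0 = w" unfolding m_def \<rho>0 by (subst integral_return) auto
  show ret: "\<rho> t = return borel (m t)" if "t \<ge> 0" for t
  proof (rule eq_return_of_AE_eq)
    show "prob_space (\<rho> t)" "sets (\<rho> t) = sets borel"
      using \<rho>[OF that] by (auto simp: prob_measures_on_def)
    have int: "integrable (\<rho> t) (\<lambda>\<omega>. (\<omega> - m t) \<bullet> (\<omega> - m t))"
      by (intro integrable_prob_measures_on[OF \<rho>[OF that] compact_K] continuous_intros)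
    have "(\<integral>\<omega>. (\<omega> - m t) \<bullet> (\<omega> - m t) \<partial>\<rho> t) \<le> 0"
      unfolding m_def by (rule weak_solution_variance_zero[OF ws \<rho>0 \<zeta> that])
    moreover have "(\<integral>\<omega>. (\<omega> - m t) \<bullet> (\<omega> - m t) \<partial>\<rho> t) \<ge> 0"
      by (rule Bochner_Integration.integral_nonneg) simp
    ultimately have "AE \<omega> in \<rho> t. (\<omega> - m t) \<bullet> (\<omega> - m t) = 0"
      using integral_nonneg_eq_0_iff_AE[OF int] by simp
    then show "AE \<omega> in \<rho> t. \<omega> = m t" by simp
  qed
  show mK: "m t \<in> K" if "t \<ge> 0" for t
    using \<rho>[OF that] unfolding ret[OF that] by (simp add: return_mem_prob_measures_on[OF compact_K])
  fix t :: real assume t: "t \<ge> 0"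
  have G: "gradient (\<Phi> (\<rho> t)) \<in> borel_measurable borel"
    by (intro borel_measurable_continuous_onI gradient_first_variation_continuous \<rho> t)
  have "((\<lambda>t. m t \<bullet> b) has_vector_derivative ((- 2 * \<zeta> t) *\<^sub>R particle_velocity (m t)) \<bullet> b) (at t within {0..})" for b
  proof -
    have eq: "(\<integral>\<omega>. \<omega> \<bullet> b \<partial>\<rho> t) = m t \<bullet> b" if "t \<ge> 0" for t
      unfolding m_def
      by (intro integral_inner_left integrable_prob_measures_on[OF \<rho>[OF that] compact_K] continuous_intros)
    have "(\<integral>\<omega>. b \<bullet> gradient (\<Phi> (\<rho> t)) \<omega> \<partial>\<rho> t) = b \<bullet> gradient (\<Phi> (\<rho> t)) (m t)"
      using G by (subst ret[OF t], subst integral_return) auto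
    also have "\<dots> = particle_velocity (m t) \<bullet> b"
      unfolding particle_velocity_eq_gradient[OF mK[OF t]] ret[OF t, symmetric] by (rule inner_commute)
    finally have "((\<lambda>t. \<integral>\<omega>. \<omega> \<bullet> b \<partial>\<rho> t) has_real_derivative - 2 * \<zeta> t * (particle_velocity (m t) \<bullet> b)) (at t within {0..})"
      using weak_solution_has_derivative[OF ws \<zeta>(1) C1_inner(1) t, of b] by (simp add: C1_inner(2))
    then have "((\<lambda>t. m t \<bullet> b) has_real_derivative - 2 * \<zeta> t * (particle_velocity (m t) \<bullet> b)) (at t within {0..})"
      by (rule has_field_derivative_transform_within[of _ _ _ _ 1]) (use t eq in auto)
    then show ?thesis
      by (simp add: has_real_derivative_iff_has_vector_derivative)
  qed
  then show "(m has_vector_derivative (- 2 * \<zeta> t) *\<^sub>R particle_velocity (m t)) (at t within {0..})"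
    unfolding has_vector_derivative_def
    by (subst has_derivative_componentwise_within) (simp add: mult.assoc)
qed

end

section \<open>The Hessian of the risk\<close>

text \<open>The origin of \<open>softmax_cov\<close> in \<open>H_tr\<close>: the quotient rule gives
  p_j (F_j' - \<Sum> p_i F_i'), which is row j of diag p - p p^T applied to F'.\<close>

lemma has_derivative_softmax_nth:
  fixes F :: "'v::finite \<Rightarrow> 'a::real_normed_vector \<Rightarrow> real"
  assumes F: "\<And>m. (F m has_derivative F' m) (at z)"
  shows "((\<lambda>z. softmax (\<chi> m. F m z) $ j) has_derivative
    (\<lambda>h. \<Sum>i\<in>UNIV. softmax_cov (softmax (\<chi> m. F m z)) $ j $ i * F' i h)) (at z)"
proof -
  define S where "S z = (\<Sum>m\<in>UNIV. exp (F m z))" for z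
  have S: "S z > 0" for z unfolding S_def by (rule sum_pos) auto
  define p where "p i = exp (F i z) / S z" for i
  have S': "(S has_derivative (\<lambda>h. \<Sum>m\<in>UNIV. F' m h * exp (F m z))) (at z)"
    unfolding S_def by (intro has_derivative_sum has_derivative_exp F)
  have "((\<lambda>z. exp (F j z) / S z) has_derivative
      (\<lambda>h. (F' j h * exp (F j z) * S z - exp (F j z) * (\<Sum>m\<in>UNIV. F' m h * exp (F m z))) / (S z * S z))) (at z)"
    using S[of z] by (intro has_derivative_divide' has_derivative_exp F S') simp
  moreover have "(F' j h * exp (F j z) * S z - exp (F j z) * (\<Sum>m\<in>UNIV. F' m h * exp (F m z))) / (S z * S z)
      = (\<Sum>i\<in>UNIV. softmax_cov (softmax (\<chi> m. F m z)) $ j $ i * F' i h)" for h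
  proof -
    have "(\<Sum>i\<in>UNIV. softmax_cov (softmax (\<chi> m. F m z)) $ j $ i * F' i h)
        = (\<Sum>i\<in>UNIV. (if j = i then p i * F' i h else 0) - p j * (p i * F' i h))"
      by (intro sum.cong refl) (auto simp: softmax_cov_def softmax_def p_def S_def algebra_simps)
    also have "\<dots> = p j * F' j h - p j * (\<Sum>i\<in>UNIV. p i * F' i h)"
      by (simp add: sum_subtractf sum_distrib_left)
    also have "(\<Sum>i\<in>UNIV. p i * F' i h) = (\<Sum>m\<in>UNIV. F' m h * exp (F m z)) / S z"
      by (simp add: p_def sum_divide_distrib mult.commute)
    also have "p j * F' j h - p j * ((\<Sum>m\<in>UNIV. F' m h * exp (F m z)) / S z)
      = (F' j h * exp (F j z) * S z - exp (F j z) * (\<Sum>m\<in>UNIV. F' m h * exp (F m z))) / (S z * S z)"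
      using S[of z] by (simp add: p_def field_simps)
    finally show ?thesis ..
  qed
  ultimately show ?thesis
    by (simp add: softmax_def S_def)
qed

lemma softmax_cov_symmetric: "softmax_cov p $ i $ j = softmax_cov p $ j $ i"
  by (simp add: softmax_cov_def mult.commute)

lemma jacobian_apply:
  fixes f :: "'a::euclidean_space \<Rightarrow> 'b::real_normed_vector"
  assumes "(f has_derivative f') (at x)"
  shows "blinfun_apply (jacobian f x) = f'"
proof -
  have "frechet_derivative f (at x) = f'"
    using frechet_derivative_at[OF assms] by simp
  then show ?thesis
    unfolding jacobian_def
    using bounded_linear_Blinfun_apply[OF has_derivative_bounded_linear[OF assms]] by simp
qed

lemma linear_symmetric_of_Basis:
  fixes H :: "'a::euclidean_space \<Rightarrow> 'a"
  assumes "linear H" "\<And>b c. b \<in> Basis \<Longrightarrow> c \<in> Basis \<Longrightarrow> H b \<bullet> c = b \<bullet> H c"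
  shows "H x \<bullet> y = x \<bullet> H y"
proof -
  have H: "H x = (\<Sum>b\<in>Basis. (x \<bullet> b) *\<^sub>R H b)" for x
    by (subst euclidean_representation[symmetric, of x])
       (simp only: linear_sum[OF assms(1)] linear_cmul[OF assms(1)])
  have eq: "H x \<bullet> b = x \<bullet> H b" if "b \<in> Basis" for b
  proof -
    have "H x \<bullet> b = (\<Sum>c\<in>Basis. (x \<bullet> c) * (H c \<bullet> b))"
      by (subst H) (simp add: inner_sum_left)
    also have "\<dots> = (\<Sum>c\<in>Basis. (x \<bullet> c) * (H b \<bullet> c))"
      using assms(2) that by (intro sum.cong refl) (simp add: inner_commute)
    also have "\<dots> = x \<bullet> H b"
      by (rule euclidean_inner[symmetric])
    finally show ?thesis .
  qed
  have "H x \<bullet> y = (\<Sum>b\<in>Basis. (H x \<bullet> b) * (y \<bullet> b))"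
    by (rule euclidean_inner)
  also have "\<dots> = (\<Sum>b\<in>Basis. (y \<bullet> b) * (x \<bullet> H b))"
    by (intro sum.cong refl) (simp add: eq)
  also have "\<dots> = x \<bullet> H y"
    by (subst (2) H) (simp add: inner_sum_right)
  finally show ?thesis .
qed

section \<open>Derivative of the particle velocity and its symmetry\<close>

context attention_flow
begin

definition p :: "'l \<Rightarrow> 'v \<Rightarrow> ('x, 'k) head \<times> ('x, 'l) tokens \<Rightarrow> real" where
  "p l j z = softmax (\<chi> m. \<psi> l m z) $ j"

definition S :: "'l \<Rightarrow> 'v \<Rightarrow> 'v \<Rightarrow> ('x, 'k) head \<times> ('x, 'l) tokens \<Rightarrow> real" where
  "S l j i z = softmax_cov (softmax (\<chi> m. \<psi> l m z)) $ j $ i"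

definition dd\<psi> :: "'l \<Rightarrow> 'v \<Rightarrow> ('x, 'k) head \<Rightarrow> ('x, 'k) head \<Rightarrow> ('x, 'k) head \<times> ('x, 'l) tokens \<Rightarrow> real" where
  "dd\<psi> l j b u z = frechet_derivative (d\<psi> l j b) (at z) (u, 0)"

text \<open>Second derivative at w, in the directions b and u, of the cross-entropy risk of a single
  head. Predictions and labels sit in separate integrals because p varies with w and gets
  differentiated, while Y is a fixed measurable weight.\<close>

definition risk_hessian :: "('x, 'k) head \<Rightarrow> ('x, 'k) head \<Rightarrow> ('x, 'k) head \<Rightarrow> real" where
  "risk_hessian w b u = (1 / real CARD('l)) * (\<Sum>l\<in>UNIV. \<Sum>j\<in>UNIV.
     (\<integral>X. p l j (w, X) * dd\<psi> l j b u (w, X) + (\<Sum>i\<in>UNIV. S l j i (w, X) * d\<psi> l i u (w, X)) * d\<psi> l j b (w, X) \<partial>D)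
     - (\<integral>X. Y l X $ j * dd\<psi> l j b u (w, X) \<partial>D))"

lemma ck_p: "ck n (p l j)"
proof -
  have "(\<Sum>m\<in>UNIV. exp (\<psi> l m z)) \<noteq> 0" for z
    by (rule less_imp_neq[THEN not_sym], rule sum_pos) auto
  then show ?thesis
    unfolding p_def softmax_def by (simp add: ck_divide ck_exp ck_sum ck_\<psi>)
qed

lemma S_continuous: "continuous_on UNIV (S l j i)"
proof -
  have "S l j i = (\<lambda>z. (if j = i then p l j z else 0) - p l j z * p l i z)"
    by (simp add: S_def p_def softmax_cov_def fun_eq_iff)
  then show ?thesis
    by (cases "j = i") (auto intro!: continuous_intros ck_continuous[OF ck_p[of 0]])
qed

lemma dd\<psi>_continuous: "continuous_on UNIV (dd\<psi> l j b u)"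
  unfolding dd\<psi>_def using ck_frechet(2)[OF ck_d\<psi>[of "Suc 0"]] by (rule ck_continuous)

lemma dd\<psi>_symmetric: "dd\<psi> l j b u z = dd\<psi> l j u b z"
  unfolding dd\<psi>_def d\<psi>_def by (rule ck_second_derivative_symmetric[OF ck_\<psi>])

lemma label_measurable: "(\<lambda>X. Y l X $ j) \<in> borel_measurable D"
  using measurable_compose[OF labels_measurable borel_measurable_continuous_onI[OF continuous_on_component[OF continuous_on_id]]]
  by simp

lemma label_bound: "AE X in D. \<bar>Y l X $ j\<bar> \<le> 1"
  using labels_one_hot
proof eventually_elim
  case (elim X)
  then have "0 \<le> Y l X $ j \<and> Y l X $ j \<le> 1" using one_hot_nth_bounds by blast
  then show ?case by linarith
qed

lemma integrable_continuous: "continuous_on UNIV g \<Longrightarrow> integrable D (\<lambda>X. g (w, X))"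
  for g :: "('x, 'k) head \<times> ('x, 'l) tokens \<Rightarrow> real"
  using integrable_bounded_mult[of g "\<lambda>_. 1" 1] by simp

lemma residual_return: "residual (return borel w) l j X = p l j (w, X) - Y l X $ j"
proof -
  have "mean_logits Wout (return borel w) l X = head_output Wout l X w"
    unfolding mean_logits_def
    by (rule integral_return) (auto intro: borel_measurable_continuous_onI head_output_continuous)
  also have "\<dots> = (\<chi> m. \<psi> l m (w, X))" by (simp add: \<psi>_def vec_eq_iff)
  finally show ?thesis by (simp add: residual_def p_def)
qed

text \<open>At a Dirac mass the residual is a smooth function of head and tokens minus the label, so
  the two are split. The factor 1 is the trivial weight that fits
  \<open>has_derivative_expectation\<close>.\<close>

lemma first_variation_deriv_return:
  "first_variation_deriv (return borel w) w b = (1 / real CARD('l)) * (\<Sum>l\<in>UNIV. \<Sum>j\<in>UNIV.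
     (\<integral>X. 1 * (p l j (w, X) * d\<psi> l j b (w, X)) \<partial>D) - (\<integral>X. Y l X $ j * d\<psi> l j b (w, X) \<partial>D))"
proof -
  have "integrable D (\<lambda>X. p l j (w, X) * d\<psi> l j b (w, X))" for l j
    using integrable_continuous[OF continuous_on_mult[OF ck_continuous[OF ck_p[of 0]] ck_continuous[OF ck_d\<psi>[of 0]]]] .
  moreover have "integrable D (\<lambda>X. Y l X $ j * d\<psi> l j b (w, X))" for l j
    by (rule integrable_bounded_mult[OF ck_continuous[OF ck_d\<psi>[of 0]] label_measurable label_bound])
  ultimately show ?thesis
    unfolding first_variation_deriv_def residual_return left_diff_distrib by simp
qed

text \<open>The product rule on p times \<open>d\<psi>\<close> gives p times
  \<open>dd\<psi>\<close>, part of the Hessian at frozen measure, and the Gauss-Newton term, which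
  is due to the measure moving with w.\<close>

lemma first_variation_deriv_return_has_derivative:
  "((\<lambda>w. first_variation_deriv (return borel w) w b) has_derivative risk_hessian w b) (at w)"
  unfolding first_variation_deriv_return risk_hessian_def
proof (intro has_derivative_mult_right has_derivative_sum has_derivative_diff)
  fix l j
  define P' where "P' z h = p l j z * frechet_derivative (d\<psi> l j b) (at z) h
    + (\<Sum>i\<in>UNIV. S l j i z * frechet_derivative (\<psi> l i) (at z) h) * d\<psi> l j b z" for z h
  have p': "(p l j has_derivative (\<lambda>h. \<Sum>i\<in>UNIV. S l j i z * frechet_derivative (\<psi> l i) (at z) h)) (at z)" for z
    unfolding p_def S_def by (intro has_derivative_softmax_nth ck_frechet(1)[OF ck_\<psi>])
  have "((\<lambda>w. \<integral>X. 1 * (\<lambda>z. p l j z * d\<psi> l j b z) (w, X) \<partial>D) has_derivative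
      (\<lambda>u. \<integral>X. 1 * P' (w, X) (u, 0) \<partial>D)) (at w)"
  proof (rule has_derivative_expectation[where M = 1])
    show "((\<lambda>z. p l j z * d\<psi> l j b z) has_derivative P' z) (at z)" for z
      unfolding P'_def by (intro has_derivative_mult p' ck_frechet(1)[OF ck_d\<psi>])
    show "continuous_on UNIV (\<lambda>z. P' z h)" for h
      unfolding P'_def
      by (intro continuous_intros S_continuous ck_continuous[OF ck_p[of 0]] ck_continuous[OF ck_d\<psi>[of 0]]
          ck_continuous[OF ck_frechet(2)[OF ck_d\<psi>[of "Suc 0"]]] ck_continuous[OF ck_frechet(2)[OF ck_\<psi>[of "Suc 0"]]])
  qed simp_all
  then show "((\<lambda>w. \<integral>X. 1 * (p l j (w, X) * d\<psi> l j b (w, X)) \<partial>D) has_derivative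
      (\<lambda>u. \<integral>X. p l j (w, X) * dd\<psi> l j b u (w, X) + (\<Sum>i\<in>UNIV. S l j i (w, X) * d\<psi> l i u (w, X)) * d\<psi> l j b (w, X) \<partial>D)) (at w)"
    by (simp add: P'_def dd\<psi>_def d\<psi>_def)
  show "((\<lambda>w. \<integral>X. Y l X $ j * d\<psi> l j b (w, X) \<partial>D) has_derivative (\<lambda>u. \<integral>X. Y l X $ j * dd\<psi> l j b u (w, X) \<partial>D)) (at w)"
    unfolding dd\<psi>_def
    by (rule has_derivative_expectation[OF ck_frechet(1)[OF ck_d\<psi>] ck_continuous[OF ck_frechet(2)[OF ck_d\<psi>[of "Suc 0"]]]
          label_measurable label_bound])
qed

lemma integrable_gauss_newton:
  "integrable D (\<lambda>X. (\<Sum>i\<in>UNIV. S l j i (w, X) * d\<psi> l i u (w, X)) * d\<psi> l j b (w, X))"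
proof -
  have "continuous_on UNIV (\<lambda>z. (\<Sum>i\<in>UNIV. S l j i z * d\<psi> l i u z) * d\<psi> l j b z)"
    by (intro continuous_intros S_continuous ck_continuous[OF ck_d\<psi>[of 0]])
  from integrable_continuous[OF this] show ?thesis .
qed

text \<open>Schwarz's theorem treats the second derivatives. The Gauss-Newton part is symmetric
  because \<open>softmax_cov\<close> is, but only after summation over both output indices; hence
  the sum over j is first moved inside the integral.\<close>

lemma risk_hessian_symmetric: "risk_hessian w b u = risk_hessian w u b"
proof -
  have "integrable D (\<lambda>X. p l j (w, X) * dd\<psi> l j b u (w, X))"
    for l j b u
    using integrable_continuous[OF continuous_on_mult[OF ck_continuous[OF ck_p[of 0]] dd\<psi>_continuous]] .
  note int = this integrable_gauss_newton
  have eq: "risk_hessian w b u = (1 / real CARD('l)) * (\<Sum>l\<in>UNIV.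
      (\<integral>X. (\<Sum>j\<in>UNIV. (\<Sum>i\<in>UNIV. S l j i (w, X) * d\<psi> l i u (w, X)) * d\<psi> l j b (w, X)) \<partial>D)
      + (\<Sum>j\<in>UNIV. (\<integral>X. p l j (w, X) * dd\<psi> l j b u (w, X) \<partial>D) - (\<integral>X. Y l X $ j * dd\<psi> l j b u (w, X) \<partial>D)))" for b u
    unfolding risk_hessian_def
    by (simp add: Bochner_Integration.integral_add[OF int] Bochner_Integration.integral_sum[OF int(2)] sum.distrib sum_subtractf)
  have "(\<Sum>j\<in>UNIV. (\<Sum>i\<in>UNIV. S l j i (w, X) * d\<psi> l i u (w, X)) * d\<psi> l j b (w, X))
      = (\<Sum>j\<in>UNIV. (\<Sum>i\<in>UNIV. S l j i (w, X) * d\<psi> l i b (w, X)) * d\<psi> l j u (w, X))" for l X b u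
    unfolding sum_distrib_right
    by (subst sum.swap) (simp add: S_def softmax_cov_symmetric[of _ i j for i j] mult_ac)
  then show ?thesis
    unfolding eq using dd\<psi>_symmetric by simp
qed

definition risk_hessian_operator :: "('x, 'k) head \<Rightarrow> ('x, 'k) head \<Rightarrow> ('x, 'k) head" where
  "risk_hessian_operator w u = (\<Sum>b\<in>Basis. risk_hessian w b u *\<^sub>R b)"

lemma particle_velocity_has_derivative:
  "(particle_velocity has_derivative risk_hessian_operator w) (at w)"
proof -
  have "particle_velocity = (\<lambda>w. \<Sum>b\<in>Basis. first_variation_deriv (return borel w) w b *\<^sub>R b)"
    using particle_velocity_def by blast
  moreover have "risk_hessian_operator w = (\<lambda>u. \<Sum>b\<in>Basis. risk_hessian w b u *\<^sub>R b)"
    using risk_hessian_operator_def by blast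
  ultimately show ?thesis
    by (simp only:) (intro has_derivative_sum has_derivative_scaleR_left first_variation_deriv_return_has_derivative)
qed

lemma risk_hessian_operator_symmetric:
  "risk_hessian_operator w x \<bullet> y = x \<bullet> risk_hessian_operator w y"
proof (rule linear_symmetric_of_Basis)
  show "linear (risk_hessian_operator w)"
    using particle_velocity_has_derivative has_derivative_linear by blast
  show "risk_hessian_operator w b \<bullet> c = b \<bullet> risk_hessian_operator w c" if "b \<in> Basis" "c \<in> Basis" for b c
    using that risk_hessian_symmetric[of w b c]
    by (simp add: risk_hessian_operator_def inner_commute[of b])
qed

lemma head_output_has_derivative:
  fixes l :: 'l and X :: "('x, 'l) tokens" and \<omega> :: "('x, 'k) head"
  shows "(head_output Wout l X has_derivative (\<lambda>u. \<chi> j. d\<psi> l j u (\<omega>, X))) (at \<omega>)"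
proof (subst has_derivative_componentwise_within, rule ballI)
  fix i :: "real ^ 'v" assume "i \<in> Basis"
  then obtain j where i: "i = axis j 1" by (auto simp: Basis_vec_def)
  have "((\<lambda>\<omega>. \<psi> l j (\<omega>, X)) has_derivative (\<lambda>u. frechet_derivative (\<psi> l j) (at (\<omega>, X)) (u, 0))) (at \<omega>)"
    by (rule has_derivative_compose[OF _ ck_frechet(1)[OF ck_\<psi>]])
       (auto intro!: derivative_eq_intros)
  then show "((\<lambda>x. head_output Wout l X x \<bullet> i) has_derivative (\<lambda>x. (\<chi> j. d\<psi> l j x (\<omega>, X)) \<bullet> i)) (at \<omega>)"
    by (simp add: i inner_axis \<psi>_def d\<psi>_def)
qed

text \<open>With the measure frozen, only \<open>d\<psi>\<close> is differentiated and the residual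
  p - Y remains a weight; this is the Hessian summand. Testing the adjoint against basis vectors
  turns the second summand into the Gauss-Newton terms. Membership in K makes the Dirac mass at w
  admissible for the gradient formula.\<close>

lemma H_tr_eq_risk_hessian_operator:
  assumes "w \<in> K"
  shows "H_tr D Wout Y w u = risk_hessian_operator w u"
proof -
  have mem: "return borel w \<in> prob_measures_on K"
    by (simp add: return_mem_prob_measures_on[OF compact_K] assms)
  let ?r = "residual (return borel w)"
  have grad: "gradient (\<Phi> (return borel w)) = (\<lambda>\<omega>. \<Sum>b\<in>Basis. first_variation_deriv (return borel w) \<omega> b *\<^sub>R b)"
    by (rule ext, rule euclidean_eqI) (simp add: gradient_first_variation_inner[OF mem])
  have "(gradient (\<Phi> (return borel w)) has_derivative (\<lambda>u. \<Sum>b\<in>Basis. ((1 / real CARD('l)) *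
      (\<Sum>l\<in>UNIV. \<Sum>j\<in>UNIV. \<integral>X. ?r l j X * dd\<psi> l j b u (w, X) \<partial>D)) *\<^sub>R b)) (at w)"
    unfolding grad first_variation_deriv_def dd\<psi>_def
    by (intro has_derivative_sum has_derivative_scaleR_left has_derivative_mult_right
        has_derivative_expectation[OF ck_frechet(1)[OF ck_d\<psi>] ck_continuous[OF ck_frechet(2)[OF ck_d\<psi>[of "Suc 0"]]]
          residual_measurable[OF mem] residual_bound])
  from jacobian_apply[OF this]
  have part1: "jacobian (gradient (\<Phi> (return borel w))) w u = (\<Sum>b\<in>Basis. ((1 / real CARD('l)) *
      (\<Sum>l\<in>UNIV. \<Sum>j\<in>UNIV. \<integral>X. ?r l j X * dd\<psi> l j b u (w, X) \<partial>D)) *\<^sub>R b)"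
    by simp
  define Q where "Q l j b X = (\<Sum>i\<in>UNIV. S l j i (w, X) * d\<psi> l i u (w, X)) * d\<psi> l j b (w, X)" for l j b X
  have intQ: "integrable D (Q l j b)" for l j b
    unfolding Q_def by (rule integrable_gauss_newton)
  define V where "V l X = (let J = blinfun_apply (jacobian (head_output Wout l X) w);
            S = softmax_cov (softmax (head_output Wout l X w))
        in adjoint J (S *v J u))" for l :: 'l and X :: "('x, 'l) tokens"
  have V: "V l X \<bullet> b = (\<Sum>j\<in>UNIV. Q l j b X)" for l X b
  proof -
    define J where "J = blinfun_apply (jacobian (head_output Wout l X) w)"
    have J: "J = (\<lambda>u. \<chi> j. d\<psi> l j u (w, X))"
      unfolding J_def by (rule jacobian_apply[OF head_output_has_derivative])
    have lin: "linear J"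
      unfolding J_def by (rule bounded_linear.linear[OF blinfun.bounded_linear_right])
    have h: "head_output Wout l X w = (\<chi> m. \<psi> l m (w, X))" by (simp add: \<psi>_def vec_eq_iff)
    let ?S = "softmax_cov (softmax (head_output Wout l X w))"
    have "adjoint J (?S *v J u) \<bullet> b = (?S *v J u) \<bullet> J b"
      using adjoint_works[OF lin, of b "?S *v J u"] by (simp add: inner_commute)
    also have "\<dots> = (\<Sum>j\<in>UNIV. Q l j b X)"
      by (simp add: inner_vec_def matrix_vector_mult_def J Q_def S_def h)
    finally show ?thesis by (simp add: V_def Let_def J_def)
  qed
  have pointwise: "(1 / real CARD('l)) *\<^sub>R (\<Sum>l\<in>UNIV. V l X)
      = (\<Sum>b\<in>Basis. ((1 / real CARD('l)) * (\<Sum>l\<in>UNIV. \<Sum>j\<in>UNIV. Q l j b X)) *\<^sub>R b)" for X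
  proof (rule euclidean_eqI)
    fix b :: "('x, 'k) head" assume b: "b \<in> Basis"
    have "((1 / real CARD('l)) *\<^sub>R (\<Sum>l\<in>UNIV. V l X)) \<bullet> b
        = (1 / real CARD('l)) * (\<Sum>l\<in>UNIV. \<Sum>j\<in>UNIV. Q l j b X)"
      by (simp add: inner_sum_left V)
    then show "((1 / real CARD('l)) *\<^sub>R (\<Sum>l\<in>UNIV. V l X)) \<bullet> b
        = (\<Sum>b\<in>Basis. ((1 / real CARD('l)) * (\<Sum>l\<in>UNIV. \<Sum>j\<in>UNIV. Q l j b X)) *\<^sub>R b) \<bullet> b"
      by (simp only: inner_sum_left_Basis[OF b])
  qed
  have part2: "(\<integral>X. (\<Sum>b\<in>Basis. ((1 / real CARD('l)) * (\<Sum>l\<in>UNIV. \<Sum>j\<in>UNIV. Q l j b X)) *\<^sub>R b) \<partial>D)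
      = (\<Sum>b\<in>Basis. ((1 / real CARD('l)) * (\<Sum>l\<in>UNIV. \<Sum>j\<in>UNIV. \<integral>X. Q l j b X \<partial>D)) *\<^sub>R b)"
    by (simp add: intQ)
  have intp: "integrable D (\<lambda>X. p l j (w, X) * dd\<psi> l j b u (w, X))" for l j b
    using integrable_continuous[OF continuous_on_mult[OF ck_continuous[OF ck_p[of 0]] dd\<psi>_continuous]] .
  have intY: "integrable D (\<lambda>X. Y l X $ j * dd\<psi> l j b u (w, X))" for l j b
    by (rule integrable_bounded_mult[OF dd\<psi>_continuous label_measurable label_bound])
  have comb: "(\<integral>X. ?r l j X * dd\<psi> l j b u (w, X) \<partial>D) + (\<integral>X. Q l j b X \<partial>D)
      = (\<integral>X. p l j (w, X) * dd\<psi> l j b u (w, X) + Q l j b X \<partial>D) - (\<integral>X. Y l X $ j * dd\<psi> l j b u (w, X) \<partial>D)" for l j b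
    unfolding residual_return left_diff_distrib by (simp add: intp intY intQ)
  show ?thesis
    unfolding H_tr_def V_def[symmetric] part1 pointwise part2 risk_hessian_operator_def risk_hessian_def
      Q_def[symmetric] comb[symmetric]
    by (simp only: sum.distrib distrib_left scaleR_add_left)
qed

end

section \<open>Instability of the stationary solution\<close>

lemma learning_rate_assumptionD:
  assumes "learning_rate_assumption \<zeta>"
  shows "continuous_on {0..} \<zeta>" "\<And>t. t \<ge> 0 \<Longrightarrow> 0 \<le> \<zeta> t" "\<And>M. \<exists>t\<ge>0. M < integral {0..t} \<zeta>"
    and "\<exists>Z. \<forall>t\<ge>0. \<zeta> t \<le> Z"
proof -
  show c: "continuous_on {0..} \<zeta>"
    using assms lipschitz_on_continuous_on unfolding learning_rate_assumption_def by blast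
  show n: "0 \<le> \<zeta> t" if "t \<ge> 0" for t
    using assms that unfolding learning_rate_assumption_def by blast
  show "\<exists>t\<ge>0. M < integral {0..t} \<zeta>" for M
    by (rule learning_rate_integral_unbounded[OF c n])
       (use assms in \<open>auto simp: learning_rate_assumption_def\<close>)
  have "bounded (\<zeta> ` {0..})"
    using assms unfolding learning_rate_assumption_def by blast
  then obtain Z where "\<forall>y\<in>\<zeta> ` {0..}. norm y \<le> Z" unfolding bounded_iff by blast
  then have "\<zeta> t \<le> Z" if "t \<ge> 0" for t
    using that by (force simp: abs_le_iff)
  then show "\<exists>Z. \<forall>t\<ge>0. \<zeta> t \<le> Z" by blast
qed

lemma tokens_norm_bound:
  fixes Kx :: "(real ^ 'x::finite) set"
  assumes "compact Kx"
  obtains R where "\<And>X::real ^ 'x ^ 'l::finite. \<forall>r. X $ r \<in> Kx \<Longrightarrow> norm X \<le> R"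
proof -
  obtain B where B: "\<forall>x\<in>Kx. norm x \<le> B"
    using compact_imp_bounded[OF assms] unfolding bounded_iff by blast
  have "norm X \<le> (\<Sum>r\<in>(UNIV :: 'l set). B)" if "\<forall>r. X $ r \<in> Kx" for X :: "real ^ 'x ^ 'l"
    by (subst norm_vec_def, rule order_trans[OF L2_set_le_sum sum_mono]) (use that B in auto)
  then show thesis by (rule that)
qed

text \<open>The derivative is taken within \<open>{0..}\<close>, as curves carry meaning for
  nonnegative times only, and it is claimed for every solution from the perturbed mass, so
  uniqueness is not presupposed.\<close>

theorem theorem7p8:
  fixes D :: "('x::finite, 'l::{finite,linorder}) tokens measure"
    and Wout :: "real ^ 'v::finite ^ 'x"
    and Y :: "'l \<Rightarrow> ('x, 'l) tokens \<Rightarrow> real ^ 'v"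
    and \<zeta> :: "real \<Rightarrow> real"
    and K :: "('x, 'k::finite) head set"
    and Kx :: "(real ^ 'x) set"
    and \<omega>s v :: "('x, 'k) head"
  assumes input: "prob_space D" "sets D = sets borel"
    and labels: "\<And>l. Y l \<in> borel_measurable D" "AE X in D. \<forall>l. one_hot (Y l X)"
    and rate: "learning_rate_assumption \<zeta>"
    and smooth: "smoothness_assumption D Wout K Kx"
    and stationary: "stationary_solution D Wout Y \<zeta> K (return borel \<omega>s)"
    and v_norm: "norm v = 1"
    and v_neg: "v \<bullet> H_tr D Wout Y \<omega>s v < 0"
    and solutions_in_K: "\<forall>\<^sub>F \<epsilon> in at_right 0. \<exists>\<rho>. weak_solution D Wout Y \<zeta> K \<rho> \<and>
          \<rho> 0 = return borel (\<omega>s + \<epsilon> *\<^sub>R v)"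
  shows "\<not> lyapunov_stable D Wout Y \<zeta> K (return borel \<omega>s) \<and>
    (0 < \<zeta> 0 \<longrightarrow>
      (\<forall>\<^sub>F \<epsilon> in at_right 0. \<forall>\<rho>. weak_solution D Wout Y \<zeta> K \<rho> \<and>
          \<rho> 0 = return borel (\<omega>s + \<epsilon> *\<^sub>R v) \<longrightarrow>
        (\<exists>d>0. ((\<lambda>t. (W2 (\<rho> t) (return borel \<omega>s))\<^sup>2) has_real_derivative d)
                 (at 0 within {0..}))))"
proof -
  have K: "compact K" and Kx: "compact Kx" "AE X in D. \<forall>r. X $ r \<in> Kx"
    using smooth unfolding smoothness_assumption_def by auto
  obtain R where R: "\<And>X::('x, 'l) tokens. \<forall>r. X $ r \<in> Kx \<Longrightarrow> norm X \<le> R"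
    using tokens_norm_bound[OF Kx(1)] by blast
  have AE_R: "AE X in D. norm X \<le> R"
    using Kx(2) by eventually_elim (rule R)
  interpret attention_flow D R Wout Y K
  proof (rule attention_flow.intro)
    show "bounded_input D R"
      by (rule bounded_input.intro, fact input(1), rule bounded_input_axioms.intro)
         (fact input(2), fact AE_R)
    show "attention_flow_axioms D Y K"
      by (rule attention_flow_axioms.intro) (fact labels(1), fact labels(2), fact K)
  qed
  note \<zeta> = learning_rate_assumptionD[OF rate]
  obtain Z where Z: "\<And>t. t \<ge> 0 \<Longrightarrow> \<zeta> t \<le> Z" using \<zeta>(4) by blast
  define G where "G = particle_velocity"
  define H where "H = risk_hessian_operator \<omega>s"
  have Dirac: "\<exists>m. m 0 = w \<and> (\<forall>t\<ge>0. m t \<in> K \<and> \<rho> t = return borel (m t) \<and>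
      (m has_vector_derivative (- 2 * \<zeta> t) *\<^sub>R G (m t)) (at t within {0..}))"
    if "weak_solution D Wout Y \<zeta> K \<rho>" "\<rho> 0 = return borel w" for \<rho> w
    unfolding G_def
    by (rule exI[of _ "\<lambda>t. \<integral>\<omega>. \<omega> \<partial>\<rho> t"], intro conjI allI impI;
        rule weak_solution_from_Dirac[OF that \<zeta>(1,2) Z]; assumption)
  have "return borel \<omega>s \<in> prob_measures_on K"
    using stationary unfolding stationary_solution_def weak_solution_def by auto
  then have \<omega>s: "\<omega>s \<in> K" by (simp add: return_mem_prob_measures_on[OF K])
  have G': "(G has_derivative H) (at \<omega>s)"
    unfolding G_def H_def by (rule particle_velocity_has_derivative)
  have neg: "v \<bullet> H v < 0"
    using v_neg unfolding H_def H_tr_eq_risk_hessian_operator[OF \<omega>s] .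
  \<comment> \<open>Stationarity makes the constant curve obey the particle equation, so \<zeta> t
    times G \<omega>s is 0 for all t; a nonzero velocity would force \<zeta> to vanish identically,
    against the divergence of its integral.\<close>
  have G0: "G \<omega>s = 0"
  proof (rule ccontr)
    assume "G \<omega>s \<noteq> 0"
    have "\<zeta> t = 0" if "t \<ge> 0" for t
    proof -
      have "((\<lambda>t. \<integral>\<omega>. \<omega> \<partial>return borel \<omega>s) has_vector_derivative
          (- 2 * \<zeta> t) *\<^sub>R G (\<integral>\<omega>. \<omega> \<partial>return borel \<omega>s)) (at t within {0..})"
        unfolding G_def
        using weak_solution_from_Dirac(4)[OF stationary[unfolded stationary_solution_def] refl \<zeta>(1,2) Z that] .
      moreover have "(\<integral>\<omega>. \<omega> \<partial>return borel \<omega>s) = \<omega>s"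
        by (rule integral_return) auto
      ultimately have "((\<lambda>t. \<omega>s) has_vector_derivative (- 2 * \<zeta> t) *\<^sub>R G \<omega>s) (at t within {0..})"
        by simp
      moreover have "((\<lambda>t. \<omega>s) has_vector_derivative 0) (at t within {0..})"
        by (rule has_vector_derivative_const)
      \<comment> \<open>Uniqueness of the derivative needs t to be an accumulation point, also at
        the endpoint 0.\<close>
      moreover have "at t within {0..} \<noteq> bot"
      proof -
        have "at_right t \<le> at t within {0..}"
          by (rule at_le) (use that in auto)
        then show ?thesis
          using trivial_limit_at_right_real[of t] by (metis bot.extremum_uniqueI)
      qed
      ultimately have "(- 2 * \<zeta> t) *\<^sub>R G \<omega>s = 0"
        using vector_derivative_unique_within by blast
      then show ?thesis using \<open>G \<omega>s \<noteq> 0\<close> by simp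
    qed
    then have "integral {0..t} \<zeta> = integral {0..t} (\<lambda>_. 0)" if "t \<ge> 0" for t
      by (intro Henstock_Kurzweil_Integration.integral_cong) simp
    then show False using \<zeta>(3)[of 0] by auto
  qed
  have sym: "H x \<bullet> y = x \<bullet> H y" for x y
    unfolding H_def by (rule risk_hessian_operator_symmetric)
  obtain \<eta> where \<eta>: "\<eta> > 0"
    "\<And>\<epsilon> m. \<epsilon> > 0 \<Longrightarrow> m 0 = \<omega>s + \<epsilon> *\<^sub>R v \<Longrightarrow>
      (\<And>t. t \<ge> 0 \<Longrightarrow> (m has_vector_derivative (- 2 * \<zeta> t) *\<^sub>R G (m t)) (at t within {0..})) \<Longrightarrow>
      \<exists>t\<ge>0. \<eta> \<le> norm (m t - \<omega>s)"
    using gradient_flow_leaves_neighbourhood[OF G' G0 sym neg v_norm \<zeta>(1-3)] by blast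
  have "\<not> lyapunov_stable D Wout Y \<zeta> K (return borel \<omega>s)"
  proof
    assume "lyapunov_stable D Wout Y \<zeta> K (return borel \<omega>s)"
    then obtain \<delta> where \<delta>: "\<delta> > 0"
      "\<And>\<rho> t. weak_solution D Wout Y \<zeta> K \<rho> \<Longrightarrow> W2 (\<rho> 0) (return borel \<omega>s) < \<delta> \<Longrightarrow> t \<ge> 0 \<Longrightarrow>
        W2 (\<rho> t) (return borel \<omega>s) < \<eta>"
      using \<eta>(1) unfolding lyapunov_stable_def by blast
    \<comment> \<open>Since v is a unit vector, the perturbed mass starts at distance exactly
      \<epsilon>; any small enough \<epsilon> < \<delta> refutes \<delta>.\<close>
    have "\<forall>\<^sub>F \<epsilon> in at_right (0::real). \<epsilon> \<in> {0<..<\<delta>}"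
      using \<delta>(1) by (rule eventually_at_right_real)
    with solutions_in_K have "\<forall>\<^sub>F \<epsilon> in at_right 0. \<epsilon> \<in> {0<..<\<delta>} \<and>
        (\<exists>\<rho>. weak_solution D Wout Y \<zeta> K \<rho> \<and> \<rho> 0 = return borel (\<omega>s + \<epsilon> *\<^sub>R v))"
      by eventually_elim simp
    from eventually_happens'[OF trivial_limit_at_right_real this]
    obtain \<epsilon> \<rho> where "\<epsilon> \<in> {0<..<\<delta>}"
      and \<rho>: "weak_solution D Wout Y \<zeta> K \<rho>" "\<rho> 0 = return borel (\<omega>s + \<epsilon> *\<^sub>R v)"
      by (elim exE conjE)
    then have \<epsilon>: "0 < \<epsilon>" "\<epsilon> < \<delta>" by simp_all
    obtain m where m: "m 0 = \<omega>s + \<epsilon> *\<^sub>R v" "\<And>t. t \<ge> 0 \<Longrightarrow> \<rho> t = return borel (m t)"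
      "\<And>t. t \<ge> 0 \<Longrightarrow> (m has_vector_derivative (- 2 * \<zeta> t) *\<^sub>R G (m t)) (at t within {0..})"
      using Dirac[OF \<rho>] by blast
    have "W2 (\<rho> 0) (return borel \<omega>s) < \<delta>"
      using \<epsilon> v_norm by (simp add: \<rho>(2) W2_return dist_norm)
    then have "W2 (\<rho> t) (return borel \<omega>s) < \<eta>" if "t \<ge> 0" for t
      using \<delta>(2)[OF \<rho>(1)] that by blast
    then have "norm (m t - \<omega>s) < \<eta>" if "t \<ge> 0" for t
      using that m(2)[OF that] by (metis W2_return dist_norm)
    moreover obtain t where "t \<ge> 0" "\<eta> \<le> norm (m t - \<omega>s)"
      using \<eta>(2)[OF \<epsilon>(1) m(1,3)] by blast
    ultimately show False by force
  qed
  moreover have "\<forall>\<^sub>F \<epsilon> in at_right 0. \<forall>\<rho>. weak_solution D Wout Y \<zeta> K \<rho> \<and>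
          \<rho> 0 = return borel (\<omega>s + \<epsilon> *\<^sub>R v) \<longrightarrow>
        (\<exists>d>0. ((\<lambda>t. (W2 (\<rho> t) (return borel \<omega>s))\<^sup>2) has_real_derivative d) (at 0 within {0..}))"
    if "0 < \<zeta> 0"
  proof -
    \<comment> \<open>This function of \<epsilon> vanishes at 0 by \<open>G0\<close> and has
      negative slope there, so just to the right of 0 the descent direction - G has a positive
      component along v.\<close>
    have "((\<lambda>\<epsilon>. v \<bullet> G (\<omega>s + \<epsilon> *\<^sub>R v)) has_real_derivative v \<bullet> H v) (at 0)"
    proof -
      have "((\<lambda>\<epsilon>. G (\<omega>s + \<epsilon> *\<^sub>R v)) has_derivative (\<lambda>r. H (r *\<^sub>R v))) (at 0)"
        by (rule has_derivative_compose[of _ "\<lambda>r. r *\<^sub>R v"])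
           (use G' in \<open>auto intro!: derivative_eq_intros\<close>)
      then have "((\<lambda>\<epsilon>. v \<bullet> G (\<omega>s + \<epsilon> *\<^sub>R v)) has_derivative (\<lambda>r. v \<bullet> H (r *\<^sub>R v))) (at 0)"
        by (rule has_derivative_inner_right)
      then show ?thesis
        unfolding has_field_derivative_def
        by (rule has_derivative_eq_rhs)
           (simp add: fun_eq_iff linear_cmul[OF has_derivative_linear[OF G']])
    qed
    from DERIV_neg_dec_right[OF this neg] obtain d where d: "d > 0"
      "\<And>h. h > 0 \<Longrightarrow> h < d \<Longrightarrow> v \<bullet> G (\<omega>s + h *\<^sub>R v) < 0"
      by (auto simp: G0)
    have "\<forall>\<^sub>F \<epsilon> in at_right (0::real). \<epsilon> \<in> {0<..<d}"
      using d(1) by (rule eventually_at_right_real)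
    then show ?thesis
    proof (rule eventually_mono, intro allI impI)
      fix \<epsilon> \<rho>
      assume \<epsilon>: "\<epsilon> \<in> {0<..<d}"
        and "weak_solution D Wout Y \<zeta> K \<rho> \<and> \<rho> 0 = return borel (\<omega>s + \<epsilon> *\<^sub>R v)"
      then obtain m where m: "m 0 = \<omega>s + \<epsilon> *\<^sub>R v" "\<And>t. t \<ge> 0 \<Longrightarrow> \<rho> t = return borel (m t)"
        "\<And>t. t \<ge> 0 \<Longrightarrow> (m has_vector_derivative (- 2 * \<zeta> t) *\<^sub>R G (m t)) (at t within {0..})"
        using Dirac by blast
      \<comment> \<open>Twice the inner product of the displacement m 0 - \<omega>s = \<epsilon> v
        with the initial velocity - 2 \<zeta> 0 G (m 0).\<close>
      define c where "c = - 4 * \<zeta> 0 * \<epsilon> * (v \<bullet> G (\<omega>s + \<epsilon> *\<^sub>R v))"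
      have "((\<lambda>t. m t - \<omega>s) has_derivative (\<lambda>r. r *\<^sub>R ((- 2 * \<zeta> 0) *\<^sub>R G (m 0)))) (at 0 within {0..})"
        using m(3)[of 0] unfolding has_vector_derivative_def
        by (auto intro!: derivative_eq_intros)
      from has_derivative_inner[OF this this]
      have "((\<lambda>t. (m t - \<omega>s) \<bullet> (m t - \<omega>s)) has_real_derivative c) (at 0 within {0..})"
        unfolding has_field_derivative_def
        by (rule has_derivative_eq_rhs) (simp add: fun_eq_iff m(1) c_def inner_commute[of "G _"])
      then have "((\<lambda>t. (W2 (\<rho> t) (return borel \<omega>s))\<^sup>2) has_real_derivative c) (at 0 within {0..})"
        by (rule has_field_derivative_transform_within[of _ _ _ _ 1])
           (use m(2) in \<open>auto simp: W2_return dist_norm power2_norm_eq_inner\<close>)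
      moreover have "c > 0"
        using d(2)[of \<epsilon>] \<epsilon> \<open>0 < \<zeta> 0\<close> by (simp add: c_def mult_pos_neg)
      ultimately show "\<exists>d>0. ((\<lambda>t. (W2 (\<rho> t) (return borel \<omega>s))\<^sup>2) has_real_derivative d) (at 0 within {0..})"
        by blast
    qed
  qed
  ultimately show ?thesis by blast
qed

end
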